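(* Let $\mathcal A,\mathcal B,\mathcal M$ be non-quasianalytic weight sequences with $\mathcal A\preceq\mathcal M$ and $\mathcal B\preceq\mathcal M$, and let $m,\mu\in\mathbb R$. Then every symbol $p\in \mathrm{SG}^{m,\mu}_{[\mathcal A,\mathcal B]}(\mathbb R^n)$ defines a continuous linear operator $\mathrm{Op}(p):\mathcal S_{[\mathcal M]}(\mathbb R^n)\to\mathcal S_{[\mathcal M]}(\mathbb R^n)$ through $$\mathrm{Op}(p)u(x)=(2\pi)^{-n/2}\int_{\mathbb R^n}e^{i\xi\cdot x}p(x,\xi)\widehat u(\xi)\,d\xi,\qquad u\in\mathcal S_{[\mathcal M]}(\mathbb R^n).$$
   Context: Weight sequences: a weight sequence is a sequence $\mathcal M=\{M_j\}_{j\in\mathbb N_0}$ of positive numbers with $M_0=M_1=1$; $M_j^2\le M_{j-1}M_{j+1}$ for $j\ge1$; and there are $A,H\ge1$ with $M_{j+1}\le AH^jM_j$ for all $j$. It is non-quasianalytic if $\sum_{j\ge1}M_{j-1}/M_j<\infty$. Write $\mathcal A\preceq\mathcal M$ if there are $C,H>0$ with $A_j\le CH^jM_j$ for all $j$. Bracket convention: $[\cdot]$ stands either for $\{\cdot\}$ (Roumieu) or for $(\cdot)$ (Beurling), the same choice being made throughout a statement. $\langle x\rangle=(1+|x|^2)^{1/2}$. Gelfand-Shilov spaces: for $h>0$, $\mathcal S_{\mathcal M}(\mathbb R^n;h)$ is the Banach space of $f\in C^\infty(\mathbb R^n)$ with $\sup_{x}\sup_{\alpha,\beta\in\mathbb N_0^n}h^{|\alpha|+|\beta|}M_{|\alpha|}^{-1}M_{|\beta|}^{-1}|x^\beta\partial^\alpha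 f(x)|<\infty$. $\mathcal S_{\{\mathcal M\}}(\mathbb R^n)$ is the inductive limit and $\mathcal S_{(\mathcal M)}(\mathbb R^n)$ the projective limit over $h>0$ of these spaces. Symbols: $\mathrm{SG}^{m,\mu}_{\mathcal A,\mathcal B}(\mathbb R^n;h)$ is the Banach space of $p\in C^\infty(\mathbb R^{2n})$ with $$\sup_{\alpha,\beta}\sup_{x,\xi}h^{|\alpha|+|\beta|}\frac{\langle\xi\rangle^{-\mu+|\alpha|}\langle x\rangle^{-m+|\beta|}}{A_{|\alpha|}B_{|\beta|}}|\partial_x^\beta\partial_\xi^\alpha p(x,\xi)|<\infty;$$ $\mathrm{SG}^{m,\mu}_{\{\mathcal A,\mathcal B\}}(\mathbb R^n)$ and $\mathrm{SG}^{m,\mu}_{(\mathcal A,\mathcal B)}(\mathbb R^n)$ are the inductive, respectively projective, limits over $h>0$. The Fourier transform is $\widehat u(\xi)=(2\pi)^{-n/2}\int e^{-ix\cdot\xi}u(x)\,dx$. *)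

theory Defs
  imports "HOL-Analysis.Analysis"
begin

section \<open>Weight sequences\<close>

definition weight_sequence :: "(nat \<Rightarrow> real) \<Rightarrow> bool" where
  "weight_sequence M \<longleftrightarrow>
     (\<forall>j. 0 < M j) \<and> M 0 = 1 \<and> M 1 = 1 \<and>
     (\<forall>j\<ge>1. (M j)\<^sup>2 \<le> M (j - 1) * M (j + 1)) \<and>
     (\<exists>A\<ge>1. \<exists>H\<ge>1. \<forall>j. M (j + 1) \<le> A * H ^ j * M j)"

text \<open>The sum over \<open>j \<ge> 1\<close> of \<open>M (j - 1) / M j\<close>, with the index shifted by one.\<close>

definition non_quasianalytic :: "(nat \<Rightarrow> real) \<Rightarrow> bool" where
  "non_quasianalytic M \<longleftrightarrow> summable (\<lambda>j. M j / M (j + 1))"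

definition weight_le :: "(nat \<Rightarrow> real) \<Rightarrow> (nat \<Rightarrow> real) \<Rightarrow> bool"  (infix \<open>\<preceq>\<^sub>w\<close> 50) where
  "A \<preceq>\<^sub>w M \<longleftrightarrow> (\<exists>C>0. \<exists>H>0. \<forall>j. A j \<le> C * H ^ j * M j)"


section \<open>Smooth functions and partial derivatives\<close>

definition dir_deriv :: "'a::real_normed_vector \<Rightarrow> ('a \<Rightarrow> complex) \<Rightarrow> 'a \<Rightarrow> complex" where
  "dir_deriv v f x = frechet_derivative f (at x) v"

primrec Ck :: "nat \<Rightarrow> ('a::euclidean_space \<Rightarrow> complex) \<Rightarrow> bool" where
  "Ck 0 f \<longleftrightarrow> continuous_on UNIV f"
| "Ck (Suc k) f \<longleftrightarrow> f differentiable_on UNIV \<and> (\<forall>b\<in>Basis. Ck k (dir_deriv b f))"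

definition smooth :: "('a::euclidean_space \<Rightarrow> complex) \<Rightarrow> bool" where
  "smooth f \<longleftrightarrow> (\<forall>k. Ck k f)"

text \<open>
  Multi-indices in \<open>n = CARD('n)\<close> variables are functions \<open>'n \<Rightarrow> nat\<close>. The derivative of
  multi-index \<open>\<alpha>\<close> composes, for each \<open>i\<close>, \<open>\<alpha> i\<close> partial derivatives in the \<open>i\<close>-th coordinate.
  As \<open>'n\<close> carries no order, the order of composition is an arbitrary list in which each \<open>i\<close>
  occurs \<open>\<alpha> i\<close> times; for smooth functions the result does not depend on this choice.
\<close>

definition mi_order :: "('n::finite \<Rightarrow> nat) \<Rightarrow> nat" where
  "mi_order \<alpha> = (\<Sum>i\<in>UNIV. \<alpha> i)"

definition mi_monomial :: "real ^ 'n \<Rightarrow> ('n::finite \<Rightarrow> nat) \<Rightarrow> real" where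
  "mi_monomial x \<beta> = (\<Prod>i\<in>UNIV. (x $ i) ^ \<beta> i)"

definition mi_deriv :: "('n::finite \<Rightarrow> nat) \<Rightarrow> (real ^ 'n \<Rightarrow> complex) \<Rightarrow> real ^ 'n \<Rightarrow> complex" where
  "mi_deriv \<alpha> f =
     foldr (\<lambda>i. dir_deriv (axis i 1)) (SOME is. \<forall>i. count_list is i = \<alpha> i) f"


section \<open>Inductive and projective limits of normed function spaces\<close>

text \<open>
  Both limits are taken of a family of spaces \<open>E h\<close>, \<open>h > 0\<close>, of functions with norms \<open>N h\<close>,
  connected by inclusions.
\<close>

datatype regime = Roumieu | Beurling

definition limit_space :: "regime \<Rightarrow> (real \<Rightarrow> ('a \<Rightarrow> complex) set) \<Rightarrow> ('a \<Rightarrow> complex) set" where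
  "limit_space r E =
     (case r of Roumieu \<Rightarrow> (\<Union>h\<in>{0<..}. E h) | Beurling \<Rightarrow> (\<Inter>h\<in>{0<..}. E h))"

definition is_seminorm_on :: "('a \<Rightarrow> complex) set \<Rightarrow> (('a \<Rightarrow> complex) \<Rightarrow> real) \<Rightarrow> bool" where
  "is_seminorm_on V q \<longleftrightarrow>
     (\<forall>f\<in>V. 0 \<le> q f) \<and>
     (\<forall>f\<in>V. \<forall>g\<in>V. q (\<lambda>x. f x + g x) \<le> q f + q g) \<and>
     (\<forall>c. \<forall>f\<in>V. q (\<lambda>x. c * f x) = cmod c * q f)"

definition seminorm_topology ::
    "('a \<Rightarrow> complex) set \<Rightarrow> (('a \<Rightarrow> complex) \<Rightarrow> real) set \<Rightarrow> ('a \<Rightarrow> complex) topology" where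
  "seminorm_topology V Q =
     topology_generated_by
       {{g \<in> V. q (\<lambda>x. g x - f x) < \<epsilon>} | q f \<epsilon>. q \<in> Q \<and> f \<in> V \<and> 0 < \<epsilon>}"

text \<open>
  The inductive limit carries the finest locally convex topology for which all inclusions of the
  \<open>E h\<close> are continuous. It is generated by all seminorms on the union whose restriction
  to every \<open>E h\<close> is continuous, that is, bounded by a multiple of the norm \<open>N h\<close>.
  The projective limit carries the coarsest topology for which all inclusions into the
  \<open>E h\<close> are continuous; it is generated by the norms \<open>N h\<close>.
\<close>

definition limit_seminorms ::
    "regime \<Rightarrow> (real \<Rightarrow> ('a \<Rightarrow> complex) set) \<Rightarrow> (real \<Rightarrow> ('a \<Rightarrow> complex) \<Rightarrow> real)
      \<Rightarrow> (('a \<Rightarrow> complex) \<Rightarrow> real) set" where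
  "limit_seminorms r E N =
     (case r of
        Roumieu \<Rightarrow> {q. is_seminorm_on (limit_space Roumieu E) q \<and>
                       (\<forall>h>0. \<exists>C. \<forall>f\<in>E h. q f \<le> C * N h f)}
      | Beurling \<Rightarrow> N ` {0<..})"

definition limit_topology ::
    "regime \<Rightarrow> (real \<Rightarrow> ('a \<Rightarrow> complex) set) \<Rightarrow> (real \<Rightarrow> ('a \<Rightarrow> complex) \<Rightarrow> real)
      \<Rightarrow> ('a \<Rightarrow> complex) topology" where
  "limit_topology r E N = seminorm_topology (limit_space r E) (limit_seminorms r E N)"


section \<open>Gelfand--Shilov spaces\<close>

definition gs_quotient ::
    "(nat \<Rightarrow> real) \<Rightarrow> real \<Rightarrow> (real ^ 'n \<Rightarrow> complex)
      \<Rightarrow> ('n::finite \<Rightarrow> nat) \<times> ('n \<Rightarrow> nat) \<times> (real ^ 'n) \<Rightarrow> real" where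
  "gs_quotient M h f = (\<lambda>(\<alpha>, \<beta>, x).
     h ^ (mi_order \<alpha> + mi_order \<beta>) / (M (mi_order \<alpha>) * M (mi_order \<beta>)) *
     cmod (complex_of_real (mi_monomial x \<beta>) * mi_deriv \<alpha> f x))"

definition GS_step :: "(nat \<Rightarrow> real) \<Rightarrow> real \<Rightarrow> (real ^ 'n::finite \<Rightarrow> complex) set" where
  "GS_step M h = {f. smooth f \<and> bdd_above (range (gs_quotient M h f))}"

definition GS_norm :: "(nat \<Rightarrow> real) \<Rightarrow> real \<Rightarrow> (real ^ 'n::finite \<Rightarrow> complex) \<Rightarrow> real" where
  "GS_norm M h f = (SUP z. gs_quotient M h f z)"

definition GS :: "regime \<Rightarrow> (nat \<Rightarrow> real) \<Rightarrow> (real ^ 'n::finite \<Rightarrow> complex) set" where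
  "GS r M = limit_space r (GS_step M)"

definition GS_topology ::
    "regime \<Rightarrow> (nat \<Rightarrow> real) \<Rightarrow> (real ^ 'n::finite \<Rightarrow> complex) topology" where
  "GS_topology r M = limit_topology r (GS_step M) (GS_norm M)"

lemma mi_deriv_zero: "mi_deriv \<alpha> (\<lambda>x::real ^ 'n::finite. 0) = (\<lambda>x. 0)"
proof -
  have "foldr (\<lambda>i. dir_deriv (axis i 1)) is (\<lambda>x::real ^ 'n. 0) = (\<lambda>x. 0)" for "is"
    by (induction "is") (simp_all add: dir_deriv_def [abs_def])
  then show ?thesis
    by (simp add: mi_deriv_def)
qed

lemma topspace_GS_topology:
  "topspace (GS_topology r M) = (GS r M :: (real ^ 'n::finite \<Rightarrow> complex) set)" (is "?L = ?R")
proof -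
  obtain q where q: "q \<in> limit_seminorms r (GS_step M) (GS_norm M)"
    and q0: "q (\<lambda>x::real ^ 'n. 0) = 0"
  proof (cases r)
    case Roumieu
    have "\<exists>C. \<forall>f\<in>GS_step M h. 0 \<le> C * GS_norm M h (f :: real ^ 'n \<Rightarrow> complex)" for h
      by (rule exI[of _ 0]) simp
    then have "(\<lambda>_. 0) \<in> limit_seminorms r (GS_step M) (GS_norm M :: real \<Rightarrow> (real ^ 'n \<Rightarrow> complex) \<Rightarrow> real)"
      by (simp add: limit_seminorms_def Roumieu is_seminorm_on_def)
    then show ?thesis using that by blast
  next
    case Beurling
    have "GS_norm M 1 (\<lambda>x::real ^ 'n. 0) = 0"
      by (simp add: GS_norm_def gs_quotient_def mi_deriv_zero case_prod_beta)
    then show ?thesis using that[of "GS_norm M 1"]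
      by (simp add: limit_seminorms_def Beurling)
  qed
  show ?thesis
  proof
    show "?L \<subseteq> ?R"
      by (auto simp: GS_topology_def limit_topology_def seminorm_topology_def GS_def)
    show "?R \<subseteq> ?L"
    proof
      fix f :: "real ^ 'n \<Rightarrow> complex" assume f: "f \<in> GS r M"
      then have "f \<in> {g \<in> GS r M. q (\<lambda>x. g x - f x) < 1}"
        using q0 by simp
      moreover have "{g \<in> GS r M. q (\<lambda>x. g x - f x) < 1} \<in>
          {{g \<in> GS r M. q (\<lambda>x. g x - f x) < \<epsilon>} | q f \<epsilon>.
            q \<in> limit_seminorms r (GS_step M) (GS_norm M) \<and> f \<in> GS r M \<and> 0 < \<epsilon>}"
        using q f zero_less_one by blast
      ultimately show "f \<in> topspace (GS_topology r M)"
        unfolding GS_topology_def limit_topology_def seminorm_topology_def GS_def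
          topology_generated_by_topspace
        by blast
    qed
  qed
qed


section \<open>Symbols and operators\<close>

definition jbracket :: "real ^ 'n::finite \<Rightarrow> real" where
  "jbracket x = sqrt (1 + (norm x)\<^sup>2)"

definition sg_quotient ::
    "real \<Rightarrow> real \<Rightarrow> (nat \<Rightarrow> real) \<Rightarrow> (nat \<Rightarrow> real) \<Rightarrow> real \<Rightarrow> ((real ^ 'n) \<times> (real ^ 'n) \<Rightarrow> complex)
      \<Rightarrow> ('n::finite \<Rightarrow> nat) \<times> ('n \<Rightarrow> nat) \<times> (real ^ 'n) \<times> (real ^ 'n) \<Rightarrow> real" where
  "sg_quotient m \<mu> A B h p = (\<lambda>(\<alpha>, \<beta>, x, \<xi>).
     h ^ (mi_order \<alpha> + mi_order \<beta>) *
     (jbracket \<xi> powr (- \<mu> + real (mi_order \<alpha>)) * jbracket x powr (- m + real (mi_order \<beta>)) /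
       (A (mi_order \<alpha>) * B (mi_order \<beta>))) *
     cmod (mi_deriv \<beta> (\<lambda>y. mi_deriv \<alpha> (\<lambda>\<eta>. p (y, \<eta>)) \<xi>) x))"

definition SG_step ::
    "real \<Rightarrow> real \<Rightarrow> (nat \<Rightarrow> real) \<Rightarrow> (nat \<Rightarrow> real) \<Rightarrow> real
      \<Rightarrow> ((real ^ 'n::finite) \<times> (real ^ 'n) \<Rightarrow> complex) set" where
  "SG_step m \<mu> A B h = {p. smooth p \<and> bdd_above (range (sg_quotient m \<mu> A B h p))}"

definition SG ::
    "regime \<Rightarrow> real \<Rightarrow> real \<Rightarrow> (nat \<Rightarrow> real) \<Rightarrow> (nat \<Rightarrow> real)
      \<Rightarrow> ((real ^ 'n::finite) \<times> (real ^ 'n) \<Rightarrow> complex) set" where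
  "SG r m \<mu> A B = limit_space r (SG_step m \<mu> A B)"

definition fourier_integrand ::
    "(real ^ 'n::finite \<Rightarrow> complex) \<Rightarrow> real ^ 'n \<Rightarrow> real ^ 'n \<Rightarrow> complex" where
  "fourier_integrand u \<xi> = (\<lambda>x. exp (- \<i> * complex_of_real (x \<bullet> \<xi>)) * u x)"

definition fourier :: "(real ^ 'n::finite \<Rightarrow> complex) \<Rightarrow> real ^ 'n \<Rightarrow> complex" where
  "fourier u \<xi> =
     complex_of_real ((2 * pi) powr (- real CARD('n) / 2)) * (LINT x|lborel. fourier_integrand u \<xi> x)"

definition Op_integrand ::
    "((real ^ 'n::finite) \<times> (real ^ 'n) \<Rightarrow> complex) \<Rightarrow> (real ^ 'n \<Rightarrow> complex)
      \<Rightarrow> real ^ 'n \<Rightarrow> real ^ 'n \<Rightarrow> complex" where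
  "Op_integrand p u x = (\<lambda>\<xi>. exp (\<i> * complex_of_real (\<xi> \<bullet> x)) * p (x, \<xi>) * fourier u \<xi>)"

definition Op ::
    "((real ^ 'n::finite) \<times> (real ^ 'n) \<Rightarrow> complex) \<Rightarrow> (real ^ 'n \<Rightarrow> complex) \<Rightarrow> real ^ 'n \<Rightarrow> complex" where
  "Op p u x =
     complex_of_real ((2 * pi) powr (- real CARD('n) / 2)) * (LINT \<xi>|lborel. Op_integrand p u x \<xi>)"

end

theory Submission
  imports Defs "HOL-Probability.Sinc_Integral"
begin

text \<open>
  Both the Fourier transform and \<open>Op p\<close> are of the form
  \<open>f \<mapsto> (x \<mapsto> \<integral> exp (\<plusminus>i x\<cdot>\<xi>) p(x,\<xi>) f(\<xi>) d\<xi>)\<close>, the former with a constant symbol, so a single estimate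
  for such integrals is applied twice. To bound \<open>x\<^sub>l\<^sup>b \<partial>\<^sup>\<alpha>\<close> of the integral, where \<open>x\<^sub>l\<close> is the largest
  coordinate of \<open>x\<close>, differentiate under the integral sign and integrate by parts \<open>b\<close> times in \<open>\<xi>\<^sub>l\<close>.
  By the Leibniz rule this leaves at most an exponential number of products of a derivative of a
  monomial in \<open>\<xi>\<close>, a derivative of \<open>p\<close> and a derivative of \<open>f\<close>. Log-convexity of \<open>M\<close> recombines the
  resulting weights, and \<open>k! \<le> S\<^sup>k M k\<close> absorbs the factorial from the monomial. The constant in the
  bound may depend on the parameter \<open>h\<close> of the source space, but \<open>h\<close> itself is only multiplied by a fixed
  factor; this serves both regimes.
\<close>

section \<open>Weight sequences and factorials\<close>

text \<open>The parameter \<open>h\<close> enters below as \<open>\<tau> = 1 / h\<close>. The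
  estimate must end with exactly the power of a multiple of \<open>\<tau>\<close> that matches the
  number of derivatives and of powers of x. In the Beurling case \<open>\<tau>\<close> is
  arbitrarily small, so a missing factor \<open>\<tau>\<close> cannot be covered by a geometric
  constant. Such a loss threatens in the integration by parts: b1 derivatives that fall on the
  monomial in \<xi> remove b1 powers of \<xi> and never reach \<open>p\<close> or \<open>f\<close>,
  so \<open>2 * b1\<close> factors \<open>\<tau>\<close> are lost and a factorial of b1 is left. The
  remedy is \<open>fact k * z ^ k \<le> exp z * R ^ k * (M k)\<^sup>2\<close> with z proportional to
  \<open>1 / \<tau>\<^sup>2\<close>: it returns the lost \<open>\<tau> ^ (2 * b1)\<close> at the
  price of the constant \<open>exp z\<close>, which depends on \<open>\<tau>\<close> but on no
  index. Hence the order of quantifiers in the estimates: the factor multiplying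
  \<open>\<tau>\<close> is fixed before \<open>\<tau>\<close>, the constant \<open>C\<close> after
  it.\<close>

lemma weight_pos: "weight_sequence M \<Longrightarrow> 0 < M j"
  by (simp add: weight_sequence_def)

lemma weight_0: "weight_sequence M \<Longrightarrow> M 0 = 1"
  by (simp add: weight_sequence_def)

lemma weight_ratio_mono:
  assumes "weight_sequence M" and "i \<le> j"
  shows "M (Suc i) / M i \<le> M (Suc j) / M j"
proof (rule lift_Suc_mono_le[where f="\<lambda>j. M (Suc j) / M j"])
  fix n
  have "(M (Suc n))\<^sup>2 \<le> M n * M (Suc (Suc n))"
    using assms(1) unfolding weight_sequence_def
    by (metis One_nat_def Suc_eq_plus1 diff_Suc_1 le_add2)
  then show "M (Suc n) / M n \<le> M (Suc (Suc n)) / M (Suc n)"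
    using weight_pos[OF assms(1)] by (simp add: field_simps power2_eq_square)
qed fact

text \<open>Raising b by one multiplies the left side by the ratio of \<open>M\<close> at b and the
  right side by the ratio at a + b, which is larger by log-convexity. The start uses
  \<open>M 0 = 1\<close>.\<close>

lemma weight_mult_le:
  assumes "weight_sequence M"
  shows "M a * M b \<le> M (a + b)"
proof (induction b)
  case 0
  then show ?case by (simp add: weight_0[OF assms])
next
  case (Suc b)
  note pos = weight_pos[OF assms]
  have "M (Suc b) / M b \<le> M (Suc (a + b)) / M (a + b)"
    by (rule weight_ratio_mono[OF assms]) simp
  then have "(M a * M b) * (M (Suc b) / M b) \<le> M (a + b) * (M (Suc (a + b)) / M (a + b))"
    using Suc pos by (intro mult_mono) (auto simp: less_imp_le)
  then show ?case
    using pos[of b] pos[of "a + b"] by simp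
qed

text \<open>Iteration of the growth condition. Each use below trades a fixed number of additional
  powers for a constant and an enlarged geometric factor, which is why polynomial growth of a symbol
  does no harm.\<close>

lemma weight_shift_le:
  assumes "weight_sequence M"
  obtains C R where "1 \<le> C" "1 \<le> R" "\<And>j. M (j + N) \<le> C * R ^ j * M j"
proof -
  obtain A H where AH: "1 \<le> A" "1 \<le> H" "\<And>j. M (j + 1) \<le> A * H ^ j * M j"
    using assms unfolding weight_sequence_def by blast
  have "\<exists>C R. 1 \<le> C \<and> 1 \<le> R \<and> (\<forall>j. M (j + N) \<le> C * R ^ j * M j)"
  proof (induction N)
    case 0
    then show ?case by (intro exI[of _ 1]) simp
  next
    case (Suc N)
    then obtain C R where CR: "1 \<le> C" "1 \<le> R" "\<And>j. M (j + N) \<le> C * R ^ j * M j" by blast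
    have "M (j + Suc N) \<le> (A * H ^ N * C) * (H * R) ^ j * M j" for j
    proof -
      have "M (j + Suc N) \<le> A * H ^ (j + N) * M (j + N)"
        using AH(3)[of "j + N"] by simp
      also have "\<dots> \<le> A * H ^ (j + N) * (C * R ^ j * M j)"
        using AH CR(3)[of j] by (intro mult_left_mono) auto
      finally show ?thesis by (simp add: power_add power_mult_distrib ac_simps)
    qed
    moreover have "1 \<le> A * H ^ N * C" "1 \<le> H * R"
      using AH CR mult_ge1_I one_le_power by metis+
    ultimately show ?case by blast
  qed
  then show thesis using that by blast
qed

text \<open>The only use of non-quasianalyticity: since \<open>M j / M (j + 1)\<close> decreases and is summable,
  it is at most \<open>S / (j + 1)\<close>.\<close>

lemma fact_le_weight:
  assumes "weight_sequence M" and "non_quasianalytic M"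
  obtains S where "1 \<le> S" "\<And>k. fact k \<le> S ^ k * M k"
proof -
  define a where "a j = M j / M (Suc j)" for j
  define S where "S = max 1 (suminf a)"
  note pos = weight_pos[OF assms(1)]
  have summ: "summable a"
    using assms(2) by (simp add: non_quasianalytic_def a_def[abs_def])
  have a_pos: "0 < a j" for j
    using pos by (simp add: a_def)
  have dec: "a j \<le> a i" if "i \<le> j" for i j
  proof -
    have "inverse (M (Suc j) / M j) \<le> inverse (M (Suc i) / M i)"
      using weight_ratio_mono[OF assms(1) that] pos by (intro le_imp_inverse_le) auto
    then show ?thesis by (simp add: a_def)
  qed
  have a_le: "real (Suc n) * a n \<le> S" for n
  proof -
    have "real (Suc n) * a n = (\<Sum>j<Suc n. a n)" by simp
    also have "\<dots> \<le> (\<Sum>j<Suc n. a j)"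
      by (intro sum_mono dec) simp
    also have "\<dots> \<le> suminf a"
      using a_pos by (intro sum_le_suminf summ) (auto simp: less_imp_le)
    finally show ?thesis by (simp add: S_def)
  qed
  have "fact k \<le> S ^ k * M k" for k
  proof (induction k)
    case 0
    then show ?case by (simp add: weight_0[OF assms(1)])
  next
    case (Suc k)
    have "real (Suc k) * M k \<le> S * M (Suc k)"
      using a_le[of k] pos[of "Suc k"] by (simp add: a_def field_simps)
    then have "(real (Suc k) * M k) * S ^ k \<le> (S * M (Suc k)) * S ^ k"
      by (intro mult_right_mono) (auto simp: S_def)
    moreover have "real (Suc k) * fact k \<le> real (Suc k) * (S ^ k * M k)"
      using Suc by (intro mult_left_mono) auto
    ultimately show ?case by (simp add: algebra_simps)
  qed
  then show thesis by (rule that[rotated]) (simp add: S_def)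
qed

text \<open>A single term of the exponential series is at most \<open>exp z\<close>, and
  \<open>(fact k)\<^sup>2 \<le> (S ^ k * M k)\<^sup>2\<close>. The free parameter z is what later
  lets powers of \<open>\<tau>\<close> be inserted.\<close>

lemma fact_power_le_weight:
  assumes "weight_sequence M" and "non_quasianalytic M"
  obtains R where "1 \<le> R" "\<And>z k. 0 < z \<Longrightarrow> fact k * z ^ k \<le> exp z * R ^ k * (M k)\<^sup>2"
proof -
  obtain S where S: "1 \<le> S" "\<And>k. fact k \<le> S ^ k * M k"
    using fact_le_weight[OF assms] by blast
  have "fact k * z ^ k \<le> exp z * (S\<^sup>2) ^ k * (M k)\<^sup>2" if "0 < z" for z k
  proof -
    have "z ^ k / fact k \<le> (\<Sum>n. z ^ n / fact n)"
      using sum_le_suminf[of "\<lambda>n. z ^ n / fact n" "{k}"] summable_exp[of z] that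
      by (simp add: field_simps)
    also have "\<dots> = exp z"
      by (simp add: exp_def divide_inverse mult.commute)
    finally have "z ^ k / fact k * (fact k)\<^sup>2 \<le> exp z * (S ^ k * M k)\<^sup>2"
      using S by (intro mult_mono power_mono) auto
    then show ?thesis
      by (simp add: power_mult_distrib power2_eq_square ac_simps)
  qed
  then show thesis using that[of "S\<^sup>2"] S(1) by simp
qed

section \<open>Calculus of smooth functions\<close>

lemma dir_deriv_eq:
  assumes "(f has_derivative f') (at x)"
  shows "dir_deriv v f x = f' v"
  using frechet_derivative_at[OF assms] by (simp add: dir_deriv_def)

lemma smooth_differentiable:
  assumes "smooth f"
  shows "f differentiable (at x)"
  using assms Ck.simps(2)[of 0 f] by (simp add: smooth_def differentiable_on_def)

lemma smooth_has_derivative: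
  assumes "smooth f"
  shows "(f has_derivative (\<lambda>v. dir_deriv v f x)) (at x)"
  using smooth_differentiable[OF assms, of x]
  unfolding dir_deriv_def frechet_derivative_works by simp

lemma smooth_continuous_on: "smooth f \<Longrightarrow> continuous_on S f"
  by (metis Ck.simps(1) continuous_on_subset smooth_def subset_UNIV)

lemma smoothI:
  assumes "f differentiable_on UNIV" "\<And>b. b \<in> Basis \<Longrightarrow> smooth (dir_deriv b f)"
  shows "smooth f"
  unfolding smooth_def
proof
  fix k
  show "Ck k f"
    using assms by (cases k) (auto simp: smooth_def intro: differentiable_imp_continuous_on)
qed

text \<open>No formula for higher derivatives is needed: it suffices to find a class of
  differentiable functions closed under partial derivatives, such as all smooth multiples of one
  exponential or all integrals of dominated integrands.\<close>

lemma smooth_coinduct: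
  assumes "P f"
    and diff: "\<And>f. P f \<Longrightarrow> f differentiable_on UNIV"
    and step: "\<And>f b. P f \<Longrightarrow> b \<in> Basis \<Longrightarrow> P (dir_deriv b f)"
  shows "smooth f"
proof -
  have "Ck k f" if "P f" for k f
    using that by (induction k arbitrary: f)
      (auto intro: differentiable_imp_continuous_on diff step)
  with assms(1) show ?thesis by (simp add: smooth_def)
qed

text \<open>Proved level by level because the induction in \<open>smooth_mult\<close> knows the two
  terms of the product rule only to be \<open>Ck k\<close>.\<close>

lemma Ck_add: "Ck k f \<Longrightarrow> Ck k g \<Longrightarrow> Ck k (\<lambda>x. f x + g x)"
proof (induction k arbitrary: f g)
  case 0
  then show ?case by (simp add: continuous_on_add)
next
  case (Suc k)
  have "dir_deriv b (\<lambda>x. f x + g x) = (\<lambda>x. dir_deriv b f x + dir_deriv b g x)" for b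
  proof
    fix x
    have "f differentiable at x" "g differentiable at x"
      using Suc.prems by (auto simp: differentiable_on_def)
    then show "dir_deriv b (\<lambda>x. f x + g x) x = dir_deriv b f x + dir_deriv b g x"
      unfolding frechet_derivative_works
      by (subst dir_deriv_eq[OF has_derivative_add]) (auto simp: dir_deriv_def)
  qed
  then show ?case using Suc by (auto intro: differentiable_on_add)
qed

lemma smooth_add: "smooth f \<Longrightarrow> smooth g \<Longrightarrow> smooth (\<lambda>x. f x + g x)"
  by (simp add: smooth_def Ck_add)

lemma dir_deriv_add:
  assumes "smooth f" "smooth g"
  shows "dir_deriv v (\<lambda>x. f x + g x) = (\<lambda>x. dir_deriv v f x + dir_deriv v g x)"
  by (rule ext, rule dir_deriv_eq, intro has_derivative_add smooth_has_derivative assms)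

lemma dir_deriv_const [simp]: "dir_deriv v (\<lambda>_. c) = (\<lambda>_. 0)"
  by (rule ext, rule dir_deriv_eq, rule has_derivative_const)

lemma smooth_const [simp]: "smooth (\<lambda>_. c)"
  by (rule smooth_coinduct[where P="\<lambda>f. \<exists>c. f = (\<lambda>_. c)"]) auto

lemma dir_deriv_linear:
  assumes "bounded_linear f"
  shows "dir_deriv v f = (\<lambda>_. f v)"
  by (rule ext, rule dir_deriv_eq, rule bounded_linear_imp_has_derivative[OF assms])

lemma smooth_linear:
  assumes "bounded_linear f"
  shows "smooth f"
proof (rule smoothI)
  show "f differentiable_on UNIV"
    using bounded_linear_imp_differentiable[OF assms] by (simp add: differentiable_on_def)
qed (simp add: dir_deriv_linear[OF assms])

lemma dir_deriv_mult:
  assumes "smooth f" "smooth g"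
  shows "dir_deriv v (\<lambda>x. f x * g x) = (\<lambda>x. f x * dir_deriv v g x + dir_deriv v f x * g x)"
  by (rule ext, rule dir_deriv_eq, intro has_derivative_mult smooth_has_derivative assms)

lemma smooth_Basis_deriv: "smooth f \<Longrightarrow> b \<in> Basis \<Longrightarrow> smooth (dir_deriv b f)"
  using Ck.simps(2) unfolding smooth_def by metis

lemma smooth_mult:
  assumes "smooth f" "smooth g"
  shows "smooth (\<lambda>x. f x * g x)"
proof -
  have "Ck k (\<lambda>x. f x * g x)" if "smooth f" "smooth g" for k f g
    using that
  proof (induction k arbitrary: f g)
    case 0
    then show ?case by (simp add: continuous_on_mult smooth_continuous_on)
  next
    case (Suc k)
    then have "(\<lambda>x. f x * g x) differentiable_on UNIV"
      by (simp add: differentiable_on_def smooth_differentiable)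
    with Suc show ?case
      by (auto simp: dir_deriv_mult smooth_Basis_deriv intro!: Ck_add)
  qed
  with assms show ?thesis unfolding smooth_def by blast
qed

lemma smooth_sum: "(\<And>i. i \<in> I \<Longrightarrow> smooth (f i)) \<Longrightarrow> smooth (\<lambda>x. \<Sum>i\<in>I. f i x)"
  by (induction I rule: infinite_finite_induct) (auto intro: smooth_add)

lemma dir_deriv_scaleR:
  assumes "smooth f"
  shows "dir_deriv (c *\<^sub>R v) f x = c *\<^sub>R dir_deriv v f x"
  using linear_cmul[OF has_derivative_linear[OF smooth_has_derivative[OF assms]]] .

lemma dir_deriv_Basis_sum:
  assumes "smooth f"
  shows "dir_deriv v f x = (\<Sum>b\<in>Basis. of_real (v \<bullet> b) * dir_deriv b f x)"
proof -
  have lin: "linear (\<lambda>v. dir_deriv v f x)"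
    by (rule has_derivative_linear[OF smooth_has_derivative[OF assms]])
  have "dir_deriv (\<Sum>b\<in>Basis. (v \<bullet> b) *\<^sub>R b) f x = (\<Sum>b\<in>Basis. of_real (v \<bullet> b) * dir_deriv b f x)"
    by (simp only: linear_sum[OF lin] linear_cmul[OF lin] scaleR_conv_of_real)
  then show ?thesis by (simp add: euclidean_representation)
qed

lemma smooth_dir_deriv:
  assumes "smooth f"
  shows "smooth (dir_deriv v f)"
proof -
  have "dir_deriv v f = (\<lambda>x. \<Sum>b\<in>Basis. of_real (v \<bullet> b) * dir_deriv b f x)"
    by (rule ext, rule dir_deriv_Basis_sum[OF assms])
  then show ?thesis
    by (simp add: smooth_sum smooth_mult smooth_Basis_deriv assms)
qed

text \<open>Affine substitutions cover both the slices of a function on a product and the shear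
  \<open>x + t *\<^sub>R v\<close> behind integration by parts.\<close>

lemma dir_deriv_affine:
  assumes "smooth f" "bounded_linear L"
  shows "dir_deriv v (\<lambda>x. f (a + L x)) = (\<lambda>x. dir_deriv (L v) f (a + L x))"
proof
  fix x
  have "((\<lambda>x. a + L x) has_derivative (\<lambda>v. 0 + L v)) (at x)"
    by (intro has_derivative_add has_derivative_const bounded_linear_imp_has_derivative assms)
  from has_derivative_compose[OF this smooth_has_derivative[OF assms(1)]]
  show "dir_deriv v (\<lambda>x. f (a + L x)) x = dir_deriv (L v) f (a + L x)"
    by (subst dir_deriv_eq) auto
qed

lemma smooth_affine:
  assumes "smooth f" "bounded_linear L"
  shows "smooth (\<lambda>x. f (a + L x))"
proof (rule smooth_coinduct[where P="\<lambda>h. \<exists>f. smooth f \<and> h = (\<lambda>x. f (a + L x))"])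
  fix h assume "\<exists>f. smooth f \<and> h = (\<lambda>x. f (a + L x))"
  then obtain f where f: "smooth f" "h = (\<lambda>x. f (a + L x))" by blast
  have "(\<lambda>x. a + L x) differentiable (at x)" for x
    by (intro differentiable_add differentiable_const bounded_linear_imp_differentiable assms)
  then show "h differentiable_on UNIV"
    using differentiable_chain_at[of "\<lambda>x. a + L x" _ f] smooth_differentiable[OF f(1)]
    by (auto simp: f(2) differentiable_on_def o_def)
  fix b
  show "\<exists>f. smooth f \<and> dir_deriv b h = (\<lambda>x. f (a + L x))"
    using f dir_deriv_affine[OF f(1) assms(2)] smooth_dir_deriv[OF f(1)] by blast
qed (use assms in blast)

section \<open>Symmetry of mixed second derivatives\<close>

lemma norm_diff_le_deriv_bound:
  fixes h :: "real \<Rightarrow> 'a::real_normed_vector"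
  assumes "\<And>t. t \<in> {0..d} \<Longrightarrow> (h has_vector_derivative h' t) (at t)"
    and "\<And>t. t \<in> {0..d} \<Longrightarrow> norm (h' t) \<le> B" and "0 \<le> d"
  shows "norm (h d - h 0) \<le> B * d"
proof -
  have "norm (h d - h 0) \<le> B * norm (d - 0)"
  proof (rule differentiable_bound[where S="{0..d}" and f'="\<lambda>t v. v *\<^sub>R h' t"])
    fix t assume t: "t \<in> {0..d}"
    show "(h has_derivative (\<lambda>v. v *\<^sub>R h' t)) (at t within {0..d})"
      using has_vector_derivative_at_within[OF assms(1)[OF t]]
      by (simp add: has_vector_derivative_def)
    show "onorm (\<lambda>v. v *\<^sub>R h' t) \<le> B"
      using assms(2)[OF t] by (intro onorm_le) (auto simp: mult.commute[of B] intro: mult_left_mono)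
  qed (use assms in auto)
  then show ?thesis using assms(3) by simp
qed

lemma smooth_line_has_vector_derivative:
  assumes "smooth f"
  shows "((\<lambda>t. f (x + t *\<^sub>R v)) has_vector_derivative dir_deriv v f (x + t *\<^sub>R v)) (at t)"
proof -
  have "((\<lambda>t. x + t *\<^sub>R v) has_derivative (\<lambda>t. t *\<^sub>R v)) (at t)"
    by (auto intro!: derivative_eq_intros)
  from has_derivative_compose[OF this smooth_has_derivative[OF assms]]
  show ?thesis
    by (simp add: has_vector_derivative_def dir_deriv_scaleR[OF assms])
qed

text \<open>Two mean value inequalities: along c for the derivative in direction b, then along b for
  f. The values are complex, so no intermediate point is available; continuity of the mixed
  derivative at x controls its oscillation on a small parallelogram instead.\<close>

lemma second_difference_bound:
  fixes f :: "'a::euclidean_space \<Rightarrow> complex"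
  assumes f: "smooth f" and "0 < \<epsilon>"
  obtains d where "0 < d" "\<And>t. 0 < t \<Longrightarrow> t < d \<Longrightarrow>
    cmod (f (x + t *\<^sub>R b + t *\<^sub>R c) - f (x + t *\<^sub>R b) - f (x + t *\<^sub>R c) + f x
      - t\<^sup>2 *\<^sub>R dir_deriv c (dir_deriv b f) x) \<le> \<epsilon> * t\<^sup>2"
proof -
  define G where "G = dir_deriv c (dir_deriv b f)"
  note fb = smooth_dir_deriv[OF f, of b]
  have "continuous_on UNIV G"
    unfolding G_def by (intro smooth_continuous_on smooth_dir_deriv f)
  then obtain e where e: "0 < e" "\<And>y. dist y x < e \<Longrightarrow> dist (G y) (G x) < \<epsilon>"
    using \<open>0 < \<epsilon>\<close> unfolding continuous_on_iff by (metis UNIV_I)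
  define d where "d = e / (norm b + norm c + 1)"
  have nn: "0 < norm b + norm c + 1"
    using norm_ge_zero[of b] norm_ge_zero[of c] by linarith
  have "0 < d" using e nn by (simp add: d_def)
  moreover have "cmod (f (x + t *\<^sub>R b + t *\<^sub>R c) - f (x + t *\<^sub>R b) - f (x + t *\<^sub>R c) + f x
      - t\<^sup>2 *\<^sub>R G x) \<le> \<epsilon> * t\<^sup>2" if t: "0 < t" "t < d" for t
  proof -
    have near: "cmod (G (x + \<sigma> *\<^sub>R b + \<tau> *\<^sub>R c) - G x) \<le> \<epsilon>"
      if "\<sigma> \<in> {0..t}" "\<tau> \<in> {0..t}" for \<sigma> \<tau>
    proof -
      have "norm (\<sigma> *\<^sub>R b + \<tau> *\<^sub>R c) \<le> \<bar>\<sigma>\<bar> * norm b + \<bar>\<tau>\<bar> * norm c"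
        by (rule order_trans[OF norm_triangle_ineq]) simp
      also have "\<dots> \<le> t * norm b + t * norm c"
        using that by (intro add_mono mult_right_mono) auto
      also have "\<dots> \<le> t * (norm b + norm c + 1)"
        using t by (simp add: algebra_simps)
      also have "\<dots> < d * (norm b + norm c + 1)"
        using t nn by (intro mult_strict_right_mono) auto
      also have "\<dots> = e" using nn by (simp add: d_def)
      finally show ?thesis
        using e(2)[of "x + \<sigma> *\<^sub>R b + \<tau> *\<^sub>R c"]
        by (simp add: dist_norm add.assoc less_imp_le)
    qed
    define h where "h \<sigma> = (\<lambda>\<tau>. dir_deriv b f (x + \<sigma> *\<^sub>R b + \<tau> *\<^sub>R c) - \<tau> *\<^sub>R G x)" for \<sigma>
    have h: "cmod (h \<sigma> t - h \<sigma> 0) \<le> \<epsilon> * t" if "\<sigma> \<in> {0..t}" for \<sigma>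
    proof (rule norm_diff_le_deriv_bound)
      show "(h \<sigma> has_vector_derivative G (x + \<sigma> *\<^sub>R b + \<tau> *\<^sub>R c) - G x) (at \<tau>)" for \<tau>
        unfolding h_def G_def
        by (auto intro!: derivative_eq_intros smooth_line_has_vector_derivative[OF fb])
    qed (use near that t in auto)
    \<comment> \<open>The derivative of \<open>g\<close> at \<open>\<sigma>\<close> is
      \<open>h \<sigma> t - h \<sigma> 0\<close>, which the previous estimate bounds. The increment
      of \<open>g\<close> is the second difference minus its main term.\<close>
    define g where "g \<sigma> = f ((x + t *\<^sub>R c) + \<sigma> *\<^sub>R b) - f (x + \<sigma> *\<^sub>R b) - \<sigma> *\<^sub>R t *\<^sub>R G x" for \<sigma>
    have "cmod (g t - g 0) \<le> (\<epsilon> * t) * t"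
    proof (rule norm_diff_le_deriv_bound)
      fix \<sigma> assume \<sigma>: "\<sigma> \<in> {0..t}"
      show "(g has_vector_derivative dir_deriv b f ((x + t *\<^sub>R c) + \<sigma> *\<^sub>R b)
          - dir_deriv b f (x + \<sigma> *\<^sub>R b) - t *\<^sub>R G x) (at \<sigma>)"
        unfolding g_def
        by (auto intro!: derivative_eq_intros smooth_line_has_vector_derivative[OF f])
      show "cmod (dir_deriv b f ((x + t *\<^sub>R c) + \<sigma> *\<^sub>R b)
          - dir_deriv b f (x + \<sigma> *\<^sub>R b) - t *\<^sub>R G x) \<le> \<epsilon> * t"
        using h[OF \<sigma>] by (simp add: h_def algebra_simps)
    qed (use t in auto)
    then show ?thesis
      by (simp add: g_def power2_eq_square algebra_simps)
  qed
  ultimately show thesis using that unfolding G_def by blast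
qed

text \<open>The second difference does not change when b and c are exchanged, so for one common
  small t both mixed derivatives times \<open>t\<^sup>2\<close> lie within
  \<open>\<epsilon> / 2 * t\<^sup>2\<close> of the same number.\<close>

lemma dir_deriv_commute:
  assumes "smooth f"
  shows "dir_deriv b (dir_deriv c f) = dir_deriv c (dir_deriv b f)"
proof
  fix x
  let ?L = "dir_deriv c (dir_deriv b f) x" and ?L' = "dir_deriv b (dir_deriv c f) x"
  have "cmod (?L' - ?L) \<le> \<epsilon>" if "0 < \<epsilon>" for \<epsilon>
  proof -
    have e2: "0 < \<epsilon> / 2" using that by simp
    define \<Delta> where "\<Delta> t = f (x + t *\<^sub>R b + t *\<^sub>R c) - f (x + t *\<^sub>R b) - f (x + t *\<^sub>R c) + f x" for t
    have swap: "f (x + t *\<^sub>R c + t *\<^sub>R b) - f (x + t *\<^sub>R c) - f (x + t *\<^sub>R b) + f x = \<Delta> t" for t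
      by (simp add: \<Delta>_def add_ac)
    obtain d where d: "0 < d" "\<And>t. 0 < t \<Longrightarrow> t < d \<Longrightarrow> cmod (\<Delta> t - t\<^sup>2 *\<^sub>R ?L) \<le> \<epsilon> / 2 * t\<^sup>2"
      using second_difference_bound[OF assms e2, of x b c] unfolding \<Delta>_def by blast
    obtain d' where d': "0 < d'"
      "\<And>t. 0 < t \<Longrightarrow> t < d' \<Longrightarrow> cmod (\<Delta> t - t\<^sup>2 *\<^sub>R ?L') \<le> \<epsilon> / 2 * t\<^sup>2"
      using second_difference_bound[OF assms e2, of x c b] by (auto simp: swap)
    define t where "t = min d d' / 2"
    have t: "0 < t" "t < d" "t < d'" using d(1) d'(1) by (auto simp: t_def)
    have "t\<^sup>2 * cmod (?L' - ?L) = cmod ((\<Delta> t - t\<^sup>2 *\<^sub>R ?L) - (\<Delta> t - t\<^sup>2 *\<^sub>R ?L'))"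
      by (simp flip: scaleR_diff_right)
    also have "\<dots> \<le> \<epsilon> / 2 * t\<^sup>2 + \<epsilon> / 2 * t\<^sup>2"
      by (rule order_trans[OF norm_triangle_ineq4 add_mono[OF d(2) d'(2)]]) (use t in auto)
    finally have "t\<^sup>2 * cmod (?L' - ?L) \<le> t\<^sup>2 * \<epsilon>" by (simp add: algebra_simps)
    then show ?thesis using t by simp
  qed
  then have "cmod (?L' - ?L) \<le> 0" by - (rule field_le_epsilon, simp)
  then show "?L' = ?L" by simp
qed

section \<open>Iterated derivatives along lists of directions and the Leibniz rule\<close>

definition iter_deriv :: "'a list \<Rightarrow> ('a::real_normed_vector \<Rightarrow> complex) \<Rightarrow> 'a \<Rightarrow> complex" where
  "iter_deriv vs f = foldr dir_deriv vs f"

lemma iter_deriv_Nil [simp]: "iter_deriv [] f = f"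
  and iter_deriv_Cons [simp]: "iter_deriv (v # vs) f = dir_deriv v (iter_deriv vs f)"
  and iter_deriv_append: "iter_deriv (vs @ ws) f = iter_deriv vs (iter_deriv ws f)"
  by (simp_all add: iter_deriv_def)

lemma smooth_iter_deriv: "smooth f \<Longrightarrow> smooth (iter_deriv vs f)"
  by (induction vs) (auto intro: smooth_dir_deriv)

lemma iter_deriv_snoc_commute:
  "smooth f \<Longrightarrow> iter_deriv vs (dir_deriv v f) = dir_deriv v (iter_deriv vs f)"
  by (induction vs) (auto simp: dir_deriv_commute smooth_iter_deriv)

text \<open>Derivatives commute, so the head of one list can be pulled to the front of the other.
  This is what makes the arbitrary list behind \<open>mi_deriv\<close> harmless.\<close>

lemma iter_deriv_mset_cong:
  assumes "smooth f" "mset vs = mset ws"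
  shows "iter_deriv vs f = iter_deriv ws f"
  using assms(2)
proof (induction vs arbitrary: ws)
  case Nil
  then show ?case by simp
next
  case (Cons v vs)
  then have "v \<in> set ws" by (metis list.set_intros(1) mset_eq_setD)
  then obtain ws1 ws2 where ws: "ws = ws1 @ v # ws2" by (meson split_list)
  have "iter_deriv vs f = iter_deriv (ws1 @ ws2) f"
    using Cons.prems by (intro Cons.IH) (simp add: ws)
  then show ?case
    by (simp add: ws iter_deriv_append iter_deriv_snoc_commute smooth_iter_deriv assms(1))
qed

lemma iter_deriv_affine:
  assumes "smooth f" "bounded_linear L"
  shows "iter_deriv vs (\<lambda>x. f (a + L x)) = (\<lambda>x. iter_deriv (map L vs) f (a + L x))"
  by (induction vs) (auto simp: dir_deriv_affine assms smooth_iter_deriv)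

lemma iter_deriv_add:
  assumes "smooth f" "smooth g"
  shows "iter_deriv vs (\<lambda>x. f x + g x) = (\<lambda>x. iter_deriv vs f x + iter_deriv vs g x)"
  by (induction vs) (auto simp: dir_deriv_add smooth_iter_deriv assms)

lemma iter_deriv_cmult:
  assumes "smooth f"
  shows "iter_deriv vs (\<lambda>x. c * f x) = (\<lambda>x. c * iter_deriv vs f x)"
  by (induction vs) (auto simp: dir_deriv_mult smooth_iter_deriv assms)

lemma iter_deriv_const: "iter_deriv vs (\<lambda>_. c) = (\<lambda>_. if vs = [] then c else 0)"
  by (induction vs) auto

text \<open>Every way to hand each derivative in a list to one of two factors. Repetitions are kept,
  so the Leibniz rule becomes a plain sum without binomial coefficients and its number of terms is a
  power of two.\<close>

primrec splittings :: "'a list \<Rightarrow> ('a list \<times> 'a list) list" where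
  "splittings [] = [([], [])]"
| "splittings (v # vs) =
     map (\<lambda>(us, ws). (v # us, ws)) (splittings vs) @ map (\<lambda>(us, ws). (us, v # ws)) (splittings vs)"

lemma length_splittings: "length (splittings vs) = 2 ^ length vs"
  by (induction vs) auto

lemma in_splittings:
  "(us, ws) \<in> set (splittings vs) \<Longrightarrow>
     length us + length ws = length vs \<and> set us \<subseteq> set vs \<and> set ws \<subseteq> set vs"
  by (induction vs arbitrary: us ws) fastforce+

lemma smooth_sum_list:
  "(\<And>z. z \<in> set zs \<Longrightarrow> smooth (F z)) \<Longrightarrow> smooth (\<lambda>x. \<Sum>z\<leftarrow>zs. F z x)"
  by (induction zs) (auto intro: smooth_add)

lemma dir_deriv_sum_list:
  "(\<And>z. z \<in> set zs \<Longrightarrow> smooth (F z)) \<Longrightarrow>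
    dir_deriv v (\<lambda>x. \<Sum>z\<leftarrow>zs. F z x) = (\<lambda>x. \<Sum>z\<leftarrow>zs. dir_deriv v (F z) x)"
  by (induction zs) (auto simp: dir_deriv_add smooth_sum_list)

lemma iter_deriv_mult:
  assumes "smooth f" "smooth g"
  shows "iter_deriv vs (\<lambda>x. f x * g x) =
    (\<lambda>x. \<Sum>(us, ws)\<leftarrow>splittings vs. iter_deriv us f x * iter_deriv ws g x)"
proof (induction vs)
  case Nil
  then show ?case by simp
next
  case (Cons v vs)
  let ?F = "\<lambda>(us, ws) x. iter_deriv us f x * iter_deriv ws g x"
  have F: "smooth (?F z)" for z
    by (simp add: case_prod_beta smooth_mult smooth_iter_deriv assms)
  have "iter_deriv (v # vs) (\<lambda>x. f x * g x) = dir_deriv v (\<lambda>x. \<Sum>z\<leftarrow>splittings vs. ?F z x)"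
    by (simp add: Cons case_prod_beta)
  also have "\<dots> = (\<lambda>x. \<Sum>z\<leftarrow>splittings vs. dir_deriv v (?F z) x)"
    by (rule dir_deriv_sum_list) (rule F)
  also have "\<dots> = (\<lambda>x. \<Sum>(us, ws)\<leftarrow>splittings (v # vs). iter_deriv us f x * iter_deriv ws g x)"
    by (simp add: case_prod_beta dir_deriv_mult smooth_iter_deriv assms sum_list_addf o_def add.commute)
  finally show ?case .
qed

lemma norm_sum_list_le:
  fixes F :: "'a \<Rightarrow> 'b::real_normed_vector"
  shows "(\<And>z. z \<in> set zs \<Longrightarrow> norm (F z) \<le> B) \<Longrightarrow> norm (\<Sum>z\<leftarrow>zs. F z) \<le> real (length zs) * B"
  by (induction zs) (auto simp: algebra_simps intro!: order_trans[OF norm_triangle_ineq] add_mono)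

text \<open>A bound common to all Leibniz terms is multiplied by their number. The resulting factor
  2 per derivative goes into the geometric factor of the weighted estimates.\<close>

lemma iter_deriv_mult_bound:
  assumes "smooth f" "smooth g"
    and "\<And>us ws. length us + length ws = length vs \<Longrightarrow> set us \<subseteq> set vs \<Longrightarrow> set ws \<subseteq> set vs \<Longrightarrow>
      cmod (iter_deriv us f x) * cmod (iter_deriv ws g x) \<le> B"
  shows "cmod (iter_deriv vs (\<lambda>x. f x * g x) x) \<le> 2 ^ length vs * B"
proof -
  have "cmod (\<Sum>(us, ws)\<leftarrow>splittings vs. iter_deriv us f x * iter_deriv ws g x)
      \<le> real (length (splittings vs)) * B"
    by (rule norm_sum_list_le) (auto simp: norm_mult dest!: in_splittings intro!: assms(3))
  then show ?thesis
    by (simp add: iter_deriv_mult[OF assms(1,2)] length_splittings)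
qed

lemma iter_deriv_replicate_mult_bound:
  assumes "smooth f" "smooth g"
    and "\<And>a b. a + b = k \<Longrightarrow>
      cmod (iter_deriv (replicate a v) f x) * cmod (iter_deriv (replicate b v) g x) \<le> B"
  shows "cmod (iter_deriv (replicate k v) (\<lambda>x. f x * g x) x) \<le> 2 ^ k * B"
proof -
  have rep: "us = replicate (length us) v" if "set us \<subseteq> {v}" for us
    using that by (simp add: subset_eq replicate_eqI)
  have "cmod (iter_deriv (replicate k v) (\<lambda>x. f x * g x) x) \<le> 2 ^ length (replicate k v) * B"
  proof (rule iter_deriv_mult_bound[OF assms(1,2)])
    fix us ws
    assume *: "length us + length ws = length (replicate k v)"
      "set us \<subseteq> set (replicate k v)" "set ws \<subseteq> set (replicate k v)"
    have "set (replicate k v) \<subseteq> {v}" by auto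
    then have "us = replicate (length us) v" "ws = replicate (length ws) v"
      using *(2,3) rep by (meson subset_trans)+
    then show "cmod (iter_deriv us f x) * cmod (iter_deriv ws g x) \<le> B"
      using assms(3)[of "length us" "length ws"] *(1) by simp
  qed
  then show ?thesis by simp
qed

section \<open>Integrals depending on a parameter\<close>

definition decay :: "'a::euclidean_space \<Rightarrow> real" where
  "decay x = 1 / (1 + infnorm x) ^ (2 * DIM('a))"

lemma infnorm_ge_0 [simp]: "0 \<le> infnorm (x::'a::euclidean_space)"
  by (rule infnorm_pos_le)

lemma decay_pos: "0 < decay x"
  by (simp add: decay_def add_pos_nonneg)

lemma integrable_inverse_one_plus_square: "integrable lborel (\<lambda>x::real. 1 / (1 + x\<^sup>2))"
  using integrable_inverse_1_plus_square
  by (simp add: set_integrable_def einterval_eq_UNIV inverse_eq_divide)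

text \<open>Each coordinate is at most \<open>infnorm x\<close> in absolute value, and the exponent
  in \<open>decay\<close> contains a 2 for every dimension. So \<open>decay\<close> lies below the
  product of \<open>1 / (1 + t\<^sup>2)\<close> over the coordinates t, whose integral splits into
  one-dimensional ones.\<close>

lemma integrable_decay: "integrable lborel (decay :: 'a::euclidean_space \<Rightarrow> real)"
proof -
  let ?k = "\<lambda>t::real. 1 / (1 + t\<^sup>2)"
  let ?W = "\<lambda>x::'a. \<Prod>b\<in>Basis. ?k (x \<bullet> b)"
  have "(\<integral>\<^sup>+t. ennreal (?k t) \<partial>lborel) < \<infinity>"
    using integrable_inverse_one_plus_square unfolding integrable_iff_bounded by simp
  moreover have "(\<integral>\<^sup>+x. (\<Prod>b\<in>(Basis::'a set). ennreal (?k (x \<bullet> b))) \<partial>lborel)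
      = (\<Prod>b\<in>(Basis::'a set). \<integral>\<^sup>+t. ennreal (?k t) \<partial>lborel)"
    using nn_integral_lborel_prod[of "\<lambda>(b::'a) t. ennreal (?k t)"] by simp
  ultimately have "(\<integral>\<^sup>+x. ennreal (?W x) \<partial>lborel) < \<infinity>"
    by (simp add: prod_ennreal power_less_top_ennreal)
  then have "integrable lborel ?W"
    by (intro integrableI_bounded) (auto simp: prod_nonneg)
  then show ?thesis
  proof (rule Bochner_Integration.integrable_bound)
    show "(decay :: 'a \<Rightarrow> real) \<in> borel_measurable lborel"
      unfolding decay_def measurable_lborel2
      by (intro borel_measurable_continuous_onI continuous_intros)
        (auto simp: add_nonneg_eq_0_iff)
    have "decay x \<le> ?W x" for x :: 'a
    proof -
      have "(\<Prod>b\<in>Basis. 1 + (x \<bullet> b)\<^sup>2) \<le> (\<Prod>b\<in>(Basis::'a set). (1 + infnorm x)\<^sup>2)"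
      proof (rule prod_mono, intro conjI)
        fix b :: 'a assume b: "b \<in> Basis"
        have "(x \<bullet> b)\<^sup>2 \<le> (infnorm x)\<^sup>2"
          using Basis_le_infnorm[OF b, of x] by (simp add: abs_le_square_iff[symmetric])
        then show "1 + (x \<bullet> b)\<^sup>2 \<le> (1 + infnorm x)\<^sup>2"
          by (simp add: power2_sum add_increasing2)
      qed simp
      also have "\<dots> = (1 + infnorm x) ^ (2 * DIM('a))"
        by (simp add: power_mult)
      finally have "(\<Prod>b\<in>Basis. 1 + (x \<bullet> b)\<^sup>2) \<le> (1 + infnorm x) ^ (2 * DIM('a))" .
      moreover have "0 < (\<Prod>b\<in>Basis. 1 + (x \<bullet> b)\<^sup>2)"
        by (intro prod_pos) (auto intro: add_pos_nonneg)
      ultimately show ?thesis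
        by (simp add: decay_def prod_dividef frac_le)
    qed
    then show "AE x in lborel. norm (decay x) \<le> norm (?W x)"
      by (intro AE_I2) (simp add: prod_nonneg abs_of_pos[OF decay_pos])
  qed
qed

text \<open>A translation by at most 1 changes \<open>1 + infnorm x\<close> by at most a factor 2.
  One majorant then serves all nearby translates in \<open>integral_dir_deriv_eq_0\<close>.\<close>

lemma decay_shift:
  fixes x u :: "'a::euclidean_space"
  assumes "infnorm u \<le> 1"
  shows "decay (x + u) \<le> 4 ^ DIM('a) * decay x"
proof -
  have "infnorm x \<le> infnorm (x + u) + infnorm (- u)"
    using infnorm_triangle[of "x + u" "- u"] by simp
  then have "1 + infnorm x \<le> 2 * (1 + infnorm (x + u))"
    using assms infnorm_ge_0[of "x + u"] unfolding infnorm_neg by (smt (verit))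
  then have "(1 + infnorm x) ^ (2 * DIM('a)) \<le> (2 * (1 + infnorm (x + u))) ^ (2 * DIM('a))"
    by (intro power_mono) (auto intro: add_nonneg_nonneg)
  also have "\<dots> = 4 ^ DIM('a) * (1 + infnorm (x + u)) ^ (2 * DIM('a))"
    unfolding power_mult power_mult_distrib by simp
  finally show ?thesis
    using infnorm_ge_0[of x] infnorm_ge_0[of "x + u"]
    by (simp add: decay_def field_simps add_pos_nonneg)
qed

lemma smooth_borel_measurable:
  assumes "smooth f"
  shows "f \<in> borel_measurable lborel"
  using borel_measurable_continuous_onI[OF smooth_continuous_on[OF assms, of UNIV]] by simp

lemma integrable_decay_bound:
  assumes "smooth f" "\<And>x. cmod (f x) \<le> C * decay x"
  shows "integrable lborel f"
proof (rule Bochner_Integration.integrable_bound)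
  show "integrable lborel (\<lambda>x. C * decay x)"
    by (intro integrable_mult_right integrable_decay)
  show "AE x in lborel. norm (f x) \<le> norm (C * decay x)"
    using assms(2) by (intro AE_I2) (smt (verit) norm_ge_zero real_norm_def)
qed (rule smooth_borel_measurable[OF assms(1)])

lemma smooth_slice_fst:
  assumes "smooth g"
  shows "smooth (\<lambda>x. g (x, y))"
  using smooth_affine[OF assms, of "\<lambda>x. (x, 0)" "(0, y)"]
  by (simp add: bounded_linear_Pair bounded_linear_ident bounded_linear_zero)

lemma smooth_slice_snd:
  assumes "smooth g"
  shows "smooth (\<lambda>y. g (x, y))"
  using smooth_affine[OF assms, of "\<lambda>y. (0, y)" "(x, 0)"]
  by (simp add: bounded_linear_Pair bounded_linear_ident bounded_linear_zero)

lemma iter_deriv_slice_fst: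
  assumes "smooth g"
  shows "iter_deriv vs (\<lambda>x. g (x, y)) x = iter_deriv (map (\<lambda>v. (v, 0)) vs) g (x, y)"
  using iter_deriv_affine[OF assms, of "\<lambda>x. (x, 0)" vs "(0, y)"]
  by (simp add: bounded_linear_Pair bounded_linear_ident bounded_linear_zero)

lemma iter_deriv_slice_snd:
  assumes "smooth g"
  shows "iter_deriv vs (\<lambda>y. g (x, y)) y = iter_deriv (map (\<lambda>v. (0, v)) vs) g (x, y)"
  using iter_deriv_affine[OF assms, of "\<lambda>y. (0, y)" vs "(x, 0)"]
  by (simp add: bounded_linear_Pair bounded_linear_ident bounded_linear_zero)

text \<open>Frechet differentiation under the integral sign by dominated convergence. A majorant for
  the basis directions is enough, since a general directional derivative is a combination of
  them.\<close>

lemma has_derivative_integral_param: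
  fixes g :: "'a::euclidean_space \<times> 'b::euclidean_space \<Rightarrow> complex"
  assumes g: "smooth g" and w: "integrable lborel w" and e: "0 < e"
    and int: "\<And>x. x \<in> ball x0 e \<Longrightarrow> integrable lborel (\<lambda>y. g (x, y))"
    and bound: "\<And>x y b. x \<in> ball x0 e \<Longrightarrow> b \<in> Basis \<Longrightarrow> cmod (dir_deriv (b, 0) g (x, y)) \<le> w y"
  shows "((\<lambda>x. LINT y|lborel. g (x, y)) has_derivative
          (\<lambda>v. LINT y|lborel. dir_deriv (v, 0) g (x0, y))) (at x0)"
proof -
  have slice: "dir_deriv (v, 0) g (x, y) = dir_deriv v (\<lambda>x. g (x, y)) x" for v x y
    using iter_deriv_slice_fst[OF g, of "[v]"] by simp
  note sm = smooth_slice_fst[OF g]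
  have lin: "linear (\<lambda>v. dir_deriv (v, 0) g (x, y))" for x y
    unfolding slice by (rule has_derivative_linear[OF smooth_has_derivative[OF sm]])
  have dv: "cmod (dir_deriv (v, 0) g (x, y)) \<le> norm v * (DIM('a) * w y)"
    if "x \<in> ball x0 e" for v x y
  proof -
    have "dir_deriv (v, 0) g (x, y) = (\<Sum>b\<in>Basis. of_real (v \<bullet> b) * dir_deriv (b, 0) g (x, y))"
      unfolding slice by (rule dir_deriv_Basis_sum[OF sm])
    also have "cmod \<dots> \<le> (\<Sum>b\<in>(Basis :: 'a set). norm v * w y)"
    proof (rule sum_norm_le)
      fix b :: 'a assume "b \<in> Basis"
      then show "cmod (of_real (v \<bullet> b) * dir_deriv (b, 0) g (x, y)) \<le> norm v * w y"
        using bound[OF that, of b y] Basis_le_norm[of b v]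
        by (auto simp: norm_mult intro!: mult_mono)
    qed
    finally show ?thesis by (simp add: ac_simps)
  qed
  have meas: "(\<lambda>y. dir_deriv (v, 0) g (x, y)) \<in> borel_measurable lborel" for v x
    by (intro smooth_borel_measurable smooth_slice_snd smooth_dir_deriv g)
  have x0: "x0 \<in> ball x0 e" using e by simp
  have intd: "integrable lborel (\<lambda>y. dir_deriv (v, 0) g (x0, y))" for v
  proof (rule Bochner_Integration.integrable_bound[OF _ meas])
    show "integrable lborel (\<lambda>y. norm v * (DIM('a) * w y))"
      by (intro integrable_mult_right w)
    show "AE y in lborel. cmod (dir_deriv (v, 0) g (x0, y)) \<le> norm (norm v * (DIM('a) * w y))"
      using dv[OF x0] by (intro AE_I2) (smt (verit) real_norm_def)
  qed
  let ?I = "\<lambda>x. LINT y|lborel. g (x, y)"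
  let ?F = "\<lambda>v. LINT y|lborel. dir_deriv (v, 0) g (x0, y)"
  have "linear ?F"
  proof (rule linearI)
    show "?F (u + v) = ?F u + ?F v" for u v
      using linear_add[OF lin, of u v] intd by simp
    show "?F (r *\<^sub>R v) = r *\<^sub>R ?F v" for r v
      using linear_cmul[OF lin, of r v] by simp
  qed
  then have blF: "bounded_linear ?F" by (simp add: linear_conv_bounded_linear)
  \<comment> \<open>The quotient whose convergence to 0 defines differentiability; integrating it
    gives the same quotient for the integral. The mean value inequality bounds it by a multiple of
    \<open>w\<close> that does not depend on x.\<close>
  define q where "q x y = ((g (x, y) - g (x0, y)) - dir_deriv (x - x0, 0) g (x0, y)) /\<^sub>R norm (x - x0)"
    for x y
  have q_int: "(LINT y|lborel. q x y) = ((?I x - ?I x0) - ?F (x - x0)) /\<^sub>R norm (x - x0)"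
    if "x \<in> ball x0 e" for x
    using int[OF that] int[OF x0] intd by (simp add: q_def)
  have q_bound: "cmod (q x y) \<le> 2 * (DIM('a) * w y)" if x: "x \<in> ball x0 e" "x \<noteq> x0" for x y
  proof -
    have "cmod (g (x0 + 1 *\<^sub>R (x - x0), y) - g (x0 + 0 *\<^sub>R (x - x0), y))
        \<le> norm (x - x0) * (DIM('a) * w y) * 1"
    proof (rule norm_diff_le_deriv_bound)
      fix t :: real assume t: "t \<in> {0..1}"
      show "((\<lambda>t. g (x0 + t *\<^sub>R (x - x0), y)) has_vector_derivative
          dir_deriv (x - x0, 0) g (x0 + t *\<^sub>R (x - x0), y)) (at t)"
        unfolding slice by (rule smooth_line_has_vector_derivative[OF sm])
      have "norm (t *\<^sub>R (x - x0)) \<le> norm (x - x0)"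
        using t by (simp add: mult_left_le_one_le)
      also have "\<dots> < e"
        using x by (simp add: dist_norm norm_minus_commute)
      finally have "x0 + t *\<^sub>R (x - x0) \<in> ball x0 e"
        by (simp add: dist_norm)
      then show "cmod (dir_deriv (x - x0, 0) g (x0 + t *\<^sub>R (x - x0), y))
          \<le> norm (x - x0) * (DIM('a) * w y)"
        by (rule dv)
    qed simp
    then have "cmod (g (x, y) - g (x0, y)) \<le> norm (x - x0) * (DIM('a) * w y)" by simp
    moreover have "cmod (dir_deriv (x - x0, 0) g (x0, y)) \<le> norm (x - x0) * (DIM('a) * w y)"
      by (rule dv[OF x0])
    ultimately have "cmod ((g (x, y) - g (x0, y)) - dir_deriv (x - x0, 0) g (x0, y))
        \<le> norm (x - x0) * (2 * (DIM('a) * w y))"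
      by (intro order_trans[OF norm_triangle_ineq4]) simp
    moreover have "cmod (q x y) = cmod ((g (x, y) - g (x0, y)) - dir_deriv (x - x0, 0) g (x0, y)) / norm (x - x0)"
      by (simp add: q_def divide_inverse mult.commute)
    ultimately show ?thesis
      using x(2) by (simp add: pos_divide_le_eq mult.commute)
  qed
  have "((\<lambda>x. ((?I x - ?I x0) - ?F (x - x0)) /\<^sub>R norm (x - x0)) \<longlongrightarrow> 0) (at x0)"
    unfolding tendsto_at_iff_sequentially
  proof (intro allI impI)
    fix X assume X: "\<forall>i. X i \<in> UNIV - {x0}" "X \<longlonglongrightarrow> x0"
    \<comment> \<open>The majorant is available only in the ball, so the finitely many terms of the
      sequence that may lie outside are shifted away.\<close>
    obtain N where N: "\<And>n. n \<ge> N \<Longrightarrow> X n \<in> ball x0 e"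
      using metric_LIMSEQ_D[OF X(2) e] by (auto simp: dist_commute)
    have "(\<lambda>n. LINT y|lborel. q (X (n + N)) y) \<longlonglongrightarrow> integral\<^sup>L (lborel :: 'b measure) (\<lambda>_. 0)"
    proof (rule integral_dominated_convergence[where w="\<lambda>y. 2 * (DIM('a) * w y)"])
      show "integrable lborel (\<lambda>y. 2 * (DIM('a) * w y))"
        by (intro integrable_mult_right w)
      show "AE y in lborel. (\<lambda>n. q (X (n + N)) y) \<longlonglongrightarrow> 0"
      proof (rule AE_I2)
        fix y
        have "((\<lambda>x. q x y) \<longlongrightarrow> 0) (at x0)"
          using smooth_has_derivative[OF sm, of y x0]
          unfolding has_derivative_at_within q_def slice by simp
        then have "(\<lambda>n. q (X n) y) \<longlonglongrightarrow> 0"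
          using X by (auto simp: tendsto_at_iff_sequentially o_def)
        then show "(\<lambda>n. q (X (n + N)) y) \<longlonglongrightarrow> 0" by (rule LIMSEQ_ignore_initial_segment)
      qed
      show "AE y in lborel. norm (q (X (n + N)) y) \<le> 2 * (DIM('a) * w y)" for n
        using q_bound[OF N] X(1) by auto
      show "q (X (n + N)) \<in> borel_measurable lborel" for n
        unfolding q_def using meas smooth_borel_measurable[OF smooth_slice_snd[OF g]]
        by measurable
    qed simp
    then have "(\<lambda>n. (\<lambda>x. ((?I x - ?I x0) - ?F (x - x0)) /\<^sub>R norm (x - x0)) (X (n + N))) \<longlonglongrightarrow> 0"
      by (simp only: q_int[OF N[OF le_add2]] integral_zero)
    then show "((\<lambda>x. ((?I x - ?I x0) - ?F (x - x0)) /\<^sub>R norm (x - x0)) \<circ> X) \<longlonglongrightarrow> 0"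
      unfolding o_def by (rule LIMSEQ_offset)
  qed
  then show ?thesis
    using blF by (simp add: has_derivative_at_within)
qed

text \<open>The integrands for which differentiation under the integral sign can be repeated
  indefinitely: the majorants may depend on the derivative and on the bounded region of x, and the
  class is closed under derivatives in the first variable.\<close>

definition dominated :: "('a::euclidean_space \<times> 'b::euclidean_space \<Rightarrow> complex) \<Rightarrow> bool" where
  "dominated g \<longleftrightarrow> smooth g \<and>
     (\<forall>vs R. set vs \<subseteq> Basis \<longrightarrow>
       (\<exists>C. \<forall>x y. norm x \<le> R \<longrightarrow> cmod (iter_deriv (map (\<lambda>v. (v, 0)) vs) g (x, y)) \<le> C * decay y))"

definition param_integral :: "('a \<times> 'b::euclidean_space \<Rightarrow> complex) \<Rightarrow> 'a \<Rightarrow> complex" where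
  "param_integral g x = (LINT y|lborel. g (x, y))"

lemma dominated_bound:
  assumes "dominated g" "set vs \<subseteq> Basis"
  obtains C where "0 \<le> C" "\<And>x y. norm x \<le> R \<Longrightarrow>
    cmod (iter_deriv (map (\<lambda>v. (v, 0)) vs) g (x, y)) \<le> C * decay y"
proof -
  obtain C where C: "\<And>x y. norm x \<le> R \<Longrightarrow>
      cmod (iter_deriv (map (\<lambda>v. (v, 0)) vs) g (x, y)) \<le> C * decay y"
    using assms unfolding dominated_def by blast
  have "cmod (iter_deriv (map (\<lambda>v. (v, 0)) vs) g (x, y)) \<le> max 0 C * decay y"
    if "norm x \<le> R" for x y
    using C[OF that, of y] decay_pos[of y]
    by (meson less_imp_le max.cobounded2 mult_right_mono order_trans)
  then show thesis using that[of "max 0 C"] by simp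
qed

lemma dominated_integrable:
  assumes "dominated g"
  shows "integrable lborel (\<lambda>y. g (x, y))"
proof -
  obtain C where "\<And>z y. norm z \<le> norm x \<Longrightarrow> cmod (iter_deriv (map (\<lambda>v. (v, 0)) []) g (z, y)) \<le> C * decay y"
    by (rule dominated_bound[OF assms, of "[]" "norm x"]) auto
  then show ?thesis
    using assms by (intro integrable_decay_bound[of _ C] smooth_slice_snd) (auto simp: dominated_def)
qed

lemma dominated_dir_deriv:
  assumes "dominated g" "b \<in> Basis"
  shows "dominated (dir_deriv (b, 0) g)"
  unfolding dominated_def
proof (intro conjI allI impI)
  show "smooth (dir_deriv (b, 0) g)"
    using assms by (simp add: dominated_def smooth_dir_deriv)
  fix vs :: "'a list" and R :: real assume "set vs \<subseteq> Basis"
  then have "set (vs @ [b]) \<subseteq> Basis" using assms(2) by simp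
  then obtain C where "\<And>x y. norm x \<le> R \<Longrightarrow>
      cmod (iter_deriv (map (\<lambda>v. (v, 0)) (vs @ [b])) g (x, y)) \<le> C * decay y"
    using dominated_bound[OF assms(1), of "vs @ [b]" R] by metis
  then show "\<exists>C. \<forall>x y. norm x \<le> R \<longrightarrow>
      cmod (iter_deriv (map (\<lambda>v. (v, 0)) vs) (dir_deriv (b, 0) g) (x, y)) \<le> C * decay y"
    by (auto simp: iter_deriv_append)
qed

lemma dominated_has_derivative:
  fixes g :: "'a::euclidean_space \<times> 'b::euclidean_space \<Rightarrow> complex"
  assumes "dominated g"
  shows "(param_integral g has_derivative (\<lambda>v. param_integral (dir_deriv (v, 0) g) x)) (at x)"
proof -
  have "\<forall>b\<in>(Basis::'a set). \<exists>C. \<forall>z y. norm z \<le> norm x + 1 \<longrightarrow>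
      0 \<le> C \<and> cmod (dir_deriv (b, 0) g (z, y)) \<le> C * decay y"
  proof
    fix b :: 'a assume b: "b \<in> Basis"
    obtain C where "0 \<le> C" "\<And>z y. norm z \<le> norm x + 1 \<Longrightarrow>
        cmod (iter_deriv (map (\<lambda>v. (v, 0)) [b]) g (z, y)) \<le> C * decay y"
      by (rule dominated_bound[OF assms, of "[b]" "norm x + 1"]) (use b in auto)
    then show "\<exists>C. \<forall>z y. norm z \<le> norm x + 1 \<longrightarrow>
      0 \<le> C \<and> cmod (dir_deriv (b, 0) g (z, y)) \<le> C * decay y"
      by (intro exI[of _ C]) simp
  qed
  then obtain C where C: "\<And>b z y. b \<in> (Basis::'a set) \<Longrightarrow> norm z \<le> norm x + 1 \<Longrightarrow>
      0 \<le> C b \<and> cmod (dir_deriv (b, 0) g (z, y)) \<le> C b * decay y"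
    unfolding bchoice_iff by blast
  have C0: "0 \<le> C b" if "b \<in> Basis" for b
    using C[OF that, of x] by simp
  show ?thesis
    unfolding param_integral_def[abs_def]
  proof (rule has_derivative_integral_param[where e=1 and w="\<lambda>y. (\<Sum>b\<in>Basis. C b) * decay y"])
    fix z y and b :: 'a assume zb: "z \<in> ball x 1" "b \<in> Basis"
    have "norm z \<le> norm x + 1"
      using zb(1) norm_triangle_sub[of z x] by (simp add: dist_norm norm_minus_commute)
    then have "cmod (dir_deriv (b, 0) g (z, y)) \<le> C b * decay y"
      using C zb(2) by blast
    also have "\<dots> \<le> (\<Sum>b\<in>Basis. C b) * decay y"
      using C0 zb(2) decay_pos[of y] by (intro mult_right_mono member_le_sum) auto
    finally show "cmod (dir_deriv (b, 0) g (z, y)) \<le> (\<Sum>b\<in>Basis. C b) * decay y" .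
  qed (use assms dominated_integrable[OF assms] in
      \<open>auto simp: dominated_def intro!: integrable_mult_right integrable_decay\<close>)
qed

lemma dir_deriv_param_integral:
  assumes "dominated g"
  shows "dir_deriv v (param_integral g) = param_integral (dir_deriv (v, 0) g)"
  by (rule ext, rule dir_deriv_eq, rule dominated_has_derivative[OF assms])

lemma smooth_param_integral:
  fixes g :: "'a::euclidean_space \<times> 'b::euclidean_space \<Rightarrow> complex"
  assumes "dominated g"
  shows "smooth (param_integral g)"
proof (rule smooth_coinduct[where P="\<lambda>f. \<exists>g :: 'a \<times> 'b \<Rightarrow> complex. dominated g \<and> f = param_integral g"])
  fix f assume "\<exists>g :: 'a \<times> 'b \<Rightarrow> complex. dominated g \<and> f = param_integral g"
  then obtain g :: "'a \<times> 'b \<Rightarrow> complex" where g: "dominated g" "f = param_integral g" by blast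
  show "f differentiable_on UNIV"
    using dominated_has_derivative[OF g(1)] g(2)
    by (auto simp: differentiable_on_def differentiable_def)
  show "\<exists>g :: 'a \<times> 'b \<Rightarrow> complex. dominated g \<and> dir_deriv b f = param_integral g" if "b \<in> Basis" for b
    using dir_deriv_param_integral[OF g(1), of b] dominated_dir_deriv[OF g(1) that] g(2) by blast
qed (use assms in blast)

lemma iter_deriv_param_integral:
  assumes "dominated g" "set vs \<subseteq> Basis"
  shows "dominated (iter_deriv (map (\<lambda>v. (v, 0)) vs) g) \<and>
    iter_deriv vs (param_integral g) = param_integral (iter_deriv (map (\<lambda>v. (v, 0)) vs) g)"
  using assms(2)
  by (induction vs) (auto simp: assms(1) dominated_dir_deriv dir_deriv_param_integral)

text \<open>Integration by parts without boundary terms or iterated integrals: the integral of a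
  translate of r along v does not depend on the shift t, and differentiating it under the integral
  sign at t = 0 gives the integral of the derivative.\<close>

lemma integral_dir_deriv_eq_0:
  fixes r :: "'a::euclidean_space \<Rightarrow> complex"
  assumes r: "smooth r" and v: "v \<in> Basis"
    and b0: "\<And>x. cmod (r x) \<le> C * decay x" and b1: "\<And>x. cmod (dir_deriv v r x) \<le> C * decay x"
  shows "(LINT x|lborel. dir_deriv v r x) = 0"
proof -
  have C: "0 \<le> C"
    using b0[of 0] decay_pos[of 0] norm_ge_zero[of "r 0"]
    by (metis mult_less_0_iff not_less order_trans)
  define L where "L = (\<lambda>(t::real, x::'a). x + t *\<^sub>R v)"
  have L: "bounded_linear L"
    unfolding L_def case_prod_beta
    by (intro bounded_linear_add bounded_linear_snd
        bounded_linear_compose[OF bounded_linear_scaleR_left bounded_linear_fst])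
  have dv: "dir_deriv (t, 0) (\<lambda>z. r (0 + L z)) (s, x) = dir_deriv (t *\<^sub>R v) r (x + s *\<^sub>R v)" for s t x
    unfolding dir_deriv_affine[OF r L] by (simp add: L_def)
  have shift: "decay (x + s *\<^sub>R v) \<le> 4 ^ DIM('a) * decay x" if "s \<in> ball 0 1" for s :: real and x
  proof (rule decay_shift)
    have "infnorm (s *\<^sub>R v) \<le> norm (s *\<^sub>R v)" by (rule infnorm_le_norm)
    also have "\<dots> \<le> 1" using that v by simp
    finally show "infnorm (s *\<^sub>R v) \<le> 1" .
  qed
  have bd: "C * decay (x + s *\<^sub>R v) \<le> C * 4 ^ DIM('a) * decay x" if "s \<in> ball 0 1" for s :: real and x
    using mult_left_mono[OF shift[OF that] C] by (simp add: mult.assoc)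
  have "((\<lambda>t. LINT x|lborel. r (0 + L (t, x))) has_derivative
      (\<lambda>t. LINT x|lborel. dir_deriv (t, 0) (\<lambda>z. r (0 + L z)) (0, x))) (at (0::real))"
  proof (rule has_derivative_integral_param[where e=1 and w="\<lambda>x. C * 4 ^ DIM('a) * decay x"])
    show "smooth (\<lambda>z. r (0 + L z))" by (rule smooth_affine[OF r L])
    show "integrable lborel (\<lambda>x. C * 4 ^ DIM('a) * decay x)"
      by (intro integrable_mult_right integrable_decay)
    fix s :: real assume s: "s \<in> ball 0 1"
    show "integrable lborel (\<lambda>x. r (0 + L (s, x)))"
    proof (rule integrable_decay_bound)
      show "smooth (\<lambda>x. r (0 + L (s, x)))"
        by (rule smooth_slice_snd[OF smooth_affine[OF r L]])
      show "cmod (r (0 + L (s, x))) \<le> C * 4 ^ DIM('a) * decay x" for x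
        using order_trans[OF b0 bd[OF s]] by (simp add: L_def)
    qed
    fix b :: real and x assume "b \<in> Basis"
    then show "cmod (dir_deriv (b, 0) (\<lambda>z. r (0 + L z)) (s, x)) \<le> C * 4 ^ DIM('a) * decay x"
      using order_trans[OF b1 bd[OF s]] unfolding dv by simp
  qed simp
  moreover have "(LINT x|lborel. r (0 + L (t, x))) = (LINT x|lborel. r x)" for t
  proof -
    have "(LINT x|lborel. r x) = (LINT x|distr lborel borel ((+) (t *\<^sub>R v)). r x)"
      by (simp add: lborel_distr_plus)
    also have "\<dots> = (LINT x|lborel. r (t *\<^sub>R v + x))"
      using smooth_borel_measurable[OF r] by (intro integral_distr) auto
    finally show ?thesis by (simp add: L_def add.commute)
  qed
  ultimately have "((\<lambda>t::real. LINT x|lborel. r x) has_derivative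
      (\<lambda>t. LINT x|lborel. dir_deriv (t *\<^sub>R v) r x)) (at 0)"
    unfolding dv by simp
  from has_derivative_unique[OF this has_derivative_const]
  have "(LINT x|lborel. dir_deriv (1 *\<^sub>R v) r x) = 0" by (rule fun_cong)
  then show ?thesis by simp
qed

section \<open>Oscillatory integrals\<close>

text \<open>The products of \<open>exp f\<close> with smooth functions form a class closed under
  derivatives, so coinduction applies.\<close>

lemma smooth_exp:
  assumes f: "smooth f"
  shows "smooth (\<lambda>x. exp (f x))"
proof -
  have der: "((\<lambda>x. q x * exp (f x)) has_derivative
      (\<lambda>v. (dir_deriv v q x + q x * dir_deriv v f x) * exp (f x))) (at x)" if q: "smooth q" for q x
  proof -
    have "((\<lambda>x. exp (f x)) has_derivative (\<lambda>v. exp (f x) * dir_deriv v f x)) (at x)"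
      by (rule has_derivative_compose[OF smooth_has_derivative[OF f]
            DERIV_exp[unfolded has_field_derivative_def]])
    from has_derivative_mult[OF smooth_has_derivative[OF q] this]
    show ?thesis by (simp add: algebra_simps)
  qed
  have "smooth (\<lambda>x. 1 * exp (f x))"
  proof (rule smooth_coinduct[where P="\<lambda>h. \<exists>q. smooth q \<and> h = (\<lambda>x. q x * exp (f x))"])
    fix h assume "\<exists>q. smooth q \<and> h = (\<lambda>x. q x * exp (f x))"
    then obtain q where q: "smooth q" "h = (\<lambda>x. q x * exp (f x))" by blast
    show "h differentiable_on UNIV"
      using der[OF q(1)] by (auto simp: q(2) differentiable_on_def differentiable_def)
    fix b
    have "dir_deriv b h = (\<lambda>x. (dir_deriv b q x + q x * dir_deriv b f x) * exp (f x))"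
      unfolding q(2) by (rule ext, rule dir_deriv_eq, rule der[OF q(1)])
    moreover have "smooth (\<lambda>x. dir_deriv b q x + q x * dir_deriv b f x)"
      by (intro smooth_add smooth_mult smooth_dir_deriv q f)
    ultimately show "\<exists>q. smooth q \<and> dir_deriv b h = (\<lambda>x. q x * exp (f x))"
      by blast
  qed (use smooth_const in blast)
  then show ?thesis by simp
qed

text \<open>The phase of both transforms, with s = -1 for the Fourier transform and s = 1 for
  \<open>Op p\<close>. The first component is the output variable, the second the integration
  variable.\<close>

definition osc :: "real \<Rightarrow> 'a::euclidean_space \<times> 'a \<Rightarrow> complex" where
  "osc s z = exp (\<i> * complex_of_real (s * (fst z \<bullet> snd z)))"

lemma cmod_osc [simp]: "cmod (osc s z) = 1"
  by (simp add: osc_def)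

lemma smooth_osc: "smooth (osc s :: 'a::euclidean_space \<times> 'a \<Rightarrow> complex)"
  unfolding osc_def[abs_def]
proof (rule smooth_exp)
  have lin: "bounded_linear (\<lambda>z :: 'a \<times> 'a. complex_of_real (fst z \<bullet> b))"
    "bounded_linear (\<lambda>z :: 'a \<times> 'a. complex_of_real (snd z \<bullet> b))" for b
    by (intro bounded_linear_compose[OF bounded_linear_of_real]
        bounded_linear_compose[OF bounded_linear_inner_left] bounded_linear_fst bounded_linear_snd)+
  have "smooth (\<lambda>z :: 'a \<times> 'a. (\<i> * complex_of_real s) *
      (\<Sum>b\<in>Basis. complex_of_real (fst z \<bullet> b) * complex_of_real (snd z \<bullet> b)))"
    by (intro smooth_mult smooth_const smooth_sum smooth_linear lin)
  moreover have "(\<lambda>z :: 'a \<times> 'a. \<i> * complex_of_real (s * (fst z \<bullet> snd z))) =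
      (\<lambda>z. (\<i> * complex_of_real s) * (\<Sum>b\<in>Basis. complex_of_real (fst z \<bullet> b) * complex_of_real (snd z \<bullet> b)))"
    by (rule ext, subst euclidean_inner) simp
  ultimately show "smooth (\<lambda>z :: 'a \<times> 'a. \<i> * complex_of_real (s * (fst z \<bullet> snd z)))"
    by (simp only:)
qed

lemma dir_deriv_osc:
  "dir_deriv (v, w) (osc s) z = \<i> * complex_of_real (s * (v \<bullet> snd z + fst z \<bullet> w)) * osc s z"
proof (rule dir_deriv_eq[THEN trans])
  show "(osc s has_derivative (\<lambda>h. exp (\<i> * complex_of_real (s * (fst z \<bullet> snd z))) *
      (\<i> * complex_of_real (s * (fst z \<bullet> snd h + fst h \<bullet> snd z))))) (at z)"
    unfolding osc_def[abs_def]
    by (rule has_derivative_compose[OF _ DERIV_exp[unfolded has_field_derivative_def]])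
      (auto intro!: derivative_eq_intros)
qed (simp add: osc_def algebra_simps)

text \<open>The monomial in \<xi> that comes down when the directions in \<open>vs\<close>
  differentiate the phase in its first variable.\<close>

definition osc_mono :: "real \<Rightarrow> 'a::euclidean_space list \<Rightarrow> 'a \<Rightarrow> complex" where
  "osc_mono s vs \<xi> = (\<Prod>v\<leftarrow>vs. \<i> * complex_of_real (s * (v \<bullet> \<xi>)))"

lemma osc_mono_Nil [simp]: "osc_mono s [] = (\<lambda>_. 1)"
  and osc_mono_Cons: "osc_mono s (v # vs) = (\<lambda>\<xi>. (\<i> * complex_of_real (s * (v \<bullet> \<xi>))) * osc_mono s vs \<xi>)"
  by (auto simp: osc_mono_def)

lemma iter_deriv_osc_fst:
  "iter_deriv vs (\<lambda>x. osc s (x, \<xi>)) x = osc_mono s vs \<xi> * osc s (x, \<xi>)"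
proof (induction vs arbitrary: x)
  case (Cons v vs)
  note sm = smooth_slice_fst[OF smooth_osc, of s \<xi>]
  have "dir_deriv v (\<lambda>x. osc s (x, \<xi>)) x = \<i> * complex_of_real (s * (v \<bullet> \<xi>)) * osc s (x, \<xi>)"
    using iter_deriv_slice_fst[OF smooth_osc, of "[v]" s \<xi> x] by (simp add: dir_deriv_osc)
  moreover have "iter_deriv vs (\<lambda>x. osc s (x, \<xi>)) = (\<lambda>x. osc_mono s vs \<xi> * osc s (x, \<xi>))"
    using Cons by blast
  ultimately show ?case
    by (simp add: dir_deriv_mult sm osc_mono_Cons)
qed simp

lemma dir_deriv_osc_snd:
  "dir_deriv v (\<lambda>\<xi>. osc s (x, \<xi>)) \<xi> = \<i> * complex_of_real (s * (x \<bullet> v)) * osc s (x, \<xi>)"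
  using iter_deriv_slice_snd[OF smooth_osc, of "[v]" s x \<xi>] by (simp add: dir_deriv_osc)

lemma bounded_linear_osc_factor: "bounded_linear (\<lambda>\<xi>. \<i> * complex_of_real (s * (v \<bullet> \<xi>)))"
proof -
  have "bounded_linear (\<lambda>\<xi>. (\<i> * complex_of_real s) * complex_of_real (v \<bullet> \<xi>))"
    by (intro bounded_linear_compose[OF bounded_linear_mult_right]
        bounded_linear_compose[OF bounded_linear_of_real] bounded_linear_inner_right)
  then show ?thesis by (simp add: mult.assoc)
qed

lemma smooth_osc_mono: "smooth (osc_mono s vs)"
proof (induction vs)
  case (Cons v vs)
  then show ?case
    unfolding osc_mono_Cons by (intro smooth_mult[OF smooth_linear[OF bounded_linear_osc_factor]])
qed simp

text \<open>Only two kinds of Leibniz terms survive because the derivative of l is constant. For k =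
  0 the truncated \<open>k - 1\<close> is harmless, as its coefficient vanishes.\<close>

lemma iter_deriv_linear_mult:
  assumes l: "bounded_linear l" and f: "smooth f"
  shows "iter_deriv (replicate k v) (\<lambda>x. l x * f x) =
    (\<lambda>x. l x * iter_deriv (replicate k v) f x + of_nat k * l v * iter_deriv (replicate (k - 1) v) f x)"
proof (induction k)
  case (Suc k)
  note sm = smooth_iter_deriv[OF f]
  have "dir_deriv v (\<lambda>x. l x * iter_deriv (replicate k v) f x
      + of_nat k * l v * iter_deriv (replicate (k - 1) v) f x) =
    (\<lambda>x. l x * dir_deriv v (iter_deriv (replicate k v) f) x + l v * iter_deriv (replicate k v) f x
      + of_nat k * l v * dir_deriv v (iter_deriv (replicate (k - 1) v) f) x)"
    by (simp add: dir_deriv_add dir_deriv_mult dir_deriv_linear[OF l] smooth_mult smooth_linear[OF l] sm)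
  with Suc show ?case
    by (cases k) (auto simp: algebra_simps)
qed simp

text \<open>Modelled on the k-th derivative of \<open>y ^ n\<close>, with n the number of factors:
  each linear factor is at most \<open>infnorm \<xi>\<close>, its derivative along v at most 1, and
  the induction step is Pascal's rule.\<close>

lemma iter_deriv_osc_mono_bound:
  assumes "\<bar>s\<bar> = 1" "v \<in> Basis" "set vs \<subseteq> Basis"
  shows "cmod (iter_deriv (replicate k v) (osc_mono s vs) \<xi>) \<le>
    real (length vs choose k) * fact k * infnorm \<xi> ^ (length vs - k)"
  using assms(3)
proof (induction vs arbitrary: k)
  case Nil
  then show ?case by (cases k) (auto simp: iter_deriv_const)
next
  case (Cons u us)
  let ?n = "length us" and ?y = "infnorm \<xi>"
  let ?l = "\<lambda>\<xi>. \<i> * complex_of_real (s * (u \<bullet> \<xi>))"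
  have l1: "cmod (?l \<xi>) \<le> ?y"
    using assms(1) Cons.prems Basis_le_infnorm[of u \<xi>]
    by (simp add: norm_mult abs_mult inner_commute)
  have l2: "cmod (?l v) \<le> 1"
    using assms(1,2) Cons.prems by (simp add: norm_mult abs_mult inner_Basis)
  have IH: "cmod (iter_deriv (replicate k v) (osc_mono s us) \<xi>)
      \<le> real (?n choose k) * fact k * ?y ^ (?n - k)" for k
    using Cons by simp
  have "cmod (iter_deriv (replicate k v) (osc_mono s (u # us)) \<xi>) \<le>
      cmod (?l \<xi>) * cmod (iter_deriv (replicate k v) (osc_mono s us) \<xi>)
      + real k * cmod (?l v) * cmod (iter_deriv (replicate (k - 1) v) (osc_mono s us) \<xi>)"
    unfolding osc_mono_Cons iter_deriv_linear_mult[OF bounded_linear_osc_factor smooth_osc_mono]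
    by (rule order_trans[OF norm_triangle_ineq]) (simp add: norm_mult)
  also have "\<dots> \<le> ?y * (real (?n choose k) * fact k * ?y ^ (?n - k))
      + real k * 1 * (real (?n choose (k - 1)) * fact (k - 1) * ?y ^ (?n - (k - 1)))"
    by (intro add_mono mult_mono IH l1 l2) auto
  also have "\<dots> = real (Suc ?n choose k) * fact k * ?y ^ (Suc ?n - k)"
  proof (cases k)
    case (Suc j)
    \<comment> \<open>For k beyond the degree the truncated exponents on the two sides need not
      match, but the binomial coefficient is 0.\<close>
    have "?y * (real (?n choose k) * ?y ^ (?n - k)) = real (?n choose k) * ?y ^ (?n - j)"
    proof (cases "k \<le> ?n")
      case True
      then have "?n - j = Suc (?n - k)" using Suc by simp
      then show ?thesis by simp
    qed simp
    then have "?y * (real (?n choose k) * fact k * ?y ^ (?n - k)) = real (?n choose k) * fact k * ?y ^ (?n - j)"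
      by (simp add: ac_simps)
    then show ?thesis
      by (simp only:) (simp add: Suc algebra_simps)
  qed simp
  finally show ?case by simp
qed

text \<open>Each integration by parts trades one factor \<open>x \<bullet> v\<close> for one
  derivative of r. Decay of the derivatives of every order is assumed with unnamed constants, to
  make the integrals converge and the total derivatives integrate to 0; only the constant for the
  k-th derivative enters the bound.\<close>

lemma osc_integral_bound:
  fixes r :: "'a::euclidean_space \<Rightarrow> complex"
  assumes "smooth r" "v \<in> Basis" "\<bar>s\<bar> = 1"
    and "\<And>k. \<exists>C. \<forall>\<xi>. cmod (iter_deriv (replicate k v) r \<xi>) \<le> C * decay \<xi>"
    and "\<And>\<xi>. cmod (iter_deriv (replicate k v) r \<xi>) \<le> C * decay \<xi>"
  shows "\<bar>x \<bullet> v\<bar> ^ k * cmod (LINT \<xi>|lborel. osc s (x, \<xi>) * r \<xi>) \<le> C * (LINT \<xi>|lborel. decay (\<xi>::'a))"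
  using assms(1,4,5)
proof (induction k arbitrary: r)
  case 0
  have int: "integrable lborel (\<lambda>\<xi>. osc s (x, \<xi>) * r \<xi>)"
    using 0 by (intro integrable_decay_bound[where C=C] smooth_mult smooth_slice_snd smooth_osc)
      (auto simp: norm_mult)
  have "cmod (LINT \<xi>|lborel. osc s (x, \<xi>) * r \<xi>) \<le> (LINT \<xi>|lborel. cmod (osc s (x, \<xi>) * r \<xi>))"
    by (rule integral_norm_bound)
  also have "\<dots> \<le> (LINT \<xi>|lborel. C * decay (\<xi>::'a))"
  proof (rule integral_mono)
    show "cmod (osc s (x, \<xi>) * r \<xi>) \<le> C * decay \<xi>" for \<xi>
      using 0(3) by (simp add: norm_mult)
  qed (intro integrable_norm int integrable_mult_right integrable_decay)+
  finally show ?case by simp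
next
  case (Suc k)
  let ?r' = "dir_deriv v r"
  note sm = smooth_slice_snd[OF smooth_osc, of s x]
  note r' = smooth_dir_deriv[OF Suc.prems(1), of v]
  have shift: "iter_deriv (replicate k v) ?r' = iter_deriv (replicate (Suc k) v) r" for k
    using Suc.prems(1) by (simp add: iter_deriv_snoc_commute)
  have IH: "\<bar>x \<bullet> v\<bar> ^ k * cmod (LINT \<xi>|lborel. osc s (x, \<xi>) * ?r' \<xi>) \<le> C * (LINT \<xi>|lborel. decay (\<xi>::'a))"
    by (rule Suc.IH[OF r']) (use Suc.prems(2,3) in \<open>auto simp only: shift\<close>)
  obtain C0 C1 where
    C0: "\<And>\<xi>. cmod (iter_deriv (replicate 0 v) r \<xi>) \<le> C0 * decay \<xi>" and
    C1: "\<And>\<xi>. cmod (iter_deriv (replicate (Suc 0) v) r \<xi>) \<le> C1 * decay \<xi>"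
    using Suc.prems(2) by meson
  have int0: "integrable lborel (\<lambda>\<xi>. osc s (x, \<xi>) * r \<xi>)"
    using C0 by (intro integrable_decay_bound[where C=C0] smooth_mult sm Suc.prems) (auto simp: norm_mult)
  have int1: "integrable lborel (\<lambda>\<xi>. osc s (x, \<xi>) * ?r' \<xi>)"
    using C1 by (intro integrable_decay_bound[where C=C1] smooth_mult sm r') (auto simp: norm_mult)
  let ?c = "\<i> * complex_of_real (s * (x \<bullet> v))"
  have der: "dir_deriv v (\<lambda>\<xi>. osc s (x, \<xi>) * r \<xi>) =
      (\<lambda>\<xi>. osc s (x, \<xi>) * ?r' \<xi> + ?c * (osc s (x, \<xi>) * r \<xi>))"
    by (simp add: dir_deriv_mult sm Suc.prems dir_deriv_osc_snd mult.assoc)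
  let ?B = "\<bar>C0\<bar> + \<bar>C1\<bar> + cmod ?c * \<bar>C0\<bar>"
  have d0: "cmod (r \<xi>) \<le> \<bar>C0\<bar> * decay \<xi>" for \<xi>
    using C0[of \<xi>] mult_right_mono[OF abs_ge_self less_imp_le[OF decay_pos], of C0 \<xi>] by simp
  have d1: "cmod (?r' \<xi>) \<le> \<bar>C1\<bar> * decay \<xi>" for \<xi>
    using C1[of \<xi>] mult_right_mono[OF abs_ge_self less_imp_le[OF decay_pos], of C1 \<xi>] by simp
  have "(LINT \<xi>|lborel. dir_deriv v (\<lambda>\<xi>. osc s (x, \<xi>) * r \<xi>) \<xi>) = 0"
  proof (rule integral_dir_deriv_eq_0[where C="?B"])
    show "smooth (\<lambda>\<xi>. osc s (x, \<xi>) * r \<xi>)" by (intro smooth_mult sm Suc.prems)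
    show "cmod (osc s (x, \<xi>) * r \<xi>) \<le> ?B * decay \<xi>" for \<xi>
    proof -
      have "\<bar>C0\<bar> * decay \<xi> \<le> ?B * decay \<xi>"
        using decay_pos[of \<xi>] by (intro mult_right_mono) (auto simp: less_imp_le)
      then show ?thesis using d0[of \<xi>] by (simp add: norm_mult)
    qed
    show "cmod (dir_deriv v (\<lambda>\<xi>. osc s (x, \<xi>) * r \<xi>) \<xi>) \<le> ?B * decay \<xi>" for \<xi>
    proof -
      have "cmod (dir_deriv v (\<lambda>\<xi>. osc s (x, \<xi>) * r \<xi>) \<xi>) \<le> cmod (?r' \<xi>) + cmod ?c * cmod (r \<xi>)"
        unfolding der by (rule order_trans[OF norm_triangle_ineq]) (simp add: norm_mult)
      also have "\<dots> \<le> \<bar>C1\<bar> * decay \<xi> + cmod ?c * (\<bar>C0\<bar> * decay \<xi>)"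
        by (intro add_mono mult_left_mono d0 d1) auto
      also have "\<dots> = (\<bar>C1\<bar> + cmod ?c * \<bar>C0\<bar>) * decay \<xi>"
        by (simp only: distrib_right mult.assoc)
      also have "\<dots> \<le> ?B * decay \<xi>"
        using decay_pos[of \<xi>] by (intro mult_right_mono) auto
      finally show ?thesis .
    qed
  qed fact
  then have "(LINT \<xi>|lborel. osc s (x, \<xi>) * ?r' \<xi>) = - (?c * (LINT \<xi>|lborel. osc s (x, \<xi>) * r \<xi>))"
    unfolding der using int0 int1 by (simp add: eq_neg_iff_add_eq_0)
  then have "cmod (LINT \<xi>|lborel. osc s (x, \<xi>) * ?r' \<xi>) =
      \<bar>x \<bullet> v\<bar> * cmod (LINT \<xi>|lborel. osc s (x, \<xi>) * r \<xi>)"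
    using assms(3) by (simp add: norm_mult abs_mult)
  with IH show ?case by (simp add: ac_simps)
qed

lemma iter_deriv_replicate_mult3_bound:
  assumes "smooth f" "smooth g" "smooth h"
    and B: "\<And>a b c. a + b + c = k \<Longrightarrow> cmod (iter_deriv (replicate a v) f x) *
      cmod (iter_deriv (replicate b v) g x) * cmod (iter_deriv (replicate c v) h x) \<le> B"
  shows "cmod (iter_deriv (replicate k v) (\<lambda>x. f x * (g x * h x)) x) \<le> 4 ^ k * B"
proof -
  have B0: "0 \<le> B"
    by (rule order_trans[OF _ B[of k 0 0]]) auto
  have "cmod (iter_deriv (replicate k v) (\<lambda>x. f x * (g x * h x)) x) \<le> 2 ^ k * (2 ^ k * B)"
  proof (rule iter_deriv_replicate_mult_bound[OF assms(1) smooth_mult[OF assms(2,3)]])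
    fix a j assume aj: "a + j = k"
    let ?c = "cmod (iter_deriv (replicate a v) f x)"
    show "?c * cmod (iter_deriv (replicate j v) (\<lambda>x. g x * h x) x) \<le> 2 ^ k * B"
    proof (cases "?c = 0")
      case False
      then have c: "0 < ?c" by simp
      \<comment> \<open>The two-factor rule asks for a bound on the inner product alone, hence the
        division by the outer factor and the separate case in which that factor vanishes.\<close>
      have "cmod (iter_deriv (replicate j v) (\<lambda>x. g x * h x) x) \<le> 2 ^ j * (B / ?c)"
      proof (rule iter_deriv_replicate_mult_bound[OF assms(2,3)])
        fix b d assume "b + d = j"
        then have "a + b + d = k" using aj by simp
        from B[OF this] c
        show "cmod (iter_deriv (replicate b v) g x) * cmod (iter_deriv (replicate d v) h x) \<le> B / ?c"
          by (simp add: pos_le_divide_eq ac_simps)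
      qed
      then have "?c * cmod (iter_deriv (replicate j v) (\<lambda>x. g x * h x) x) \<le> 2 ^ j * B"
        using c by (simp add: pos_le_divide_eq ac_simps)
      also have "\<dots> \<le> 2 ^ k * B"
        using aj B0 by (intro mult_right_mono power_increasing) auto
      finally show ?thesis .
    qed (use B0 in simp)
  qed
  moreover have "2 ^ k * (2 ^ k * B) = 4 ^ k * B"
    using power_mult_distrib[of "2::real" 2 k] by simp
  ultimately show ?thesis by simp
qed

section \<open>Weighted estimates for oscillatory integrals\<close>

text \<open>The Gelfand-Shilov estimate with \<open>\<tau>\<close> in place of \<open>1 / h\<close>
  and a power of \<open>infnorm x\<close> in place of all monomials of that order. Both forms agree
  with the same constant, and this one can be tested on the largest coordinate alone.\<close>

definition schwartz_bound ::
    "(nat \<Rightarrow> real) \<Rightarrow> real \<Rightarrow> real \<Rightarrow> ('a::euclidean_space \<Rightarrow> complex) \<Rightarrow> bool" where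
  "schwartz_bound M \<tau> K f \<longleftrightarrow> smooth f \<and>
     (\<forall>vs a x. set vs \<subseteq> Basis \<longrightarrow>
       infnorm x ^ a * cmod (iter_deriv vs f x) \<le> K * \<tau> ^ (a + length vs) * (M a * M (length vs)))"

text \<open>The growth orders \<open>m\<close> and \<open>\<mu>\<close> and the gain in decay under differentiation are irrelevant for
  continuity on Gelfand--Shilov spaces; a crude polynomial bound of order \<open>d\<close> in both variables
  suffices. Only pure derivatives are needed in the second variable.\<close>

definition symbol_bound ::
    "(nat \<Rightarrow> real) \<Rightarrow> real \<Rightarrow> real \<Rightarrow> nat \<Rightarrow> ('a::euclidean_space \<times> 'a \<Rightarrow> complex) \<Rightarrow> bool" where
  "symbol_bound M \<tau> P d p \<longleftrightarrow> smooth p \<and>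
     (\<forall>l b vs x \<xi>. l \<in> Basis \<longrightarrow> set vs \<subseteq> Basis \<longrightarrow>
       cmod (iter_deriv (replicate b (0, l) @ map (\<lambda>v. (v, 0)) vs) p (x, \<xi>)) \<le>
         P * \<tau> ^ (b + length vs) * (M b * M (length vs)) * (1 + infnorm x) ^ d * (1 + infnorm \<xi>) ^ d)"

lemma schwartz_boundD:
  assumes "schwartz_bound M \<tau> K f" "set vs \<subseteq> Basis"
  shows "infnorm x ^ a * cmod (iter_deriv vs f x) \<le> K * \<tau> ^ (a + length vs) * (M a * M (length vs))"
  using assms by (simp add: schwartz_bound_def)

lemma schwartz_bound_nonneg:
  assumes "weight_sequence M" "schwartz_bound M \<tau> K f"
  shows "0 \<le> K"
  using schwartz_boundD[OF assms(2), of "[]" 0 0] weight_0[OF assms(1)]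
  by (auto intro: order_trans[OF norm_ge_zero])

lemma symbol_boundD:
  assumes "symbol_bound M \<tau> P d p" "l \<in> Basis" "set vs \<subseteq> Basis"
  shows "cmod (iter_deriv (replicate b (0, l) @ map (\<lambda>v. (v, 0)) vs) p (x, \<xi>)) \<le>
    P * \<tau> ^ (b + length vs) * (M b * M (length vs)) * (1 + infnorm x) ^ d * (1 + infnorm \<xi>) ^ d"
  using assms by (simp add: symbol_bound_def)

lemma symbol_bound_nonneg:
  assumes "weight_sequence M" "symbol_bound M \<tau> P d p"
  shows "0 \<le> P"
  using symbol_boundD[OF assms(2) SOME_Basis, of "[]" 0 0 0] weight_0[OF assms(1)]
  by (auto simp: infnorm_0 intro: order_trans[OF norm_ge_zero])

lemma one_plus_power_le:
  assumes "0 \<le> (y::real)"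
  shows "(1 + y) ^ e \<le> 2 ^ e * (1 + y ^ e)"
proof (cases "y \<le> 1")
  case True
  then have "(1 + y) ^ e \<le> 2 ^ e" using assms by (intro power_mono) auto
  also have "\<dots> \<le> 2 ^ e * (1 + y ^ e)" using assms by (simp add: distrib_left)
  finally show ?thesis .
next
  case False
  then have "(1 + y) ^ e \<le> (2 * y) ^ e" by (intro power_mono) auto
  also have "\<dots> \<le> 2 ^ e * (1 + y ^ e)" by (simp add: power_mult_distrib distrib_left)
  finally show ?thesis .
qed

text \<open>The weight is at most \<open>2 ^ e * (1 + infnorm x ^ e)\<close>, and e further powers
  of \<open>infnorm x\<close> are covered by the bound on f through \<open>weight_shift_le\<close>.
  They leave a factor \<open>\<tau> ^ e\<close>, which is why \<open>C\<close> depends on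
  \<open>\<tau>\<close> while \<open>R\<close> does not.\<close>

lemma weighted_schwartz_bound:
  assumes M: "weight_sequence M"
  obtains R where "1 \<le> R" "\<And>\<tau>. 0 < \<tau> \<Longrightarrow> \<exists>C>0. \<forall>K (f :: 'a::euclidean_space \<Rightarrow> complex) vs a x.
    schwartz_bound M \<tau> K f \<longrightarrow> set vs \<subseteq> Basis \<longrightarrow>
    (1 + infnorm x) ^ e * (infnorm x ^ a * cmod (iter_deriv vs f x)) \<le>
      C * K * (R * \<tau>) ^ (a + length vs) * (M a * M (length vs))"
proof -
  obtain C0 R where CR: "1 \<le> C0" "1 \<le> R" "\<And>j. M (j + e) \<le> C0 * R ^ j * M j"
    using weight_shift_le[OF M] by blast
  note pos = weight_pos[OF M]
  have "\<exists>C>0. \<forall>K (f :: 'a \<Rightarrow> complex) vs a x.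
      schwartz_bound M \<tau> K f \<longrightarrow> set vs \<subseteq> Basis \<longrightarrow>
      (1 + infnorm x) ^ e * (infnorm x ^ a * cmod (iter_deriv vs f x)) \<le>
        C * K * (R * \<tau>) ^ (a + length vs) * (M a * M (length vs))" if \<tau>: "0 < \<tau>" for \<tau>
  proof (intro exI conjI allI impI)
    define C where "C = 2 ^ e * (1 + \<tau> ^ e * C0)"
    have "0 < \<tau> ^ e * C0" using \<tau> CR by simp
    then show "0 < C" by (simp add: C_def)
    fix K :: real and f :: "'a \<Rightarrow> complex" and vs :: "'a list" and a :: nat and x :: 'a
    assume f: "schwartz_bound M \<tau> K f" and vs: "set vs \<subseteq> Basis"
    let ?F = "cmod (iter_deriv vs f x)" and ?y = "infnorm x" and ?b = "length vs"
    note K = schwartz_bound_nonneg[OF M f]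
    have 1: "?y ^ a * ?F \<le> K * (R * \<tau>) ^ (a + ?b) * (M a * M ?b)"
    proof (rule order_trans[OF schwartz_boundD[OF f vs]])
      show "K * \<tau> ^ (a + ?b) * (M a * M ?b) \<le> K * (R * \<tau>) ^ (a + ?b) * (M a * M ?b)"
        using K \<tau> CR pos by (intro mult_right_mono mult_left_mono power_mono) (auto simp: less_imp_le)
    qed
    have 2: "?y ^ (a + e) * ?F \<le> \<tau> ^ e * C0 * (K * (R * \<tau>) ^ (a + ?b) * (M a * M ?b))"
    proof -
      have "?y ^ (a + e) * ?F \<le> K * \<tau> ^ (a + e + ?b) * (M (a + e) * M ?b)"
        by (rule schwartz_boundD[OF f vs])
      also have "\<dots> \<le> K * \<tau> ^ (a + e + ?b) * (C0 * R ^ a * M a * M ?b)"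
        using K \<tau> CR pos by (intro mult_right_mono mult_left_mono) (auto simp: less_imp_le)
      also have "\<dots> \<le> K * \<tau> ^ (a + e + ?b) * (C0 * R ^ (a + ?b) * M a * M ?b)"
        using K \<tau> CR pos
        by (intro mult_right_mono mult_left_mono power_increasing) (auto simp: less_imp_le)
      finally show ?thesis by (simp add: power_add power_mult_distrib ac_simps)
    qed
    have "(1 + ?y) ^ e * (?y ^ a * ?F) \<le> 2 ^ e * (1 + ?y ^ e) * (?y ^ a * ?F)"
      by (intro mult_right_mono one_plus_power_le) auto
    also have "\<dots> = 2 ^ e * (?y ^ a * ?F + ?y ^ (a + e) * ?F)"
      by (simp add: power_add algebra_simps)
    also have "\<dots> \<le> 2 ^ e * (K * (R * \<tau>) ^ (a + ?b) * (M a * M ?b)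
        + \<tau> ^ e * C0 * (K * (R * \<tau>) ^ (a + ?b) * (M a * M ?b)))"
      by (intro mult_left_mono add_mono 1 2) auto
    also have "\<dots> = C * K * (R * \<tau>) ^ (a + ?b) * (M a * M ?b)"
      by (simp add: C_def algebra_simps)
    finally show "(1 + ?y) ^ e * (?y ^ a * ?F) \<le> C * K * (R * \<tau>) ^ (a + ?b) * (M a * M ?b)" .
  qed
  with that[OF CR(2)] show thesis by blast
qed

lemma weight_mult4_le:
  assumes M: "weight_sequence M" and "b1 \<le> s"
  shows "(M b1)\<^sup>2 * (M b2 * M t) * (M (s - b1) * M b3) \<le> M (s + t) * M (b1 + b2 + b3)"
proof -
  note pos = weight_pos[OF M] and le = weight_mult_le[OF M]
  have 1: "M b1 * M (s - b1) * M t \<le> M (s + t)"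
  proof -
    have "M b1 * M (s - b1) * M t \<le> M (b1 + (s - b1)) * M t"
      by (intro mult_right_mono le less_imp_le pos)
    also have "\<dots> \<le> M (b1 + (s - b1) + t)" by (rule le)
    finally show ?thesis by (simp add: assms(2))
  qed
  have 2: "M b1 * M b2 * M b3 \<le> M (b1 + b2 + b3)"
    by (rule order_trans[OF mult_right_mono[OF le less_imp_le[OF pos]] le])
  have "(M b1 * M (s - b1) * M t) * (M b1 * M b2 * M b3) \<le> M (s + t) * M (b1 + b2 + b3)"
    using pos by (intro mult_mono 1 2) (auto simp: less_imp_le)
  then show ?thesis by (simp add: power2_eq_square ac_simps)
qed

text \<open>The factorial produced by differentiating the monomial is absorbed by \<open>(M b1)\<^sup>2\<close>: one factor
  recombines with \<open>M (s - b1)\<close> and the other one with \<open>M b2 * M b3\<close>.\<close>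

lemma product_estimate:
  assumes M: "weight_sequence M"
    and S: "1 \<le> S" "\<And>k. fact k * z ^ k \<le> E * S ^ k * (M k)\<^sup>2"
    and \<tau>: "0 < \<tau>" and R: "1 \<le> R" and z: "z = 1 / (R * \<tau>)\<^sup>2" and E: "0 \<le> E"
    and nn: "0 \<le> P" "0 \<le> K" "0 \<le> C" "0 \<le> X" "0 \<le> y" "0 \<le> F1" "0 \<le> F2" "0 \<le> F3"
    and F1: "F1 \<le> real (s choose b1) * fact b1 * y ^ (s - b1)"
    and F2: "F2 \<le> P * \<tau> ^ (b2 + t) * (M b2 * M t) * X * (1 + y) ^ d"
    and F3: "(1 + y) ^ (N + d) * (y ^ (s - b1) * F3) \<le>
      C * K * (R * \<tau>) ^ (s - b1 + b3) * (M (s - b1) * M b3)"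
  shows "F1 * F2 * F3 \<le> E * C * (P * K * X) * (2 * S * R * \<tau>) ^ (s + t + (b1 + b2 + b3)) *
    (M (s + t) * M (b1 + b2 + b3)) * (1 / (1 + y) ^ N)"
proof (cases "b1 \<le> s")
  \<comment> \<open>More derivatives than the degree annihilate the monomial. Separating this case
    avoids the truncation of \<open>s - b1\<close>.\<close>
  case False
  then have "F1 = 0" using F1 nn by (simp add: binomial_eq_0)
  moreover have "0 \<le> E * C * (P * K * X) * (2 * S * R * \<tau>) ^ (s + t + (b1 + b2 + b3)) *
    (M (s + t) * M (b1 + b2 + b3)) * (1 / (1 + y) ^ N)"
    using nn E S(1) R \<tau> weight_pos[OF M] by (intro mult_nonneg_nonneg zero_le_power) (auto simp: less_imp_le)
  ultimately show ?thesis by simp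
next
  case True
  note pos = weight_pos[OF M]
  let ?\<sigma> = "R * \<tau>" and ?n = "s + t + (b1 + b2 + b3)"
  have \<sigma>: "0 < ?\<sigma>" "\<tau> \<le> ?\<sigma>" using R \<tau> by auto
  have y1: "0 < 1 + y" using nn by simp
  have fct: "real (s choose b1) * fact b1 \<le> 2 ^ ?n * (E * S ^ ?n * ?\<sigma> ^ (2 * b1) * (M b1)\<^sup>2)"
  proof (rule mult_mono)
    have "real (s choose b1) \<le> real (2 ^ s)"
      unfolding of_nat_le_iff by (rule binomial_le_pow2)
    also have "\<dots> \<le> 2 ^ ?n" by (simp add: power_increasing)
    finally show "real (s choose b1) \<le> 2 ^ ?n" .
    \<comment> \<open>By the choice of z, \<open>z ^ b1\<close> cancels the power of
      \<open>R * \<tau>\<close>. This supplies the \<open>2 * b1\<close> factors needed to complete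
      the exponent \<open>?n\<close>.\<close>
    have "fact b1 = (fact b1 * z ^ b1) * ?\<sigma> ^ (2 * b1)"
      using R \<tau> by (simp add: z power_divide power_mult)
    also have "\<dots> \<le> (E * S ^ b1 * (M b1)\<^sup>2) * ?\<sigma> ^ (2 * b1)"
      using \<sigma> by (intro mult_right_mono S(2)) auto
    also have "\<dots> \<le> (E * S ^ ?n * (M b1)\<^sup>2) * ?\<sigma> ^ (2 * b1)"
      using \<sigma> E S(1) by (intro mult_right_mono mult_left_mono power_increasing) auto
    finally show "fact b1 \<le> E * S ^ ?n * ?\<sigma> ^ (2 * b1) * (M b1)\<^sup>2" by (simp add: ac_simps)
  qed auto
  have "F1 * F2 * F3 \<le> (real (s choose b1) * fact b1 * y ^ (s - b1)) *
      (P * ?\<sigma> ^ (b2 + t) * (M b2 * M t) * X * (1 + y) ^ d) * F3"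
  proof (intro mult_right_mono mult_mono F1 order_trans[OF F2])
    show "\<tau> ^ (b2 + t) \<le> ?\<sigma> ^ (b2 + t)" using \<tau> \<sigma> by (intro power_mono) auto
  qed (use nn \<tau> \<sigma> pos in \<open>auto simp: less_imp_le\<close>)
  also have "\<dots> = (real (s choose b1) * fact b1) * (P * ?\<sigma> ^ (b2 + t) * (M b2 * M t) * X) *
      ((1 + y) ^ (N + d) * (y ^ (s - b1) * F3)) * (1 / (1 + y) ^ N)"
    using y1 by (simp add: power_add field_simps)
  also have "\<dots> \<le> (2 ^ ?n * (E * S ^ ?n * ?\<sigma> ^ (2 * b1) * (M b1)\<^sup>2)) * (P * ?\<sigma> ^ (b2 + t) * (M b2 * M t) * X) *
      (C * K * ?\<sigma> ^ (s - b1 + b3) * (M (s - b1) * M b3)) * (1 / (1 + y) ^ N)"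
    using nn \<sigma> pos E S(1) y1
    by (intro mult_right_mono mult_mono fct F3) (auto simp: less_imp_le)
  also have "\<dots> = E * C * (P * K * X) * (2 ^ ?n * S ^ ?n * (?\<sigma> ^ (2 * b1) * ?\<sigma> ^ (b2 + t) * ?\<sigma> ^ (s - b1 + b3))) *
      ((M b1)\<^sup>2 * (M b2 * M t) * (M (s - b1) * M b3)) * (1 / (1 + y) ^ N)"
    by (simp only: ac_simps)
  also have "?\<sigma> ^ (2 * b1) * ?\<sigma> ^ (b2 + t) * ?\<sigma> ^ (s - b1 + b3) = ?\<sigma> ^ ?n"
  proof -
    have "2 * b1 + (b2 + t) + (s - b1 + b3) = ?n" using True by simp
    then show ?thesis by (simp only: flip: power_add)
  qed
  also have "2 ^ ?n * S ^ ?n * ?\<sigma> ^ ?n = (2 * S * R * \<tau>) ^ ?n"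
    by (simp only: power_mult_distrib ac_simps)
  also have "E * C * (P * K * X) * (2 * S * R * \<tau>) ^ ?n *
      ((M b1)\<^sup>2 * (M b2 * M t) * (M (s - b1) * M b3)) * (1 / (1 + y) ^ N) \<le>
      E * C * (P * K * X) * (2 * S * R * \<tau>) ^ ?n * (M (s + t) * M (b1 + b2 + b3)) * (1 / (1 + y) ^ N)"
    using nn \<sigma> E S(1) R \<tau> y1
    by (intro mult_right_mono mult_left_mono weight_mult4_le[OF M True]) auto
  finally show ?thesis .
qed

text \<open>The amplitude left after the directions \<open>us\<close> have hit the phase and
  \<open>ws\<close> the symbol. Of the powers of \<open>1 + infnorm \<xi>\<close> borrowed from the
  decay of f, d pay for the growth of p and \<open>2 * DIM('a)\<close> produce
  \<open>decay\<close>.\<close>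

lemma symbol_product_bound:
  assumes M: "weight_sequence M" "non_quasianalytic M"
  obtains \<rho> where "1 \<le> \<rho>" "\<And>\<tau>. 0 < \<tau> \<Longrightarrow>
    \<exists>C>0. \<forall>s P K (p :: 'a::euclidean_space \<times> 'a \<Rightarrow> complex) f us ws l b x \<xi>.
      \<bar>s\<bar> = 1 \<longrightarrow> symbol_bound M \<tau> P d p \<longrightarrow> schwartz_bound M \<tau> K f \<longrightarrow>
      set us \<subseteq> Basis \<longrightarrow> set ws \<subseteq> Basis \<longrightarrow> l \<in> Basis \<longrightarrow>
      cmod (iter_deriv (replicate b l)
        (\<lambda>\<xi>. osc_mono s us \<xi> * (iter_deriv (map (\<lambda>v. (v, 0)) ws) p (x, \<xi>) * f \<xi>)) \<xi>) \<le>
      C * (P * K * (1 + infnorm x) ^ d) * (\<rho> * \<tau>) ^ (length us + length ws + b) *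
        (M (length us + length ws) * M b) * decay \<xi>"
proof -
  let ?N = "2 * DIM('a)"
  obtain R where R: "1 \<le> R" and weighted: "\<And>\<tau>. 0 < \<tau> \<Longrightarrow> \<exists>C>0. \<forall>K (f :: 'a \<Rightarrow> complex) vs a x.
    schwartz_bound M \<tau> K f \<longrightarrow> set vs \<subseteq> Basis \<longrightarrow>
    (1 + infnorm x) ^ (?N + d) * (infnorm x ^ a * cmod (iter_deriv vs f x)) \<le>
      C * K * (R * \<tau>) ^ (a + length vs) * (M a * M (length vs))"
    using weighted_schwartz_bound[OF M(1), where e="?N + d" and ?'a='a] by blast
  obtain S where S: "1 \<le> S" "\<And>z k. 0 < z \<Longrightarrow> fact k * z ^ k \<le> exp z * S ^ k * (M k)\<^sup>2"
    using fact_power_le_weight[OF M] by blast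
  have "\<exists>C>0. \<forall>s P K (p :: 'a \<times> 'a \<Rightarrow> complex) f us ws l b x \<xi>.
      \<bar>s\<bar> = 1 \<longrightarrow> symbol_bound M \<tau> P d p \<longrightarrow> schwartz_bound M \<tau> K f \<longrightarrow>
      set us \<subseteq> Basis \<longrightarrow> set ws \<subseteq> Basis \<longrightarrow> l \<in> Basis \<longrightarrow>
      cmod (iter_deriv (replicate b l)
        (\<lambda>\<xi>. osc_mono s us \<xi> * (iter_deriv (map (\<lambda>v. (v, 0)) ws) p (x, \<xi>) * f \<xi>)) \<xi>) \<le>
      C * (P * K * (1 + infnorm x) ^ d) * (8 * S * R * \<tau>) ^ (length us + length ws + b) *
        (M (length us + length ws) * M b) * decay \<xi>" if \<tau>: "0 < \<tau>" for \<tau>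
  proof -
    obtain C where C: "C > 0" and F3: "\<And>K (f :: 'a \<Rightarrow> complex) vs a x.
      schwartz_bound M \<tau> K f \<Longrightarrow> set vs \<subseteq> Basis \<Longrightarrow>
      (1 + infnorm x) ^ (?N + d) * (infnorm x ^ a * cmod (iter_deriv vs f x)) \<le>
        C * K * (R * \<tau>) ^ (a + length vs) * (M a * M (length vs))"
      using weighted[OF \<tau>] by blast
    define z where "z = 1 / (R * \<tau>)\<^sup>2"
    have z: "0 < z" using R \<tau> by (simp add: z_def)
    show ?thesis
    proof (intro exI[of _ "exp z * C"] conjI allI impI)
      show "0 < exp z * C" using C by simp
      fix s P K :: real and p :: "'a \<times> 'a \<Rightarrow> complex" and f :: "'a \<Rightarrow> complex"
        and us ws :: "'a list" and l x \<xi> :: 'a and b :: nat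
      assume s: "\<bar>s\<bar> = 1" and p: "symbol_bound M \<tau> P d p" and f: "schwartz_bound M \<tau> K f"
        and us: "set us \<subseteq> (Basis :: 'a set)" and ws: "set ws \<subseteq> (Basis :: 'a set)"
        and l: "l \<in> (Basis :: 'a set)"
      let ?q = "iter_deriv (map (\<lambda>v. (v, 0)) ws) p"
      let ?X = "(1 + infnorm x) ^ d" and ?k = "length us + length ws"
      let ?B = "exp z * C * (P * K * ?X) * (2 * S * R * \<tau>) ^ (?k + b) *
        (M ?k * M b) * (1 / (1 + infnorm \<xi>) ^ ?N)"
      have sp: "smooth p" and sf: "smooth f"
        using p f by (auto simp: symbol_bound_def schwartz_bound_def)
      note nn = symbol_bound_nonneg[OF M(1) p] schwartz_bound_nonneg[OF M(1) f]
      have nnx: "0 \<le> ?X" by (intro zero_le_power add_nonneg_nonneg) auto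
      have nn1: "0 \<le> exp z * C * (P * K * ?X)"
        using C nn nnx by (intro mult_nonneg_nonneg) auto
      have nnB: "0 \<le> (M ?k * M b) * (1 / (1 + infnorm \<xi>) ^ ?N)"
        using weight_pos[OF M(1)] by (intro mult_nonneg_nonneg) (auto simp: less_imp_le)
      have "cmod (iter_deriv (replicate b l) (\<lambda>\<xi>. osc_mono s us \<xi> * (?q (x, \<xi>) * f \<xi>)) \<xi>) \<le> 4 ^ b * ?B"
      proof (rule iter_deriv_replicate_mult3_bound)
        show "smooth (\<lambda>\<xi>. ?q (x, \<xi>))" by (intro smooth_slice_snd smooth_iter_deriv sp)
        fix b1 b2 b3 assume b: "b1 + b2 + b3 = b"
        have sl: "iter_deriv (replicate b2 l) (\<lambda>\<xi>. ?q (x, \<xi>)) \<xi> =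
            iter_deriv (replicate b2 (0, l) @ map (\<lambda>v. (v, 0)) ws) p (x, \<xi>)"
          by (simp add: iter_deriv_slice_snd smooth_iter_deriv sp iter_deriv_append)
        have rl: "set (replicate b3 l) \<subseteq> Basis" using l by auto
        have "cmod (iter_deriv (replicate b1 l) (osc_mono s us) \<xi>) *
            cmod (iter_deriv (replicate b2 l) (\<lambda>\<xi>. ?q (x, \<xi>)) \<xi>) *
            cmod (iter_deriv (replicate b3 l) f \<xi>) \<le>
          exp z * C * (P * K * ?X) * (2 * S * R * \<tau>) ^ (length us + length ws + (b1 + b2 + b3)) *
            (M (length us + length ws) * M (b1 + b2 + b3)) * (1 / (1 + infnorm \<xi>) ^ ?N)"
        proof (rule product_estimate[OF M(1) S(1) S(2)[OF z] \<tau> R z_def])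
          show "cmod (iter_deriv (replicate b1 l) (osc_mono s us) \<xi>) \<le>
              real (length us choose b1) * fact b1 * infnorm \<xi> ^ (length us - b1)"
            by (rule iter_deriv_osc_mono_bound[OF s l us])
          show "cmod (iter_deriv (replicate b2 l) (\<lambda>\<xi>. ?q (x, \<xi>)) \<xi>) \<le>
              P * \<tau> ^ (b2 + length ws) * (M b2 * M (length ws)) * ?X * (1 + infnorm \<xi>) ^ d"
            unfolding sl by (rule symbol_boundD[OF p l ws])
          show "(1 + infnorm \<xi>) ^ (?N + d) * (infnorm \<xi> ^ (length us - b1) * cmod (iter_deriv (replicate b3 l) f \<xi>)) \<le>
              C * K * (R * \<tau>) ^ (length us - b1 + b3) * (M (length us - b1) * M b3)"
            using F3[OF f rl, of \<xi> "length us - b1"] by simp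
        qed (use nn nnx C in auto)
        then show "cmod (iter_deriv (replicate b1 l) (osc_mono s us) \<xi>) *
            cmod (iter_deriv (replicate b2 l) (\<lambda>\<xi>. ?q (x, \<xi>)) \<xi>) *
            cmod (iter_deriv (replicate b3 l) f \<xi>) \<le> ?B"
          unfolding b .
      qed (use smooth_osc_mono sf in auto)
      also have "\<dots> \<le> 4 ^ (?k + b) * ?B"
      proof (rule mult_right_mono)
        show "0 \<le> ?B"
          unfolding mult.assoc[of _ "M ?k * M b"]
        proof (rule mult_nonneg_nonneg[OF mult_nonneg_nonneg[OF nn1] nnB])
          show "0 \<le> (2 * S * R * \<tau>) ^ (?k + b)" using S(1) R \<tau> by simp
        qed
      qed (simp add: power_increasing)
      also have "\<dots> = exp z * C * (P * K * ?X) * (4 ^ (?k + b) * (2 * S * R * \<tau>) ^ (?k + b)) *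
        (M ?k * M b) * (1 / (1 + infnorm \<xi>) ^ ?N)"
        by (simp only: ac_simps)
      \<comment> \<open>The 8 is a 4 from the Leibniz rule for three factors times a 2 from the
        binomial coefficient.\<close>
      also have "4 ^ (?k + b) * (2 * S * R * \<tau>) ^ (?k + b) = (8 * S * R * \<tau>) ^ (?k + b)"
      proof -
        have "8 * S * R * \<tau> = 4 * (2 * S * R * \<tau>)" by simp
        then show ?thesis by (simp only: power_mult_distrib)
      qed
      finally show "cmod (iter_deriv (replicate b l) (\<lambda>\<xi>. osc_mono s us \<xi> * (?q (x, \<xi>) * f \<xi>)) \<xi>) \<le>
        exp z * C * (P * K * ?X) * (8 * S * R * \<tau>) ^ (?k + b) * (M ?k * M b) * decay \<xi>"
        by (simp only: decay_def)
    qed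
  qed
  moreover have "1 \<le> 8 * S * R"
    using mult_mono[of 1 S 1 R] S(1) R by simp
  ultimately show thesis using that[of "8 * S * R"] by blast
qed

definition osc_symbol ::
    "real \<Rightarrow> ('a::euclidean_space \<times> 'a \<Rightarrow> complex) \<Rightarrow> ('a \<Rightarrow> complex) \<Rightarrow> 'a \<times> 'a \<Rightarrow> complex" where
  "osc_symbol s p f z = osc s z * (p z * f (snd z))"

lemma smooth_osc_symbol:
  assumes "smooth p" "smooth f"
  shows "smooth (osc_symbol s p f)"
proof -
  have "smooth (\<lambda>z. f (0 + snd z))"
    by (rule smooth_affine[OF assms(2) bounded_linear_snd])
  then show ?thesis
    unfolding osc_symbol_def[abs_def] by (intro smooth_mult smooth_osc assms) simp
qed

lemma iter_deriv_osc_symbol: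
  assumes p: "smooth p" and f: "smooth f"
  shows "iter_deriv (map (\<lambda>v. (v, 0)) vs) (osc_symbol s p f) (x, \<xi>) =
    (\<Sum>(us, ws)\<leftarrow>splittings vs.
      osc s (x, \<xi>) * (osc_mono s us \<xi> * (iter_deriv (map (\<lambda>v. (v, 0)) ws) p (x, \<xi>) * f \<xi>)))"
proof -
  note so = smooth_slice_fst[OF smooth_osc] and sp = smooth_slice_fst[OF p]
  have fp: "smooth (\<lambda>x. f \<xi> * p (x, \<xi>))" by (intro smooth_mult smooth_const sp)
  have "iter_deriv (map (\<lambda>v. (v, 0)) vs) (osc_symbol s p f) (x, \<xi>) =
      iter_deriv vs (\<lambda>x. osc s (x, \<xi>) * (f \<xi> * p (x, \<xi>))) x"
    unfolding iter_deriv_slice_fst[OF smooth_osc_symbol[OF assms], symmetric]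
    by (simp add: osc_symbol_def mult.commute)
  also have "\<dots> = (\<Sum>(us, ws)\<leftarrow>splittings vs.
      iter_deriv us (\<lambda>x. osc s (x, \<xi>)) x * iter_deriv ws (\<lambda>x. f \<xi> * p (x, \<xi>)) x)"
    by (simp add: iter_deriv_mult[OF so fp])
  finally show ?thesis
    by (simp add: iter_deriv_osc_fst iter_deriv_cmult[OF sp] iter_deriv_slice_fst[OF p] ac_simps)
qed

lemma integral_sum_list:
  fixes F :: "'b \<Rightarrow> 'a \<Rightarrow> complex"
  assumes "\<And>z. z \<in> set zs \<Longrightarrow> integrable M (F z)"
  shows "integrable M (\<lambda>x. \<Sum>z\<leftarrow>zs. F z x) \<and>
    (LINT x|M. (\<Sum>z\<leftarrow>zs. F z x)) = (\<Sum>z\<leftarrow>zs. LINT x|M. F z x)"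
  using assms by (induction zs) auto

text \<open>The Leibniz rule in x leaves finitely many oscillatory integrals, each integrated by
  parts b times in the coordinate l. The amplitude bound without \<xi>-derivatives yields
  \<open>dominated\<close>, which is what permits differentiating under the integral sign.\<close>

lemma osc_integral_component_estimate:
  assumes M: "weight_sequence M" "non_quasianalytic M"
  obtains \<rho> where "1 \<le> \<rho>" "\<And>\<tau>. 0 < \<tau> \<Longrightarrow>
    \<exists>C>0. \<forall>s P K (p :: 'a::euclidean_space \<times> 'a \<Rightarrow> complex) f.
      \<bar>s\<bar> = 1 \<longrightarrow> symbol_bound M \<tau> P d p \<longrightarrow> schwartz_bound M \<tau> K f \<longrightarrow>
      dominated (osc_symbol s p f) \<and>
      (\<forall>l vs b x. l \<in> Basis \<longrightarrow> set vs \<subseteq> Basis \<longrightarrow>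
        \<bar>x \<bullet> l\<bar> ^ b * cmod (iter_deriv vs (param_integral (osc_symbol s p f)) x) \<le>
        C * (P * K * (1 + infnorm x) ^ d) * (\<rho> * \<tau>) ^ (length vs + b) * (M (length vs) * M b))"
proof -
  obtain \<rho>0 where \<rho>0: "1 \<le> \<rho>0" and prod: "\<And>\<tau>. 0 < \<tau> \<Longrightarrow>
    \<exists>C>0. \<forall>s P K (p :: 'a::euclidean_space \<times> 'a \<Rightarrow> complex) f us ws l b x \<xi>.
      \<bar>s\<bar> = 1 \<longrightarrow> symbol_bound M \<tau> P d p \<longrightarrow> schwartz_bound M \<tau> K f \<longrightarrow>
      set us \<subseteq> Basis \<longrightarrow> set ws \<subseteq> Basis \<longrightarrow> l \<in> Basis \<longrightarrow>
      cmod (iter_deriv (replicate b l)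
        (\<lambda>\<xi>. osc_mono s us \<xi> * (iter_deriv (map (\<lambda>v. (v, 0)) ws) p (x, \<xi>) * f \<xi>)) \<xi>) \<le>
      C * (P * K * (1 + infnorm x) ^ d) * (\<rho>0 * \<tau>) ^ (length us + length ws + b) *
        (M (length us + length ws) * M b) * decay \<xi>"
    using symbol_product_bound[OF M, where ?'a='a and d=d] by blast
  let ?I = "LINT \<xi>|lborel. decay (\<xi>::'a)"
  have I: "0 \<le> ?I"
    by (intro integral_nonneg_AE AE_I2 less_imp_le decay_pos)
  have "\<exists>C>0. \<forall>s P K (p :: 'a \<times> 'a \<Rightarrow> complex) f.
      \<bar>s\<bar> = 1 \<longrightarrow> symbol_bound M \<tau> P d p \<longrightarrow> schwartz_bound M \<tau> K f \<longrightarrow>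
      dominated (osc_symbol s p f) \<and>
      (\<forall>l vs b x. l \<in> Basis \<longrightarrow> set vs \<subseteq> Basis \<longrightarrow>
        \<bar>x \<bullet> l\<bar> ^ b * cmod (iter_deriv vs (param_integral (osc_symbol s p f)) x) \<le>
        C * (P * K * (1 + infnorm x) ^ d) * (2 * \<rho>0 * \<tau>) ^ (length vs + b) * (M (length vs) * M b))"
    if \<tau>: "0 < \<tau>" for \<tau>
  proof -
    obtain C where C: "0 < C" and bound: "\<And>s P K (p :: 'a \<times> 'a \<Rightarrow> complex) f us ws l b x \<xi>.
      \<bar>s\<bar> = 1 \<Longrightarrow> symbol_bound M \<tau> P d p \<Longrightarrow> schwartz_bound M \<tau> K f \<Longrightarrow>
      set us \<subseteq> Basis \<Longrightarrow> set ws \<subseteq> Basis \<Longrightarrow> l \<in> Basis \<Longrightarrow>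
      cmod (iter_deriv (replicate b l)
        (\<lambda>\<xi>. osc_mono s us \<xi> * (iter_deriv (map (\<lambda>v. (v, 0)) ws) p (x, \<xi>) * f \<xi>)) \<xi>) \<le>
      C * (P * K * (1 + infnorm x) ^ d) * (\<rho>0 * \<tau>) ^ (length us + length ws + b) *
        (M (length us + length ws) * M b) * decay \<xi>"
      using prod[OF \<tau>] by blast
    show ?thesis
    \<comment> \<open>Only nonnegativity of \<open>?I\<close> has been recorded; the added 1 keeps
      the constant positive.\<close>
    proof (intro exI[of _ "C * (?I + 1)"] conjI allI impI)
      show "0 < C * (?I + 1)" using C I by simp
      fix s P K :: real and p :: "'a \<times> 'a \<Rightarrow> complex" and f :: "'a \<Rightarrow> complex"
      assume s: "\<bar>s\<bar> = 1" and p: "symbol_bound M \<tau> P d p" and f: "schwartz_bound M \<tau> K f"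
      let ?g = "osc_symbol s p f"
      let ?r = "\<lambda>us ws x \<xi>. osc_mono s us \<xi> * (iter_deriv (map (\<lambda>v. (v, 0)) ws) p (x, \<xi>) * f \<xi>)"
      let ?B = "\<lambda>vs b x. C * (P * K * (1 + infnorm x) ^ d) * (\<rho>0 * \<tau>) ^ (length vs + b) * (M (length vs) * M b)"
      have sp: "smooth p" and sf: "smooth f"
        using p f by (auto simp: symbol_bound_def schwartz_bound_def)
      note nn = symbol_bound_nonneg[OF M(1) p] schwartz_bound_nonneg[OF M(1) f]
      have sr: "smooth (?r us ws x)" for us ws x
        by (intro smooth_mult smooth_osc_mono smooth_slice_snd smooth_iter_deriv sp sf)
      have r: "cmod (iter_deriv (replicate b l) (?r us ws x) \<xi>) \<le> ?B vs b x * decay \<xi>"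
        if "(us, ws) \<in> set (splittings vs)" "set vs \<subseteq> Basis" "l \<in> Basis" for us ws vs b l x \<xi>
        using bound[OF s p f, of us ws l b x \<xi>] in_splittings[OF that(1)] that(2,3) by auto
      have deriv: "iter_deriv (map (\<lambda>v. (v, 0)) vs) ?g (x, \<xi>) =
          (\<Sum>z\<leftarrow>splittings vs. osc s (x, \<xi>) * ?r (fst z) (snd z) x \<xi>)" for vs x \<xi>
        unfolding iter_deriv_osc_symbol[OF sp sf] by (simp add: case_prod_beta')
      show dom: "dominated ?g"
        unfolding dominated_def
      proof (intro conjI allI impI exI)
        show "smooth ?g" by (rule smooth_osc_symbol[OF sp sf])
        fix vs :: "'a list" and R and x \<xi> :: 'a
        assume vs: "set vs \<subseteq> Basis" and x: "norm x \<le> R"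
        let ?D = "C * (P * K * (1 + R) ^ d) * (\<rho>0 * \<tau>) ^ length vs * (M (length vs) * M 0)"
        have BD: "?B vs 0 x \<le> ?D"
        proof -
          have "(1 + infnorm x) ^ d \<le> (1 + R) ^ d"
            using infnorm_le_norm[of x] x by (intro power_mono) auto
          then show ?thesis
            using C nn \<rho>0 \<tau> weight_pos[OF M(1)]
            by (simp only: add_0_right) (intro mult_right_mono mult_left_mono; simp add: less_imp_le)
        qed
        have "cmod (\<Sum>z\<leftarrow>splittings vs. osc s (x, \<xi>) * ?r (fst z) (snd z) x \<xi>) \<le>
            real (length (splittings vs)) * (?D * decay \<xi>)"
        proof (rule norm_sum_list_le)
          fix z assume z: "z \<in> set (splittings vs)"
          \<comment> \<open>No \<xi>-derivative is taken: an arbitrary basis vector fits the case b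
            = 0 to the shape of \<open>r\<close>.\<close>
          have "cmod (iter_deriv (replicate 0 (SOME l. l \<in> Basis)) (?r (fst z) (snd z) x) \<xi>) \<le> ?B vs 0 x * decay \<xi>"
            using z by (intro r[OF _ vs SOME_Basis]) simp
          also have "\<dots> \<le> ?D * decay \<xi>"
            by (intro mult_right_mono BD less_imp_le decay_pos)
          finally show "cmod (osc s (x, \<xi>) * ?r (fst z) (snd z) x \<xi>) \<le> ?D * decay \<xi>"
            unfolding norm_mult[of "osc s (x, \<xi>)"] by simp
        qed
        then show "cmod (iter_deriv (map (\<lambda>v. (v, 0)) vs) ?g (x, \<xi>)) \<le> (2 ^ length vs * ?D) * decay \<xi>"
          unfolding deriv by (simp add: length_splittings mult.assoc)
      qed
      fix l :: 'a and vs :: "'a list" and b :: nat and x :: 'a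
      assume l: "l \<in> Basis" and vs: "set vs \<subseteq> Basis"
      have Bnn: "0 \<le> ?B vs b x"
        using C nn \<rho>0 \<tau> weight_pos[OF M(1)]
        by (intro mult_nonneg_nonneg zero_le_power add_nonneg_nonneg) (auto simp: less_imp_le)
      have int: "integrable lborel (\<lambda>\<xi>. osc s (x, \<xi>) * ?r us ws x \<xi>)"
        if z: "(us, ws) \<in> set (splittings vs)" for us ws
        using r[OF z vs l, of 0 x]
        by (intro integrable_decay_bound[where C="?B vs 0 x"] smooth_mult[OF smooth_slice_snd[OF smooth_osc] sr])
          (simp add: norm_mult)
      have eq: "iter_deriv vs (param_integral ?g) x =
          (\<Sum>z\<leftarrow>splittings vs. LINT \<xi>|lborel. osc s (x, \<xi>) * ?r (fst z) (snd z) x \<xi>)"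
      proof -
        have "iter_deriv vs (param_integral ?g) x =
            (LINT \<xi>|lborel. (\<Sum>z\<leftarrow>splittings vs. osc s (x, \<xi>) * ?r (fst z) (snd z) x \<xi>))"
          using iter_deriv_param_integral[OF dom vs] by (simp add: param_integral_def deriv)
        also have "\<dots> = (\<Sum>z\<leftarrow>splittings vs. LINT \<xi>|lborel. osc s (x, \<xi>) * ?r (fst z) (snd z) x \<xi>)"
          by (rule integral_sum_list[THEN conjunct2]) (use int in auto)
        finally show ?thesis .
      qed
      have "\<bar>x \<bullet> l\<bar> ^ b * cmod (iter_deriv vs (param_integral ?g) x) =
          cmod (\<Sum>z\<leftarrow>splittings vs. complex_of_real (\<bar>x \<bullet> l\<bar> ^ b) *
            (LINT \<xi>|lborel. osc s (x, \<xi>) * ?r (fst z) (snd z) x \<xi>))"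
        unfolding eq by (simp only: sum_list_const_mult norm_mult) (simp add: norm_power)
      also have "\<dots> \<le> real (length (splittings vs)) * (?B vs b x * ?I)"
      proof (rule norm_sum_list_le)
        fix z assume z: "z \<in> set (splittings vs)"
        then have z': "(fst z, snd z) \<in> set (splittings vs)" by simp
        have "\<bar>x \<bullet> l\<bar> ^ b * cmod (LINT \<xi>|lborel. osc s (x, \<xi>) * ?r (fst z) (snd z) x \<xi>) \<le> ?B vs b x * ?I"
          by (rule osc_integral_bound[OF sr l s _ r[OF z' vs l]]) (use r[OF z' vs l] in blast)
        then show "cmod (complex_of_real (\<bar>x \<bullet> l\<bar> ^ b) *
            (LINT \<xi>|lborel. osc s (x, \<xi>) * ?r (fst z) (snd z) x \<xi>)) \<le> ?B vs b x * ?I"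
          by (simp add: norm_mult norm_power)
      qed
      also have "\<dots> \<le> 2 ^ (length vs + b) * (?B vs b x * (?I + 1))"
        using Bnn I by (intro mult_mono mult_left_mono) (auto simp: length_splittings power_increasing)
      also have "\<dots> = (C * (?I + 1)) * (P * K * (1 + infnorm x) ^ d) * (2 ^ (length vs + b) * (\<rho>0 * \<tau>) ^ (length vs + b)) *
          (M (length vs) * M b)"
        by (simp only: ac_simps)
      also have "2 ^ (length vs + b) * (\<rho>0 * \<tau>) ^ (length vs + b) = (2 * \<rho>0 * \<tau>) ^ (length vs + b)"
        by (simp only: power_mult_distrib mult.assoc)
      finally show "\<bar>x \<bullet> l\<bar> ^ b * cmod (iter_deriv vs (param_integral ?g) x) \<le>
        (C * (?I + 1)) * (P * K * (1 + infnorm x) ^ d) * (2 * \<rho>0 * \<tau>) ^ (length vs + b) * (M (length vs) * M b)" .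
    qed
  qed
  with that[of "2 * \<rho>0"] \<rho>0 show thesis by simp
qed

lemma infnorm_attained:
  fixes x :: "'a::euclidean_space"
  obtains l where "l \<in> Basis" "infnorm x = \<bar>x \<bullet> l\<bar>"
proof -
  have "Max ((\<lambda>i. \<bar>x \<bullet> i\<bar>) ` Basis) \<in> (\<lambda>i. \<bar>x \<bullet> i\<bar>) ` Basis"
    by (intro Max_in) auto
  then obtain l where "l \<in> Basis" "Max ((\<lambda>i. \<bar>x \<bullet> i\<bar>) ` Basis) = \<bar>x \<bullet> l\<bar>"
    by (rule imageE)
  then show thesis using that by (simp add: infnorm_Max)
qed

text \<open>The growth in \<open>x\<close> is absorbed by \<open>d\<close> additional powers of the largest coordinate of \<open>x\<close>.\<close>

lemma osc_integral_schwartz_bound: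
  assumes M: "weight_sequence M" "non_quasianalytic M"
  obtains \<rho> where "1 \<le> \<rho>" "\<And>\<tau>. 0 < \<tau> \<Longrightarrow>
    \<exists>C>0. \<forall>s P K (p :: 'a::euclidean_space \<times> 'a \<Rightarrow> complex) f.
      \<bar>s\<bar> = 1 \<longrightarrow> symbol_bound M \<tau> P d p \<longrightarrow> schwartz_bound M \<tau> K f \<longrightarrow>
      dominated (osc_symbol s p f) \<and>
      schwartz_bound M (\<rho> * \<tau>) (C * (P * K)) (param_integral (osc_symbol s p f))"
proof -
  obtain \<rho>0 where \<rho>0: "1 \<le> \<rho>0" and comp: "\<And>\<tau>. 0 < \<tau> \<Longrightarrow>
    \<exists>C>0. \<forall>s P K (p :: 'a::euclidean_space \<times> 'a \<Rightarrow> complex) f.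
      \<bar>s\<bar> = 1 \<longrightarrow> symbol_bound M \<tau> P d p \<longrightarrow> schwartz_bound M \<tau> K f \<longrightarrow>
      dominated (osc_symbol s p f) \<and>
      (\<forall>l vs b x. l \<in> Basis \<longrightarrow> set vs \<subseteq> Basis \<longrightarrow>
        \<bar>x \<bullet> l\<bar> ^ b * cmod (iter_deriv vs (param_integral (osc_symbol s p f)) x) \<le>
        C * (P * K * (1 + infnorm x) ^ d) * (\<rho>0 * \<tau>) ^ (length vs + b) * (M (length vs) * M b))"
    using osc_integral_component_estimate[OF M, where ?'a='a and d=d] by blast
  obtain C0 R where CR: "1 \<le> C0" "1 \<le> R" "\<And>j. M (j + d) \<le> C0 * R ^ j * M j"
    using weight_shift_le[OF M(1)] by blast
  note pos = weight_pos[OF M(1)]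
  have "\<exists>C>0. \<forall>s P K (p :: 'a::euclidean_space \<times> 'a \<Rightarrow> complex) f.
      \<bar>s\<bar> = 1 \<longrightarrow> symbol_bound M \<tau> P d p \<longrightarrow> schwartz_bound M \<tau> K f \<longrightarrow>
      dominated (osc_symbol s p f) \<and>
      schwartz_bound M (R * \<rho>0 * \<tau>) (C * (P * K)) (param_integral (osc_symbol s p f))"
    if \<tau>: "0 < \<tau>" for \<tau>
  proof -
    define \<sigma> where "\<sigma> = \<rho>0 * \<tau>"
    have \<sigma>: "0 < \<sigma>" using \<rho>0 \<tau> by (simp add: \<sigma>_def)
    obtain C where C: "0 < C" and dom: "\<And>s P K (p :: 'a::euclidean_space \<times> 'a \<Rightarrow> complex) f.
      \<bar>s\<bar> = 1 \<Longrightarrow> symbol_bound M \<tau> P d p \<Longrightarrow> schwartz_bound M \<tau> K f \<Longrightarrow>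
      dominated (osc_symbol s p f)"
      and bound: "\<And>s P K (p :: 'a::euclidean_space \<times> 'a \<Rightarrow> complex) f l vs b x.
      \<bar>s\<bar> = 1 \<Longrightarrow> symbol_bound M \<tau> P d p \<Longrightarrow> schwartz_bound M \<tau> K f \<Longrightarrow>
        l \<in> Basis \<Longrightarrow> set vs \<subseteq> Basis \<Longrightarrow>
        \<bar>x \<bullet> l\<bar> ^ b * cmod (iter_deriv vs (param_integral (osc_symbol s p f)) x) \<le>
        C * (P * K * (1 + infnorm x) ^ d) * \<sigma> ^ (length vs + b) * (M (length vs) * M b)"
      using comp[OF \<tau>] unfolding \<sigma>_def by blast
    define C' where "C' = C * 2 ^ d * (1 + \<sigma> ^ d * C0)"
    have ge0: "0 \<le> \<sigma> ^ d * C0" using \<sigma> CR by simp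
    show ?thesis
    proof (intro exI[of _ C'] conjI allI impI)
      show "0 < C'" using C ge0 by (simp add: C'_def)
      fix s P K :: real and p :: "'a \<times> 'a \<Rightarrow> complex" and f :: "'a \<Rightarrow> complex"
      assume s: "\<bar>s\<bar> = 1" and p: "symbol_bound M \<tau> P d p" and f: "schwartz_bound M \<tau> K f"
      show "dominated (osc_symbol s p f)" by (rule dom[OF s p f])
      note nn = symbol_bound_nonneg[OF M(1) p] schwartz_bound_nonneg[OF M(1) f]
      let ?F = "\<lambda>vs x. cmod (iter_deriv vs (param_integral (osc_symbol s p f)) x)"
      show "schwartz_bound M (R * \<rho>0 * \<tau>) (C' * (P * K)) (param_integral (osc_symbol s p f))"
        unfolding schwartz_bound_def
      proof (intro conjI allI impI)
        show "smooth (param_integral (osc_symbol s p f))"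
          by (rule smooth_param_integral[OF dom[OF s p f]])
        fix vs :: "'a list" and a and x :: 'a assume vs: "set vs \<subseteq> Basis"
        let ?y = "infnorm x" and ?n = "length vs"
        obtain l where l: "l \<in> Basis" "?y = \<bar>x \<bullet> l\<bar>" by (rule infnorm_attained)
        have y: "?y ^ b * ?F vs x \<le> C * (P * K * (1 + ?y) ^ d) * \<sigma> ^ (?n + b) * (M ?n * M b)" for b
          using bound[OF s p f l(1) vs, of x b] by (simp only: l(2))
        let ?Z = "C * 2 ^ d * (P * K) * (R * \<sigma>) ^ (a + ?n) * (M a * M ?n)"
        have Z: "0 \<le> ?Z"
          using C nn \<sigma> CR(2) pos by (intro mult_nonneg_nonneg zero_le_power) (auto simp: less_imp_le)
        have \<sigma>R: "\<sigma> ^ (?n + a) * R ^ a \<le> (R * \<sigma>) ^ (a + ?n)"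
        proof -
          have "\<sigma> ^ (?n + a) * R ^ a \<le> \<sigma> ^ (?n + a) * R ^ (?n + a)"
            using \<sigma> CR(2) by (intro mult_left_mono power_increasing) auto
          then show ?thesis by (simp add: power_mult_distrib ac_simps)
        qed
        have "?y ^ a * ?F vs x \<le> (1 + \<sigma> ^ d * C0) * ?Z"
        proof (cases "?y \<le> 1")
          case True
          have "?y ^ a * ?F vs x \<le> C * (P * K * (1 + ?y) ^ d) * \<sigma> ^ (?n + a) * (M ?n * M a)" by (rule y)
          also have "\<dots> \<le> C * (P * K * 2 ^ d) * (R * \<sigma>) ^ (?n + a) * (M ?n * M a)"
            using C nn \<sigma> CR(2) pos True
            by (intro mult_mono mult_left_mono mult_right_mono power_mono) (auto simp: less_imp_le)
          also have "\<dots> = ?Z" by (simp add: ac_simps)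
          also have "\<dots> \<le> (1 + \<sigma> ^ d * C0) * ?Z"
            using mult_right_mono[of 1 "1 + \<sigma> ^ d * C0" ?Z] Z ge0 by simp
          finally show ?thesis .
        next
          case False
          then have y1: "1 < ?y" by simp
          have "(?y ^ a * ?F vs x) * ?y ^ d = ?y ^ (a + d) * ?F vs x" by (simp add: power_add)
          also have "\<dots> \<le> C * (P * K * (1 + ?y) ^ d) * \<sigma> ^ (?n + (a + d)) * (M ?n * M (a + d))" by (rule y)
          also have "\<dots> \<le> C * (P * K * (2 * ?y) ^ d) * \<sigma> ^ (?n + (a + d)) * (M ?n * (C0 * R ^ a * M a))"
            using C nn \<sigma> CR pos y1
            by (intro mult_mono mult_left_mono mult_right_mono power_mono) (auto simp: less_imp_le)
          also have "\<dots> = (\<sigma> ^ d * C0) * (C * 2 ^ d * (P * K) * (\<sigma> ^ (?n + a) * R ^ a) * (M a * M ?n)) * ?y ^ d"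
            by (simp add: power_add power_mult_distrib ac_simps)
          also have "\<dots> \<le> (\<sigma> ^ d * C0) * ?Z * ?y ^ d"
            using C nn \<sigma> CR pos y1 ge0 \<sigma>R
            by (intro mult_right_mono mult_left_mono) (auto simp: less_imp_le)
          finally have "?y ^ a * ?F vs x \<le> (\<sigma> ^ d * C0) * ?Z"
            by (rule mult_right_le_imp_le) (use y1 in simp)
          also have "\<dots> \<le> (1 + \<sigma> ^ d * C0) * ?Z"
            using Z by (intro mult_right_mono) auto
          finally show ?thesis .
        qed
        then show "?y ^ a * ?F vs x \<le> C' * (P * K) * (R * \<rho>0 * \<tau>) ^ (a + ?n) * (M a * M ?n)"
          by (simp add: C'_def \<sigma>_def ac_simps)
      qed
    qed
  qed
  moreover have "1 \<le> R * \<rho>0"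
    using mult_mono[of 1 R 1 \<rho>0] \<rho>0 CR(2) by simp
  ultimately show thesis using that[of "R * \<rho>0"] by blast
qed

section \<open>Gelfand--Shilov norms and symbol classes\<close>

lemma Basis_list_eq_map_axis:
  assumes "set vs \<subseteq> (Basis :: (real ^ 'n) set)"
  obtains js where "vs = map (\<lambda>i. axis i 1) js"
proof -
  have "\<exists>js. vs = map (\<lambda>i. axis i 1) js"
    using assms
  proof (induction vs)
    case (Cons v vs)
    then obtain js where "vs = map (\<lambda>i. axis i 1) js" by auto
    moreover from Cons.prems obtain i where "v = axis i 1" by (auto simp: Basis_vec_def)
    ultimately have "v # vs = map (\<lambda>i. axis i 1) (i # js)" by simp
    then show ?case by (rule exI)
  qed simp
  then show thesis by (rule exE) (rule that)
qed

lemma set_map_axis: "set (map (\<lambda>i. axis i 1) js) \<subseteq> (Basis :: (real ^ 'n) set)"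
  by (auto simp: axis_in_Basis_iff)

text \<open>By commutation the list chosen by \<open>SOME\<close> may be replaced by any list with
  the same counts. This is the bridge from multi-indices to lists.\<close>

lemma mi_deriv_eq_iter_deriv:
  assumes "smooth f" and "\<And>i. count_list js i = \<alpha> i"
  shows "mi_deriv \<alpha> f = iter_deriv (map (\<lambda>i. axis i 1) js) f"
proof -
  define js' where "js' = (SOME is. \<forall>i. count_list is i = \<alpha> i)"
  have "\<forall>i. count_list js' i = \<alpha> i"
    unfolding js'_def by (rule someI[of _ js]) (simp add: assms(2))
  then have "mset js' = mset js"
    by (intro multiset_eqI) (simp add: count_mset assms(2))
  then have "mset (map (\<lambda>i. axis i (1::real)) js') = mset (map (\<lambda>i. axis i 1) js)"
    by simp
  then have "iter_deriv (map (\<lambda>i. axis i 1) js') f = iter_deriv (map (\<lambda>i. axis i 1) js) f"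
    by (rule iter_deriv_mset_cong[OF assms(1)])
  then show ?thesis
    by (simp add: mi_deriv_def js'_def iter_deriv_def foldr_map o_def)
qed

lemma mi_order_count_list: "mi_order (count_list js) = length js"
  unfolding mi_order_def by (rule sum_count_set) auto

lemma multi_index_list:
  fixes \<alpha> :: "'n::finite \<Rightarrow> nat"
  obtains js where "count_list js = \<alpha>"
proof -
  obtain js where js: "mset js = (\<Sum>i\<in>UNIV. replicate_mset (\<alpha> i) i)"
    using ex_mset by blast
  have "count_list js i = \<alpha> i" for i
    by (simp add: js count_sum flip: count_mset)
  then show thesis using that by blast
qed

lemma mi_order_single [simp]: "mi_order (\<lambda>i. if i = j then a else 0) = a"
  by (simp add: mi_order_def)

lemma mi_monomial_single: "mi_monomial x (\<lambda>i. if i = j then a else 0) = (x $ j) ^ a"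
proof -
  have "mi_monomial x (\<lambda>i. if i = j then a else 0) = (\<Prod>i\<in>UNIV. if i = j then (x $ i) ^ a else 1)"
    unfolding mi_monomial_def by (intro prod.cong) auto
  then show ?thesis by simp
qed

lemma abs_mi_monomial_le: "\<bar>mi_monomial x \<beta>\<bar> \<le> infnorm x ^ mi_order \<beta>"
proof -
  have "\<bar>mi_monomial x \<beta>\<bar> = (\<Prod>i\<in>UNIV. \<bar>x $ i\<bar> ^ \<beta> i)"
    by (simp add: mi_monomial_def abs_prod power_abs)
  also have "\<dots> \<le> (\<Prod>i\<in>UNIV. infnorm x ^ \<beta> i)"
    by (intro prod_mono conjI power_mono component_le_infnorm_cart) auto
  finally show ?thesis by (simp add: mi_order_def power_sum)
qed

section \<open>Gelfand-Shilov norms as Schwartz bounds\<close>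

lemma GS_step_smooth: "f \<in> GS_step M h \<Longrightarrow> smooth f"
  by (simp add: GS_step_def)

lemma gs_quotient_le_norm: "f \<in> GS_step M h \<Longrightarrow> gs_quotient M h f z \<le> GS_norm M h f"
  unfolding GS_norm_def GS_step_def by (intro cSUP_upper) auto

lemma GS_stepI:
  assumes "smooth f" "\<And>z. gs_quotient M h f z \<le> K"
  shows "f \<in> GS_step M h" "GS_norm M h f \<le> K"
  using assms by (auto simp: GS_step_def GS_norm_def intro!: cSUP_least bdd_aboveI[of _ K])

lemma scaled_le_iff:
  fixes h t Y K :: real
  assumes "0 < h" "0 < Y"
  shows "h ^ k / Y * t \<le> K \<longleftrightarrow> t \<le> K * (1 / h) ^ k * Y"
proof -
  have "0 < h ^ k" using assms(1) by simp
  then show ?thesis using assms(2) by (simp add: power_one_over field_simps)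
qed

text \<open>The power of \<open>infnorm x\<close> is the modulus of a monomial in the largest
  coordinate alone, so it already occurs in the supremum over multi-indices and no constant is
  lost.\<close>

lemma GS_step_schwartz_bound:
  fixes f :: "real ^ 'n::finite \<Rightarrow> complex"
  assumes M: "weight_sequence M" and h: "0 < h" and f: "f \<in> GS_step M h"
  shows "schwartz_bound M (1 / h) (GS_norm M h f) f"
  unfolding schwartz_bound_def
proof (intro conjI allI impI)
  show sm: "smooth f" by (rule GS_step_smooth[OF f])
  fix vs :: "(real ^ 'n) list" and a and x :: "real ^ 'n"
  assume vs: "set vs \<subseteq> Basis"
  obtain js :: "'n list" where js: "vs = map (\<lambda>i. axis i 1) js"
    by (rule Basis_list_eq_map_axis[OF vs])
  obtain l where l: "l \<in> Basis" "infnorm x = \<bar>x \<bullet> l\<bar>" by (rule infnorm_attained)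
  then obtain j where j: "infnorm x = \<bar>x $ j\<bar>"
    by (auto simp: Basis_vec_def inner_axis)
  note pos = weight_pos[OF M]
  have "mi_deriv (count_list js) f = iter_deriv vs f"
    unfolding js by (rule mi_deriv_eq_iter_deriv[OF sm]) simp
  then have "h ^ (length vs + a) / (M (length vs) * M a) * (infnorm x ^ a * cmod (iter_deriv vs f x)) \<le> GS_norm M h f"
    using gs_quotient_le_norm[OF f, of "(count_list js, (\<lambda>i. if i = j then a else 0), x)"]
    by (simp add: gs_quotient_def mi_order_count_list mi_monomial_single norm_mult norm_power js j power_abs)
  then show "infnorm x ^ a * cmod (iter_deriv vs f x) \<le>
      GS_norm M h f * (1 / h) ^ (a + length vs) * (M a * M (length vs))"
    using scaled_le_iff[OF h, of "M (length vs) * M a"] pos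
    by (simp add: add.commute[of a] mult.commute[of "M a"])
qed

text \<open>Conversely, every monomial is at most the power of \<open>infnorm x\<close> of the same
  order, so the way back keeps h and the constant too.\<close>

lemma schwartz_bound_GS_step:
  fixes f :: "real ^ 'n::finite \<Rightarrow> complex"
  assumes M: "weight_sequence M" and h: "0 < h" and f: "schwartz_bound M (1 / h) K f"
  shows "f \<in> GS_step M h" "GS_norm M h f \<le> K"
proof -
  have sm: "smooth f" using f by (simp add: schwartz_bound_def)
  note pos = weight_pos[OF M]
  have q: "gs_quotient M h f z \<le> K" for z
  proof -
    obtain \<alpha> \<beta> x where z: "z = (\<alpha>, \<beta>, x)" by (cases z) auto
    obtain js where js: "count_list js = \<alpha>" by (rule multi_index_list)
    let ?vs = "map (\<lambda>i. axis i 1) js :: (real ^ 'n) list"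
    have d: "mi_deriv \<alpha> f = iter_deriv ?vs f"
      by (rule mi_deriv_eq_iter_deriv[OF sm]) (simp add: js)
    have len: "mi_order \<alpha> = length ?vs" by (simp add: mi_order_count_list flip: js)
    have "\<bar>mi_monomial x \<beta>\<bar> * cmod (iter_deriv ?vs f x) \<le> infnorm x ^ mi_order \<beta> * cmod (iter_deriv ?vs f x)"
      by (intro mult_right_mono abs_mi_monomial_le) simp
    also have "\<dots> \<le> K * (1 / h) ^ (mi_order \<beta> + length ?vs) * (M (mi_order \<beta>) * M (length ?vs))"
      by (rule schwartz_boundD[OF f set_map_axis])
    finally have "\<bar>mi_monomial x \<beta>\<bar> * cmod (iter_deriv ?vs f x) \<le>
      K * (1 / h) ^ (mi_order \<beta> + length ?vs) * (M (mi_order \<beta>) * M (length ?vs))" .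
    then show ?thesis
      using scaled_le_iff[OF h, of "M (length ?vs) * M (mi_order \<beta>)"] pos
      by (simp add: z gs_quotient_def d len norm_mult add.commute[of "mi_order \<beta>"]
          mult.commute[of "M (mi_order \<beta>)"])
  qed
  show "f \<in> GS_step M h" "GS_norm M h f \<le> K"
    using GS_stepI[OF sm q] by auto
qed

lemma schwartz_bound_mono:
  assumes "weight_sequence M" "schwartz_bound M \<tau> K f" "0 \<le> \<tau>" "\<tau> \<le> \<tau>'"
  shows "schwartz_bound M \<tau>' K f"
  unfolding schwartz_bound_def
proof (intro conjI allI impI)
  show "smooth f" using assms(2) by (simp add: schwartz_bound_def)
  fix vs :: "'a list" and a x
  assume "set vs \<subseteq> Basis"
  then have "infnorm x ^ a * cmod (iter_deriv vs f x) \<le> K * \<tau> ^ (a + length vs) * (M a * M (length vs))"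
    by (rule schwartz_boundD[OF assms(2)])
  also have "\<dots> \<le> K * \<tau>' ^ (a + length vs) * (M a * M (length vs))"
    using assms schwartz_bound_nonneg[OF assms(1,2)] weight_pos[OF assms(1)]
    by (intro mult_right_mono mult_left_mono power_mono) (auto simp: less_imp_le)
  finally show "infnorm x ^ a * cmod (iter_deriv vs f x) \<le> K * \<tau>' ^ (a + length vs) * (M a * M (length vs))" .
qed

section \<open>Symbol classes as symbol bounds\<close>

lemma symbol_bound_mono:
  assumes "weight_sequence M" "symbol_bound M \<tau> P d p" "0 \<le> \<tau>" "\<tau> \<le> \<tau>'"
  shows "symbol_bound M \<tau>' P d p"
  unfolding symbol_bound_def
proof (intro conjI allI impI)
  show "smooth p" using assms(2) by (simp add: symbol_bound_def)
  fix l :: 'a and b and vs :: "'a list" and x \<xi> :: 'a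
  assume "l \<in> Basis" "set vs \<subseteq> Basis"
  from symbol_boundD[OF assms(2) this]
  have "cmod (iter_deriv (replicate b (0, l) @ map (\<lambda>v. (v, 0)) vs) p (x, \<xi>)) \<le>
    P * \<tau> ^ (b + length vs) * (M b * M (length vs)) * (1 + infnorm x) ^ d * (1 + infnorm \<xi>) ^ d" .
  also have "\<dots> \<le> P * \<tau>' ^ (b + length vs) * (M b * M (length vs)) * (1 + infnorm x) ^ d * (1 + infnorm \<xi>) ^ d"
    using assms symbol_bound_nonneg[OF assms(1,2)] weight_pos[OF assms(1)]
    by (intro mult_right_mono mult_left_mono power_mono) (auto simp: less_imp_le)
  finally show "cmod (iter_deriv (replicate b (0, l) @ map (\<lambda>v. (v, 0)) vs) p (x, \<xi>)) \<le>
    P * \<tau>' ^ (b + length vs) * (M b * M (length vs)) * (1 + infnorm x) ^ d * (1 + infnorm \<xi>) ^ d" .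
qed

text \<open>Covers the Fourier transform, whose symbol is the normalising constant. With
  \<open>\<tau>\<close> and d arbitrary it fits the parameters forced by the actual symbol.\<close>

lemma symbol_bound_const:
  assumes "weight_sequence M" "0 < \<tau>"
  shows "symbol_bound M \<tau> (cmod c) d (\<lambda>_. c)"
  unfolding symbol_bound_def
proof (intro conjI allI impI smooth_const)
  fix l :: 'a and b and vs :: "'a list" and x \<xi> :: 'a
  have nn: "0 \<le> cmod c * \<tau> ^ (b + length vs) * (M b * M (length vs)) * (1 + infnorm x) ^ d * (1 + infnorm \<xi>) ^ d"
    using assms(2) weight_pos[OF assms(1)]
    by (intro mult_nonneg_nonneg zero_le_power add_nonneg_nonneg) (auto simp: less_imp_le)
  show "cmod (iter_deriv (replicate b (0, l) @ map (\<lambda>v. (v, 0)) vs) (\<lambda>_. c) (x, \<xi>)) \<le>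
    cmod c * \<tau> ^ (b + length vs) * (M b * M (length vs)) * (1 + infnorm x) ^ d * (1 + infnorm \<xi>) ^ d"
  proof (cases "b = 0 \<and> vs = []")
    case True
    have "cmod c * (1 * 1) \<le> cmod c * ((1 + infnorm x) ^ d * (1 + infnorm \<xi>) ^ d)"
      by (intro mult_left_mono mult_mono one_le_power) auto
    with True show ?thesis by (simp add: weight_0[OF assms(1)])
  next
    case False
    then show ?thesis using nn by (auto simp: iter_deriv_const)
  qed
qed

lemma symbol_bound_cmult:
  assumes "symbol_bound M \<tau> P d p"
  shows "symbol_bound M \<tau> (cmod c * P) d (\<lambda>z. c * p z)"
proof -
  have sm: "smooth p" using assms by (simp add: symbol_bound_def)
  then show ?thesis
    using assms unfolding symbol_bound_def
    by (auto simp: smooth_mult iter_deriv_cmult norm_mult mult.assoc intro!: mult_left_mono)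
qed

lemma jbracket_ge_1: "1 \<le> jbracket x"
  by (simp add: jbracket_def)

text \<open>Brackets are at least 1, so any exponent, negative ones included, may be raised to d.
  The constant comes from comparing the Euclidean norm with \<open>infnorm\<close>.\<close>

lemma jbracket_powr_le:
  fixes x :: "real ^ 'n::finite"
  assumes "e \<le> real d"
  shows "jbracket x powr e \<le> (1 + sqrt (real CARD('n))) ^ d * (1 + infnorm x) ^ d"
proof -
  let ?c = "sqrt (real CARD('n))"
  have "jbracket x \<le> sqrt (1\<^sup>2) + sqrt ((norm x)\<^sup>2)"
    unfolding jbracket_def by (rule order_trans[OF _ sqrt_add_le_add_sqrt]) auto
  also have "\<dots> \<le> 1 + ?c * infnorm x"
    using norm_le_infnorm[of x] by simp
  also have "\<dots> \<le> (1 + ?c) * (1 + infnorm x)"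
    by (simp add: algebra_simps)
  finally have le: "jbracket x \<le> (1 + ?c) * (1 + infnorm x)" .
  have "jbracket x powr e \<le> jbracket x powr real d"
    by (intro powr_mono assms jbracket_ge_1)
  also have "\<dots> = jbracket x ^ d"
    using jbracket_ge_1[of x] by (intro powr_realpow) linarith
  also have "\<dots> \<le> ((1 + ?c) * (1 + infnorm x)) ^ d"
    using jbracket_ge_1[of x] by (intro power_mono le) linarith
  finally show ?thesis by (simp add: power_mult_distrib)
qed

text \<open>Of the exponents of the brackets only the upper bound d is kept. Comparing A and B with
  M costs constants and the geometric factor \<open>H\<close>, so h is merely rescaled; everything
  that depends on p goes into P.\<close>

lemma SG_step_symbol_bound:
  fixes A B M :: "nat \<Rightarrow> real"
  assumes A: "weight_sequence A" "A \<preceq>\<^sub>w M" and B: "weight_sequence B" "B \<preceq>\<^sub>w M"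
    and M: "weight_sequence M"
  obtains H d where "1 \<le> H" "\<And>h (p :: (real ^ 'n::finite) \<times> (real ^ 'n) \<Rightarrow> complex).
    0 < h \<Longrightarrow> p \<in> SG_step m \<mu> A B h \<Longrightarrow> \<exists>P. symbol_bound M (H / h) P d p"
proof -
  obtain CA HA where HA: "0 < CA" "0 < HA" "\<And>j. A j \<le> CA * HA ^ j * M j"
    using A(2) unfolding weight_le_def by blast
  obtain CB HB where HB: "0 < CB" "0 < HB" "\<And>j. B j \<le> CB * HB ^ j * M j"
    using B(2) unfolding weight_le_def by blast
  define H where "H = max 1 (max HA HB)"
  have H: "1 \<le> H" "HA \<le> H" "HB \<le> H" by (auto simp: H_def)
  note posA = weight_pos[OF A(1)] and posB = weight_pos[OF B(1)] and posM = weight_pos[OF M]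
  have AM: "A j \<le> CA * H ^ j * M j" for j
    by (rule order_trans[OF HA(3)])
      (use H HA(1,2) posM in \<open>auto intro!: mult_right_mono mult_left_mono power_mono simp: less_imp_le\<close>)
  have BM: "B j \<le> CB * H ^ j * M j" for j
    by (rule order_trans[OF HB(3)])
      (use H HB(1,2) posM in \<open>auto intro!: mult_right_mono mult_left_mono power_mono simp: less_imp_le\<close>)
  obtain d :: nat where d: "max \<bar>m\<bar> \<bar>\<mu>\<bar> \<le> real d" using real_arch_simple by blast
  let ?c = "(1 + sqrt (real CARD('n))) ^ d"
  have c: "0 \<le> ?c" by (intro zero_le_power add_nonneg_nonneg) auto
  have "\<exists>P. symbol_bound M (H / h) P d p" if h: "0 < h" and p: "p \<in> SG_step m \<mu> A B h"
    for h and p :: "(real ^ 'n) \<times> (real ^ 'n) \<Rightarrow> complex"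
  proof -
    have sp: "smooth p" using p by (simp add: SG_step_def)
    obtain P0 where P0: "\<And>z. sg_quotient m \<mu> A B h p z \<le> P0"
      using p by (auto simp: SG_step_def bdd_above_def)
    define P1 where "P1 = max 0 P0"
    have P1: "0 \<le> P1" "\<And>z. sg_quotient m \<mu> A B h p z \<le> P1"
      using P0 by (auto simp: P1_def le_max_iff_disj)
    have "symbol_bound M (H / h) (P1 * (CA * CB * ?c * ?c)) d p"
      unfolding symbol_bound_def
    proof (intro conjI allI impI sp)
      fix l :: "real ^ 'n" and b and vs :: "(real ^ 'n) list" and x \<xi> :: "real ^ 'n"
      assume l: "l \<in> Basis" and vs: "set vs \<subseteq> Basis"
      obtain j where j: "l = axis j 1" using l by (auto simp: Basis_vec_def)
      obtain js :: "'n list" where js: "vs = map (\<lambda>i. axis i 1) js"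
        by (rule Basis_list_eq_map_axis[OF vs])
      let ?n = "length vs"
      let ?D = "iter_deriv (replicate b (0, l) @ map (\<lambda>v. (v, 0)) vs) p (x, \<xi>)"
      let ?Y = "iter_deriv (replicate b (0, l)) p"
      have inner: "mi_deriv (count_list (replicate b j)) (\<lambda>\<eta>. p (y, \<eta>)) \<xi> = ?Y (y, \<xi>)" for y
        by (subst mi_deriv_eq_iter_deriv[OF smooth_slice_snd[OF sp], of "replicate b j"])
          (simp_all add: iter_deriv_slice_snd sp j)
      have "mi_deriv (count_list js) (\<lambda>y. ?Y (y, \<xi>)) x = iter_deriv (map (\<lambda>v. (v, 0)) vs) ?Y (x, \<xi>)"
        by (subst mi_deriv_eq_iter_deriv[OF smooth_slice_fst[OF smooth_iter_deriv[OF sp]], of js])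
          (simp_all add: iter_deriv_slice_fst smooth_iter_deriv sp js)
      also have "\<dots> = iter_deriv (map (\<lambda>v. (v, 0)) vs @ replicate b (0, l)) p (x, \<xi>)"
        by (simp add: iter_deriv_append)
      \<comment> \<open>The symbol quotient applies the \<xi>-derivatives first; commutation brings
        the list into the order used in \<open>symbol_bound\<close>.\<close>
      also have "\<dots> = ?D"
        by (rule fun_cong[OF iter_deriv_mset_cong[OF sp]]) simp
      finally have D: "mi_deriv (count_list js)
          (\<lambda>y. mi_deriv (count_list (replicate b j)) (\<lambda>\<eta>. p (y, \<eta>)) \<xi>) x = ?D"
        by (simp add: inner)
      let ?W = "jbracket \<xi> powr (- \<mu> + real b) * jbracket x powr (- m + real ?n)"
      \<comment> \<open>The reciprocal of \<open>?W\<close>, used to carry the bracket powers to the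
        right-hand side.\<close>
      let ?W' = "jbracket \<xi> powr (\<mu> - real b) * jbracket x powr (m - real ?n)"
      have jpos: "0 < jbracket x" "0 < jbracket \<xi>"
        using jbracket_ge_1[of x] jbracket_ge_1[of \<xi>] by linarith+
      have WW: "?W * ?W' = 1"
        using jpos by (simp flip: powr_add add: algebra_simps)
      have "h ^ (b + ?n) * (?W / (A b * B ?n)) * cmod ?D \<le> P1"
        using P1(2)[of "(count_list (replicate b j), count_list js, x, \<xi>)"]
        by (simp only: sg_quotient_def case_prod_conv mi_order_count_list D length_replicate)
          (simp add: js)
      then have "(h ^ (b + ?n) * (?W / (A b * B ?n)) * cmod ?D) * ((A b * B ?n) * (1 / h) ^ (b + ?n) * ?W') \<le>
          P1 * ((A b * B ?n) * (1 / h) ^ (b + ?n) * ?W')"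
        using h posA[of b] posB[of ?n] by (intro mult_right_mono) auto
      moreover have "(h ^ (b + ?n) * (?W / (A b * B ?n)) * cmod ?D) * ((A b * B ?n) * (1 / h) ^ (b + ?n) * ?W')
          = (?W * ?W') * cmod ?D"
        using h posA[of b] posB[of ?n] by (simp add: power_divide field_simps)
      ultimately have "cmod ?D \<le> P1 * ((A b * B ?n) * (1 / h) ^ (b + ?n) * ?W')"
        unfolding WW by simp
      also have "\<dots> \<le> P1 * (((CA * H ^ b * M b) * (CB * H ^ ?n * M ?n)) * (1 / h) ^ (b + ?n) *
          ((?c * (1 + infnorm \<xi>) ^ d) * (?c * (1 + infnorm x) ^ d)))"
      proof (intro mult_left_mono mult_mono AM BM jbracket_powr_le)
        show "\<mu> - real b \<le> real d" "m - real ?n \<le> real d" using d by auto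
      qed (use P1(1) HA(1) HB(1) H(1) h posA posB posM c in
          \<open>auto intro!: mult_nonneg_nonneg zero_le_power add_nonneg_nonneg simp: less_imp_le\<close>)
      also have "\<dots> = P1 * (CA * CB * ?c * ?c) * (H / h) ^ (b + ?n) * (M b * M ?n) *
          (1 + infnorm x) ^ d * (1 + infnorm \<xi>) ^ d"
        by (simp add: power_add power_divide ac_simps)
      finally show "cmod ?D \<le> P1 * (CA * CB * ?c * ?c) * (H / h) ^ (b + ?n) * (M b * M ?n) *
          (1 + infnorm x) ^ d * (1 + infnorm \<xi>) ^ d" .
    qed
    then show ?thesis by blast
  qed
  with H(1) show thesis using that by blast
qed

section \<open>Linear structure of the spaces and monotonicity in h\<close>

lemma mi_deriv_list:
  fixes \<alpha> :: "'n::finite \<Rightarrow> nat"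
  obtains vs where "\<And>f. smooth f \<Longrightarrow> mi_deriv \<alpha> f = iter_deriv vs f"
proof -
  obtain js where js: "count_list js = \<alpha>" by (rule multi_index_list)
  show thesis
    by (rule that, rule mi_deriv_eq_iter_deriv[where js=js]) (simp_all add: js)
qed

lemma gs_quotient_add_le:
  assumes "weight_sequence M" "0 < h" "smooth f" "smooth g"
  shows "gs_quotient M h (\<lambda>x. f x + g x) z \<le> gs_quotient M h f z + gs_quotient M h g z"
proof -
  obtain \<alpha> \<beta> x where z: "z = (\<alpha>, \<beta>, x)" by (cases z) auto
  obtain vs where vs: "\<And>f. smooth f \<Longrightarrow> mi_deriv \<alpha> f = iter_deriv vs f"
    using mi_deriv_list[of \<alpha>] by blast
  let ?c = "h ^ (mi_order \<alpha> + mi_order \<beta>) / (M (mi_order \<alpha>) * M (mi_order \<beta>))"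
  have "0 \<le> ?c"
    using assms(2) weight_pos[OF assms(1)] by (simp add: less_imp_le)
  moreover have "cmod (complex_of_real (mi_monomial x \<beta>) * mi_deriv \<alpha> (\<lambda>x. f x + g x) x) \<le>
      cmod (complex_of_real (mi_monomial x \<beta>) * mi_deriv \<alpha> f x)
      + cmod (complex_of_real (mi_monomial x \<beta>) * mi_deriv \<alpha> g x)"
    by (simp only: vs smooth_add assms iter_deriv_add distrib_left norm_triangle_ineq)
  ultimately show ?thesis
    unfolding z gs_quotient_def case_prod_conv distrib_left[symmetric] by (rule mult_left_mono[rotated])
qed

lemma gs_quotient_cmult:
  assumes "smooth f"
  shows "gs_quotient M h (\<lambda>x. c * f x) z = cmod c * gs_quotient M h f z"
proof -
  obtain \<alpha> \<beta> x where z: "z = (\<alpha>, \<beta>, x)" by (cases z) auto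
  obtain vs where vs: "\<And>f. smooth f \<Longrightarrow> mi_deriv \<alpha> f = iter_deriv vs f"
    using mi_deriv_list[of \<alpha>] by blast
  show ?thesis
    unfolding z gs_quotient_def case_prod_conv
    by (simp add: vs smooth_mult assms iter_deriv_cmult norm_mult)
qed

lemma GS_step_add:
  assumes M: "weight_sequence M" and h: "0 < h" and f: "f \<in> GS_step M h" and g: "g \<in> GS_step M h"
  shows "(\<lambda>x. f x + g x) \<in> GS_step M h"
    and "GS_norm M h (\<lambda>x. f x + g x) \<le> GS_norm M h f + GS_norm M h g"
proof -
  note sm = GS_step_smooth[OF f] GS_step_smooth[OF g]
  have "gs_quotient M h (\<lambda>x. f x + g x) z \<le> GS_norm M h f + GS_norm M h g" for z
    by (rule order_trans[OF gs_quotient_add_le[OF M h sm]])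
      (intro add_mono gs_quotient_le_norm f g)
  from GS_stepI[OF smooth_add[OF sm] this]
  show "(\<lambda>x. f x + g x) \<in> GS_step M h"
    and "GS_norm M h (\<lambda>x. f x + g x) \<le> GS_norm M h f + GS_norm M h g" by auto
qed

lemma GS_step_cmult:
  assumes f: "f \<in> GS_step M h"
  shows "(\<lambda>x. c * f x) \<in> GS_step M h"
    and "GS_norm M h (\<lambda>x. c * f x) = cmod c * GS_norm M h f"
proof -
  have le: "(\<lambda>x. c * f x) \<in> GS_step M h \<and> GS_norm M h (\<lambda>x. c * f x) \<le> cmod c * GS_norm M h f"
    if f: "f \<in> GS_step M h" for c f
  proof -
    have "gs_quotient M h (\<lambda>x. c * f x) z \<le> cmod c * GS_norm M h f" for z
      unfolding gs_quotient_cmult[OF GS_step_smooth[OF f]]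
      by (intro mult_left_mono gs_quotient_le_norm f) simp
    from GS_stepI[OF smooth_mult[OF smooth_const GS_step_smooth[OF f]] this]
    show ?thesis by auto
  qed
  show mem: "(\<lambda>x. c * f x) \<in> GS_step M h" using le[OF f] by blast
  show "GS_norm M h (\<lambda>x. c * f x) = cmod c * GS_norm M h f"
  proof (cases "c = 0")
    case True
    have "gs_quotient M h (\<lambda>x. c * f x) = (\<lambda>_. 0)"
      by (rule ext) (simp add: True gs_quotient_def mi_deriv_zero case_prod_beta)
    then show ?thesis by (simp add: GS_norm_def True)
  next
    case False
    \<comment> \<open>The inequality for the scalar \<open>1 / c\<close>, applied to the multiple of
      f by c, gives the reverse bound.\<close>
    have "GS_norm M h (\<lambda>x. (1 / c) * (c * f x)) \<le> cmod (1 / c) * GS_norm M h (\<lambda>x. c * f x)"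
      using le[OF mem] by blast
    then have "cmod c * GS_norm M h f \<le> GS_norm M h (\<lambda>x. c * f x)"
      using False by (simp add: norm_divide field_simps)
    with le[OF f, of c] show ?thesis by simp
  qed
qed

lemma GS_norm_nonneg:
  assumes "weight_sequence M" "0 < h" "f \<in> GS_step M h"
  shows "0 \<le> GS_norm M h f"
  by (rule schwartz_bound_nonneg[OF assms(1) GS_step_schwartz_bound[OF assms]])

lemma GS_step_mono:
  assumes M: "weight_sequence M" and h: "0 < h" "h \<le> h'" and f: "f \<in> GS_step M h'"
  shows "f \<in> GS_step M h" "GS_norm M h f \<le> GS_norm M h' f"
proof -
  have "gs_quotient M h f z \<le> GS_norm M h' f" for z
  proof (rule order_trans[OF _ gs_quotient_le_norm[OF f]])
    show "gs_quotient M h f z \<le> gs_quotient M h' f z"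
      using h weight_pos[OF M] unfolding gs_quotient_def
      by (cases z) (auto intro!: mult_right_mono divide_right_mono power_mono simp: less_imp_le)
  qed
  from GS_stepI[OF GS_step_smooth[OF f] this]
  show "f \<in> GS_step M h" "GS_norm M h f \<le> GS_norm M h' f" by auto
qed

lemma SG_step_mono:
  assumes "weight_sequence A" "weight_sequence B" and h: "0 < h" "h \<le> h'"
    and p: "p \<in> SG_step m \<mu> A B h'"
  shows "p \<in> SG_step m \<mu> A B h"
proof -
  obtain K where K: "\<And>z. sg_quotient m \<mu> A B h' p z \<le> K"
    using p by (auto simp: SG_step_def bdd_above_def)
  have "sg_quotient m \<mu> A B h p z \<le> K" for z
  proof (rule order_trans[OF _ K])
    show "sg_quotient m \<mu> A B h p z \<le> sg_quotient m \<mu> A B h' p z"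
      using h weight_pos[OF assms(1)] weight_pos[OF assms(2)] unfolding sg_quotient_def
      by (cases z) (simp only: case_prod_conv, intro mult_right_mono power_mono;
          auto intro!: mult_nonneg_nonneg divide_nonneg_pos simp: less_imp_le)
  qed
  then show ?thesis using p by (auto simp: SG_step_def intro!: bdd_aboveI[of _ K])
qed

lemma GS_add:
  assumes M: "weight_sequence M" and f: "f \<in> GS r M" and g: "g \<in> GS r M"
  shows "(\<lambda>x. f x + g x) \<in> GS r M"
proof (cases r)
  case Roumieu
  then obtain h1 h2 where "0 < h1" "f \<in> GS_step M h1" "0 < h2" "g \<in> GS_step M h2"
    using f g by (auto simp: GS_def limit_space_def)
  then have "0 < min h1 h2" "f \<in> GS_step M (min h1 h2)" "g \<in> GS_step M (min h1 h2)"
    using GS_step_mono(1)[OF M, of "min h1 h2" h1 f] GS_step_mono(1)[OF M, of "min h1 h2" h2 g] by auto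
  then show ?thesis
    using GS_step_add(1)[OF M, of "min h1 h2" f g] Roumieu
    unfolding GS_def limit_space_def by (auto intro!: bexI[of _ "min h1 h2"])
next
  case Beurling
  then show ?thesis
    using f g GS_step_add(1)[OF M, of _ f g] by (auto simp: GS_def limit_space_def)
qed

lemma GS_cmult:
  assumes "f \<in> GS r M"
  shows "(\<lambda>x. c * f x) \<in> GS r M"
  using assms GS_step_cmult(1)[of f] by (cases r) (auto simp: GS_def limit_space_def)

lemma GS_diff:
  assumes "weight_sequence M" "f \<in> GS r M" "g \<in> GS r M"
  shows "(\<lambda>x. f x - g x) \<in> GS r M"
  using GS_add[OF assms(1,2) GS_cmult[OF assms(3), of "-1"]] by simp

lemma GS_limit_seminorm:
  fixes q :: "(real ^ 'n::finite \<Rightarrow> complex) \<Rightarrow> real"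
  assumes M: "weight_sequence M" and q: "q \<in> limit_seminorms r (GS_step M) (GS_norm M)"
  shows "is_seminorm_on (GS r M) q"
proof (cases r)
  case Roumieu
  then show ?thesis using q by (simp add: limit_seminorms_def GS_def)
next
  case Beurling
  then obtain h where h: "0 < h" "q = GS_norm M h"
    using q by (auto simp: limit_seminorms_def)
  have "f \<in> GS_step M h" if "f \<in> GS r M" for f :: "real ^ 'n \<Rightarrow> complex"
    using that h(1) Beurling by (auto simp: GS_def limit_space_def)
  then show ?thesis
    unfolding is_seminorm_on_def h(2)
    by (auto intro: GS_step_add(2)[OF M h(1)] GS_step_cmult(2) GS_norm_nonneg[OF M h(1)])
qed

section \<open>Continuity in topologies generated by seminorms\<close>

lemma seminorm_on_nonneg: "is_seminorm_on V q \<Longrightarrow> f \<in> V \<Longrightarrow> 0 \<le> q f"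
  and seminorm_on_add: "is_seminorm_on V q \<Longrightarrow> f \<in> V \<Longrightarrow> g \<in> V \<Longrightarrow> q (\<lambda>x. f x + g x) \<le> q f + q g"
  and seminorm_on_cmult: "is_seminorm_on V q \<Longrightarrow> f \<in> V \<Longrightarrow> q (\<lambda>x. c * f x) = cmod c * q f"
  by (auto simp: is_seminorm_on_def)

text \<open>Balls with arbitrary centres generate the topology, so it suffices that the preimage of
  each one contains a ball around each of its points. Compatibility of \<open>T\<close> with
  differences moves the centre.\<close>

lemma continuous_map_seminorm_topology:
  assumes T: "\<And>f. f \<in> V \<Longrightarrow> T f \<in> V"
    and diff: "\<And>f g. f \<in> V \<Longrightarrow> g \<in> V \<Longrightarrow> (\<lambda>x. f x - g x) \<in> V"
    and T_diff: "\<And>f g. f \<in> V \<Longrightarrow> g \<in> V \<Longrightarrow> T (\<lambda>x. f x - g x) = (\<lambda>x. T f x - T g x)"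
    and Q: "\<And>q. q \<in> Q \<Longrightarrow> is_seminorm_on V q"
    and bound: "\<And>q. q \<in> Q \<Longrightarrow> \<exists>q'\<in>Q. \<exists>C\<ge>0. \<forall>f\<in>V. q (T f) \<le> C * q' f"
  shows "continuous_map (seminorm_topology V Q) (seminorm_topology V Q) T"
proof -
  let ?S = "{{g \<in> V. q (\<lambda>x. g x - f x) < \<epsilon>} | q f \<epsilon>. q \<in> Q \<and> f \<in> V \<and> 0 < \<epsilon>}"
  have zero: "q (\<lambda>x. f x - f x) = 0" if "q \<in> Q" "f \<in> V" for q f
    using seminorm_on_cmult[OF Q[OF that(1)] that(2), of 0] by simp
  have ball: "openin (seminorm_topology V Q) {g \<in> V. q (\<lambda>x. g x - f x) < \<epsilon>}"
    if "q \<in> Q" "f \<in> V" "0 < \<epsilon>" for q f \<epsilon>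
    unfolding seminorm_topology_def using that by (intro topology_generated_by_Basis) blast
  have top: "topspace (seminorm_topology V Q) \<subseteq> V"
    unfolding seminorm_topology_def topology_generated_by_topspace by blast
  have "continuous_map (seminorm_topology V Q) (topology_generated_by ?S) T"
  proof (rule continuous_on_generated_topo)
    fix U assume "U \<in> ?S"
    then obtain q f \<epsilon> where U: "U = {g \<in> V. q (\<lambda>x. g x - f x) < \<epsilon>}"
      and q: "q \<in> Q" and f: "f \<in> V" and \<epsilon>: "0 < \<epsilon>" by blast
    obtain q' C where q': "q' \<in> Q" and C: "0 \<le> C" and le: "\<And>f. f \<in> V \<Longrightarrow> q (T f) \<le> C * q' f"
      using bound[OF q] by blast
    show "openin (seminorm_topology V Q) (T -` U \<inter> topspace (seminorm_topology V Q))"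
    proof (subst openin_subopen, intro ballI)
      fix g assume g: "g \<in> T -` U \<inter> topspace (seminorm_topology V Q)"
      then have gV: "g \<in> V" and gU: "q (\<lambda>x. T g x - f x) < \<epsilon>" using top U by auto
      \<comment> \<open>The room left between \<open>T g\<close> and the boundary of
        \<open>U\<close>, divided by C + 1 rather than C so that C = 0 needs no separate
        case.\<close>
      define \<delta> where "\<delta> = (\<epsilon> - q (\<lambda>x. T g x - f x)) / (C + 1)"
      have \<delta>: "0 < \<delta>" using gU C by (simp add: \<delta>_def)
      let ?N = "{k \<in> V. q' (\<lambda>x. k x - g x) < \<delta>}"
      have N: "openin (seminorm_topology V Q) ?N" by (rule ball[OF q' gV \<delta>])
      moreover have "g \<in> ?N" using gV zero[OF q' gV] \<delta> by simp
      moreover have "?N \<subseteq> T -` U \<inter> topspace (seminorm_topology V Q)"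
      proof
        fix k assume k: "k \<in> ?N"
        then have kV: "k \<in> V" by blast
        have "q (\<lambda>x. (T k x - T g x) + (T g x - f x)) \<le> q (\<lambda>x. T k x - T g x) + q (\<lambda>x. T g x - f x)"
          by (rule seminorm_on_add[OF Q[OF q] diff[OF T[OF kV] T[OF gV]] diff[OF T[OF gV] f]])
        moreover have "q (\<lambda>x. T k x - T g x) \<le> C * q' (\<lambda>x. k x - g x)"
          using le[OF diff[OF kV gV]] T_diff[OF kV gV] by simp
        moreover have "C * q' (\<lambda>x. k x - g x) < (C + 1) * \<delta>"
        proof -
          have "0 \<le> q' (\<lambda>x. k x - g x)"
            by (rule seminorm_on_nonneg[OF Q[OF q'] diff[OF kV gV]])
          then have "C * q' (\<lambda>x. k x - g x) \<le> (C + 1) * q' (\<lambda>x. k x - g x)"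
            by (intro mult_right_mono) auto
          also have "\<dots> < (C + 1) * \<delta>"
            using k C by (intro mult_strict_left_mono) auto
          finally show ?thesis .
        qed
        moreover have "(C + 1) * \<delta> = \<epsilon> - q (\<lambda>x. T g x - f x)"
          using C by (simp add: \<delta>_def)
        ultimately have "q (\<lambda>x. T k x - f x) < \<epsilon>" by simp
        then have "T k \<in> U" using T[OF kV] U by simp
        moreover have "k \<in> topspace (seminorm_topology V Q)"
          using openin_subset[OF N] k by blast
        ultimately show "k \<in> T -` U \<inter> topspace (seminorm_topology V Q)" by simp
      qed
      ultimately show "\<exists>N. openin (seminorm_topology V Q) N \<and> g \<in> N \<and>
          N \<subseteq> T -` U \<inter> topspace (seminorm_topology V Q)"
        by (intro exI[of _ ?N] conjI)
    qed
  next
    show "T ` topspace (seminorm_topology V Q) \<subseteq> \<Union> ?S"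
    proof
      fix k assume "k \<in> T ` topspace (seminorm_topology V Q)"
      then obtain f where f: "f \<in> topspace (seminorm_topology V Q)" "k = T f" by blast
      \<comment> \<open>A point of the topspace lies in some generating ball, so \<open>Q\<close> is
        not empty; a ball centred at \<open>T f\<close> then covers \<open>T f\<close>.\<close>
      then obtain q where q: "q \<in> Q"
        unfolding seminorm_topology_def topology_generated_by_topspace by blast
      have "T f \<in> V" using f top T by blast
      then have "T f \<in> {g \<in> V. q (\<lambda>x. g x - T f x) < 1}" using zero[OF q] by simp
      then show "k \<in> \<Union> ?S" using q \<open>T f \<in> V\<close> zero_less_one f(2) by blast
    qed
  qed
  then show ?thesis by (simp add: seminorm_topology_def)
qed

section \<open>Pseudodifferential operators\<close>

text \<open>The normalising constant is moved into the symbol, so that the general estimate speaks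
  about the transform itself.\<close>

lemma fourier_eq_param_integral:
  "fourier u = param_integral
    (osc_symbol (-1) (\<lambda>_. complex_of_real ((2 * pi) powr (- real CARD('n) / 2))) u)"
  for u :: "real ^ 'n::finite \<Rightarrow> complex"
proof
  fix \<xi> :: "real ^ 'n"
  let ?c = "complex_of_real ((2 * pi) powr (- real CARD('n) / 2))"
  have "osc_symbol (-1) (\<lambda>_. ?c) u (\<xi>, x) = ?c * fourier_integrand u \<xi> x" for x
    by (simp add: osc_symbol_def osc_def fourier_integrand_def inner_commute)
  then show "fourier u \<xi> = param_integral (osc_symbol (-1) (\<lambda>_. ?c) u) \<xi>"
    by (simp add: fourier_def param_integral_def)
qed

lemma fourier_integrand_eq: "fourier_integrand u \<xi> = (\<lambda>x. osc_symbol (-1) (\<lambda>_. 1) u (\<xi>, x))"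
  by (simp add: osc_symbol_def osc_def fourier_integrand_def inner_commute)

lemma Op_integrand_eq: "Op_integrand p u x = (\<lambda>\<xi>. osc_symbol 1 p (fourier u) (x, \<xi>))"
  by (simp add: osc_symbol_def osc_def Op_integrand_def inner_commute mult.assoc)

lemma Op_eq_param_integral:
  "Op p u = param_integral
    (osc_symbol 1 (\<lambda>z. complex_of_real ((2 * pi) powr (- real CARD('n) / 2)) * p z) (fourier u))"
  for u :: "real ^ 'n::finite \<Rightarrow> complex"
proof
  fix x :: "real ^ 'n"
  let ?c = "complex_of_real ((2 * pi) powr (- real CARD('n) / 2))"
  have "osc_symbol 1 (\<lambda>z. ?c * p z) (fourier u) (x, \<xi>) = ?c * Op_integrand p u x \<xi>" for \<xi>
    by (simp add: Op_integrand_eq osc_symbol_def)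
  then show "Op p u x = param_integral (osc_symbol 1 (\<lambda>z. ?c * p z) (fourier u)) x"
    by (simp add: Op_def param_integral_def)
qed

text \<open>Two applications of the oscillatory estimate, from u to its transform and from there to
  \<open>Op p u\<close>. The constant C may depend on h and p; \<open>\<sigma>\<close> may not,
  since h varies in both limits.\<close>

lemma Op_estimate:
  fixes A B M :: "nat \<Rightarrow> real"
  assumes A: "weight_sequence A" "A \<preceq>\<^sub>w M" and B: "weight_sequence B" "B \<preceq>\<^sub>w M"
    and M: "weight_sequence M" "non_quasianalytic M"
  obtains \<sigma> where "0 < \<sigma>" "\<And>h (p :: (real ^ 'n::finite) \<times> (real ^ 'n) \<Rightarrow> complex).
    0 < h \<Longrightarrow> p \<in> SG_step m \<mu> A B h \<Longrightarrow> \<exists>C\<ge>0. \<forall>u\<in>GS_step M h.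
      (\<forall>\<xi>. integrable lborel (fourier_integrand u \<xi>)) \<and>
      (\<forall>x. integrable lborel (Op_integrand p u x)) \<and>
      Op p u \<in> GS_step M (\<sigma> * h) \<and> GS_norm M (\<sigma> * h) (Op p u) \<le> C * GS_norm M h u"
proof -
  obtain H d where H: "1 \<le> H" and sym: "\<And>h (p :: (real ^ 'n::finite) \<times> (real ^ 'n) \<Rightarrow> complex).
    0 < h \<Longrightarrow> p \<in> SG_step m \<mu> A B h \<Longrightarrow> \<exists>P. symbol_bound M (H / h) P d p"
    using SG_step_symbol_bound[OF A B M(1), where ?'n='n] by blast
  obtain \<rho> where \<rho>: "1 \<le> \<rho>" and key: "\<And>\<tau>. 0 < \<tau> \<Longrightarrow>
    \<exists>C>0. \<forall>s P K (p :: (real ^ 'n) \<times> (real ^ 'n) \<Rightarrow> complex) f.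
      \<bar>s\<bar> = 1 \<longrightarrow> symbol_bound M \<tau> P d p \<longrightarrow> schwartz_bound M \<tau> K f \<longrightarrow>
      dominated (osc_symbol s p f) \<and>
      schwartz_bound M (\<rho> * \<tau>) (C * (P * K)) (param_integral (osc_symbol s p f))"
    using osc_integral_schwartz_bound[OF M, where d=d and ?'a="real ^ 'n"] by blast
  \<comment> \<open>One \<open>\<rho>\<close> for each transform, the first replaced by
    \<open>H\<close> if the symbol forces the larger parameter. Then
    \<open>1 / (\<sigma> * h)\<close> equals \<open>\<rho> * \<tau>\<close> for the
    \<open>\<tau>\<close> chosen below.\<close>
  define \<sigma> where "\<sigma> = 1 / (\<rho> * max \<rho> H)"
  have \<sigma>: "0 < \<sigma>" using \<rho> by (simp add: \<sigma>_def)
  have "\<exists>C\<ge>0. \<forall>u\<in>GS_step M h.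
      (\<forall>\<xi>. integrable lborel (fourier_integrand u \<xi>)) \<and>
      (\<forall>x. integrable lborel (Op_integrand p u x)) \<and>
      Op p u \<in> GS_step M (\<sigma> * h) \<and> GS_norm M (\<sigma> * h) (Op p u) \<le> C * GS_norm M h u"
    if h: "0 < h" and p: "p \<in> SG_step m \<mu> A B h"
    for h and p :: "(real ^ 'n) \<times> (real ^ 'n) \<Rightarrow> complex"
  proof -
    let ?c = "complex_of_real ((2 * pi) powr (- real CARD('n) / 2))"
    \<comment> \<open>Large enough for the transform of u, controlled at \<open>\<rho> / h\<close>,
      and for the symbol, controlled at \<open>H / h\<close>.\<close>
    define \<tau> where "\<tau> = max \<rho> H / h"
    have \<tau>: "0 < 1 / h" "0 < \<tau>" "\<rho> * (1 / h) \<le> \<tau>" "H / h \<le> \<tau>"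
      using h \<rho> by (auto simp: \<tau>_def intro!: divide_right_mono divide_pos_pos)
    obtain P where "symbol_bound M (H / h) P d p" using sym[OF h p] by blast
    then have pP: "symbol_bound M \<tau> P d p"
      by (rule symbol_bound_mono[OF M(1) _ _ \<tau>(4)]) (use H h in simp)
    have P: "0 \<le> P" by (rule symbol_bound_nonneg[OF M(1) pP])
    obtain C1 where C1: "0 < C1" and key1: "\<And>s P K (p :: (real ^ 'n) \<times> (real ^ 'n) \<Rightarrow> complex) f.
      \<bar>s\<bar> = 1 \<Longrightarrow> symbol_bound M (1 / h) P d p \<Longrightarrow> schwartz_bound M (1 / h) K f \<Longrightarrow>
      dominated (osc_symbol s p f) \<and>
      schwartz_bound M (\<rho> * (1 / h)) (C1 * (P * K)) (param_integral (osc_symbol s p f))"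
      using key[OF \<tau>(1)] by blast
    obtain C2 where C2: "0 < C2" and key2: "\<And>s P K (p :: (real ^ 'n) \<times> (real ^ 'n) \<Rightarrow> complex) f.
      \<bar>s\<bar> = 1 \<Longrightarrow> symbol_bound M \<tau> P d p \<Longrightarrow> schwartz_bound M \<tau> K f \<Longrightarrow>
      dominated (osc_symbol s p f) \<and>
      schwartz_bound M (\<rho> * \<tau>) (C2 * (P * K)) (param_integral (osc_symbol s p f))"
      using key[OF \<tau>(2)] by blast
    define C where "C = C2 * ((cmod ?c * P) * (C1 * cmod ?c))"
    show ?thesis
    proof (intro exI[of _ C] conjI ballI allI)
      show "0 \<le> C" using C1 C2 P by (simp add: C_def)
      fix u :: "real ^ 'n \<Rightarrow> complex" assume u: "u \<in> GS_step M h"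
      note su = GS_step_schwartz_bound[OF M(1) h u]
      have neg1: "\<bar>- 1 :: real\<bar> = 1" by simp
      show "integrable lborel (fourier_integrand u \<xi>)" for \<xi>
        unfolding fourier_integrand_eq
        by (rule dominated_integrable[OF conjunct1[OF key1[OF neg1 symbol_bound_const[OF M(1) \<tau>(1)] su]]])
      have "schwartz_bound M (\<rho> * (1 / h)) (C1 * (cmod ?c * GS_norm M h u)) (fourier u)"
        unfolding fourier_eq_param_integral
        by (rule conjunct2[OF key1[OF neg1 symbol_bound_const[OF M(1) \<tau>(1)] su]])
      then have su': "schwartz_bound M \<tau> (C1 * (cmod ?c * GS_norm M h u)) (fourier u)"
        by (rule schwartz_bound_mono[OF M(1) _ _ \<tau>(3)]) (use \<rho> h in simp)
      show "integrable lborel (Op_integrand p u x)" for x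
        unfolding Op_integrand_eq
        by (rule dominated_integrable[OF conjunct1[OF key2[OF abs_one pP su']]])
      have "schwartz_bound M (\<rho> * \<tau>) (C2 * ((cmod ?c * P) * (C1 * (cmod ?c * GS_norm M h u)))) (Op p u)"
        unfolding Op_eq_param_integral
        by (rule conjunct2[OF key2[OF abs_one symbol_bound_cmult[OF pP] su']])
      then have "schwartz_bound M (1 / (\<sigma> * h)) (C * GS_norm M h u) (Op p u)"
        by (simp add: \<sigma>_def \<tau>_def C_def ac_simps)
      then show "Op p u \<in> GS_step M (\<sigma> * h)" "GS_norm M (\<sigma> * h) (Op p u) \<le> C * GS_norm M h u"
        by (auto intro: schwartz_bound_GS_step[OF M(1) mult_pos_pos[OF \<sigma> h]])
    qed
  qed
  with \<sigma> show thesis using that by blast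
qed

section \<open>Linearity of the operator and the final assembly\<close>

lemma fourier_add:
  assumes "\<And>\<xi>. integrable lborel (fourier_integrand u \<xi>)" "\<And>\<xi>. integrable lborel (fourier_integrand v \<xi>)"
  shows "fourier (\<lambda>x. u x + v x) = (\<lambda>\<xi>. fourier u \<xi> + fourier v \<xi>)"
proof
  fix \<xi>
  have "fourier_integrand (\<lambda>x. u x + v x) \<xi> = (\<lambda>x. fourier_integrand u \<xi> x + fourier_integrand v \<xi> x)"
    by (simp add: fourier_integrand_def distrib_left)
  then show "fourier (\<lambda>x. u x + v x) \<xi> = fourier u \<xi> + fourier v \<xi>"
    using assms by (simp add: fourier_def distrib_left)
qed

lemma fourier_cmult: "fourier (\<lambda>x. c * u x) = (\<lambda>\<xi>. c * fourier u \<xi>)"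
proof
  fix \<xi>
  have "fourier_integrand (\<lambda>x. c * u x) \<xi> = (\<lambda>x. c * fourier_integrand u \<xi> x)"
    by (simp add: fourier_integrand_def ac_simps)
  then show "fourier (\<lambda>x. c * u x) \<xi> = c * fourier u \<xi>"
    by (simp add: fourier_def)
qed

lemma Op_add:
  assumes "\<And>\<xi>. integrable lborel (fourier_integrand u \<xi>)" "\<And>\<xi>. integrable lborel (fourier_integrand v \<xi>)"
    and "\<And>x. integrable lborel (Op_integrand p u x)" "\<And>x. integrable lborel (Op_integrand p v x)"
  shows "Op p (\<lambda>x. u x + v x) = (\<lambda>x. Op p u x + Op p v x)"
proof
  fix x
  have "Op_integrand p (\<lambda>x. u x + v x) x = (\<lambda>\<xi>. Op_integrand p u x \<xi> + Op_integrand p v x \<xi>)"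
    by (simp add: Op_integrand_def fourier_add assms distrib_left)
  then show "Op p (\<lambda>x. u x + v x) x = Op p u x + Op p v x"
    using assms by (simp add: Op_def distrib_left)
qed

lemma Op_cmult: "Op p (\<lambda>x. c * u x) = (\<lambda>x. c * Op p u x)"
proof
  fix x
  have "Op_integrand p (\<lambda>x. c * u x) x = (\<lambda>\<xi>. c * Op_integrand p u x \<xi>)"
    by (simp add: Op_integrand_def fourier_cmult ac_simps)
  then show "Op p (\<lambda>x. c * u x) x = c * Op p u x"
    by (simp add: Op_def)
qed

theorem theorem3p1:
  fixes A B M :: "nat \<Rightarrow> real" and m \<mu> :: real and r :: regime
    and p :: "(real ^ 'n::finite) \<times> (real ^ 'n) \<Rightarrow> complex"
  assumes "weight_sequence A" and "non_quasianalytic A"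
    and "weight_sequence B" and "non_quasianalytic B"
    and "weight_sequence M" and "non_quasianalytic M"
    and "A \<preceq>\<^sub>w M" and "B \<preceq>\<^sub>w M"
    and "p \<in> SG r m \<mu> A B"
  shows
    "(\<forall>u\<in>GS r M. (\<forall>\<xi>. integrable lborel (fourier_integrand u \<xi>)) \<and>
                  (\<forall>x. integrable lborel (Op_integrand p u x))) \<and>
     (\<forall>u\<in>GS r M. Op p u \<in> GS r M) \<and>
     (\<forall>u\<in>GS r M. \<forall>v\<in>GS r M. Op p (\<lambda>x. u x + v x) = (\<lambda>x. Op p u x + Op p v x)) \<and>
     (\<forall>c. \<forall>u\<in>GS r M. Op p (\<lambda>x. c * u x) = (\<lambda>x. c * Op p u x)) \<and>
     continuous_map (GS_topology r M) (GS_topology r M) (Op p)"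
proof -
  note A = assms(1,7) and B = assms(3,8) and M = assms(5,6)
  obtain \<sigma> where \<sigma>: "0 < \<sigma>" and est: "\<And>h (p :: (real ^ 'n::finite) \<times> (real ^ 'n) \<Rightarrow> complex).
    0 < h \<Longrightarrow> p \<in> SG_step m \<mu> A B h \<Longrightarrow> \<exists>C\<ge>0. \<forall>u\<in>GS_step M h.
      (\<forall>\<xi>. integrable lborel (fourier_integrand u \<xi>)) \<and>
      (\<forall>x. integrable lborel (Op_integrand p u x)) \<and>
      Op p u \<in> GS_step M (\<sigma> * h) \<and> GS_norm M (\<sigma> * h) (Op p u) \<le> C * GS_norm M h u"
    using Op_estimate[OF A B M, where ?'n='n] by blast
  \<comment> \<open>In the Roumieu case u and p come with parameters of their own, and the smaller
    one serves both. In the Beurling case every h is admissible.\<close>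
  have common: "\<exists>h>0. u \<in> GS_step M h \<and> p \<in> SG_step m \<mu> A B h" if u: "u \<in> GS r M" for u
  proof (cases r)
    case Roumieu
    then obtain h1 h2 where h: "0 < h1" "u \<in> GS_step M h1" "0 < h2" "p \<in> SG_step m \<mu> A B h2"
      using u assms(9) by (auto simp: GS_def SG_def limit_space_def)
    then have "0 < min h1 h2" "u \<in> GS_step M (min h1 h2)" "p \<in> SG_step m \<mu> A B (min h1 h2)"
      using GS_step_mono(1)[OF M(1), of "min h1 h2" h1] SG_step_mono[OF A(1) B(1), of "min h1 h2" h2] by auto
    then show ?thesis by blast
  next
    case Beurling
    then have "u \<in> GS_step M 1" "p \<in> SG_step m \<mu> A B 1"
      using u assms(9) by (auto simp: GS_def SG_def limit_space_def)
    then show ?thesis using zero_less_one by blast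
  qed
  have int: "integrable lborel (fourier_integrand u \<xi>)" "integrable lborel (Op_integrand p u x)"
    if "u \<in> GS r M" for u \<xi> x
    using common[OF that] est by blast+
  have maps: "Op p u \<in> GS r M" if u: "u \<in> GS r M" for u
  proof (cases r)
    case Roumieu
    obtain h where "0 < h" "u \<in> GS_step M h" "p \<in> SG_step m \<mu> A B h" using common[OF u] by blast
    then have "Op p u \<in> GS_step M (\<sigma> * h)" "0 < \<sigma> * h" using est \<sigma> by auto
    then show ?thesis using Roumieu by (auto simp: GS_def limit_space_def)
  next
    case Beurling
    have "Op p u \<in> GS_step M h" if h: "0 < h" for h
    proof -
      \<comment> \<open>Starting from \<open>h / \<sigma>\<close> makes the image land exactly at h,
        which is possible because u and p admit all parameters.\<close>
      have "0 < h / \<sigma>" "u \<in> GS_step M (h / \<sigma>)" "p \<in> SG_step m \<mu> A B (h / \<sigma>)"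
        using u assms(9) Beurling h \<sigma> by (auto simp: GS_def SG_def limit_space_def)
      then have "Op p u \<in> GS_step M (\<sigma> * (h / \<sigma>))" using est by blast
      then show ?thesis using \<sigma> by simp
    qed
    then show ?thesis using Beurling by (auto simp: GS_def limit_space_def)
  qed
  have add: "Op p (\<lambda>x. u x + v x) = (\<lambda>x. Op p u x + Op p v x)" if "u \<in> GS r M" "v \<in> GS r M" for u v
    by (intro Op_add int that)
  have "Op p (\<lambda>x. u x - v x) = (\<lambda>x. Op p u x - Op p v x)" if "u \<in> GS r M" "v \<in> GS r M" for u v
    using add[OF that(1) GS_cmult[OF that(2), of "-1"]] by (simp add: Op_cmult[of p "-1", simplified])
  moreover have "\<exists>q'\<in>limit_seminorms r (GS_step M) (GS_norm M). \<exists>C\<ge>0. \<forall>f\<in>GS r M. q (Op p f) \<le> C * q' f"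
    if q: "q \<in> limit_seminorms r (GS_step M) (GS_norm M)" for q
  proof (cases r)
    \<comment> \<open>The pullback of q under \<open>Op p\<close> is itself an admissible seminorm
      and serves as q' with C = 1. What has to be checked is that it is bounded on every step
      space.\<close>
    case Roumieu
    obtain h2 where h2: "0 < h2" "p \<in> SG_step m \<mu> A B h2"
      using assms(9) Roumieu by (auto simp: SG_def limit_space_def)
    have "\<exists>C. \<forall>f\<in>GS_step M h1. q (Op p f) \<le> C * GS_norm M h1 f" if h1: "0 < h1" for h1
    proof -
      \<comment> \<open>The symbol is known only at \<open>h2\<close>, so larger \<open>h1\<close>
        are reduced to it; the norm at the smaller parameter does not exceed the one at
        \<open>h1\<close>.\<close>
      define h where "h = min h1 h2"
      have h: "0 < h" "h \<le> h1" "h \<le> h2" using h1 h2 by (auto simp: h_def)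
      have ph: "p \<in> SG_step m \<mu> A B h" by (rule SG_step_mono[OF A(1) B(1) h(1,3) h2(2)])
      obtain C where C: "0 \<le> C" "\<And>u. u \<in> GS_step M h \<Longrightarrow> Op p u \<in> GS_step M (\<sigma> * h) \<and>
          GS_norm M (\<sigma> * h) (Op p u) \<le> C * GS_norm M h u"
        using est[OF h(1) ph] by blast
      have \<sigma>h: "0 < \<sigma> * h" using \<sigma> h by simp
      then obtain D where D: "\<forall>f\<in>GS_step M (\<sigma> * h). q f \<le> D * GS_norm M (\<sigma> * h) f"
        using q Roumieu by (auto simp: limit_seminorms_def)
      have "q (Op p f) \<le> (\<bar>D\<bar> * C) * GS_norm M h1 f" if f: "f \<in> GS_step M h1" for f
      proof -
        note fh = GS_step_mono[OF M(1) h(1,2) f]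
        have "q (Op p f) \<le> D * GS_norm M (\<sigma> * h) (Op p f)" using C(2)[OF fh(1)] D by blast
        also have "\<dots> \<le> \<bar>D\<bar> * GS_norm M (\<sigma> * h) (Op p f)"
          using C(2)[OF fh(1)] GS_norm_nonneg[OF M(1) \<sigma>h] by (intro mult_right_mono) auto
        also have "\<dots> \<le> \<bar>D\<bar> * (C * GS_norm M h1 f)"
          using C(2)[OF fh(1)] mult_left_mono[OF fh(2) C(1)] by (intro mult_left_mono) auto
        finally show ?thesis by (simp add: mult.assoc)
      qed
      then show ?thesis by blast
    qed
    moreover have "is_seminorm_on (GS r M) (\<lambda>f. q (Op p f))"
      using GS_limit_seminorm[OF M(1) q] maps add by (simp add: is_seminorm_on_def Op_cmult)
    ultimately have "(\<lambda>f. q (Op p f)) \<in> limit_seminorms r (GS_step M) (GS_norm M)"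
      using Roumieu by (simp add: limit_seminorms_def GS_def)
    then show ?thesis by (intro bexI[of _ "\<lambda>f. q (Op p f)"] exI[of _ 1]) auto
  next
    case Beurling
    then obtain h where h: "0 < h" "q = GS_norm M h"
      using q by (auto simp: limit_seminorms_def)
    \<comment> \<open>The image norm at h is controlled by the source norm at
      \<open>h / \<sigma>\<close>, which is again one of the generating norms.\<close>
    define k where "k = h / \<sigma>"
    have k: "0 < k" "\<sigma> * k = h" using h \<sigma> by (auto simp: k_def)
    have "p \<in> SG_step m \<mu> A B k" using assms(9) Beurling k by (auto simp: SG_def limit_space_def)
    then obtain C where C: "0 \<le> C" "\<And>u. u \<in> GS_step M k \<Longrightarrow> GS_norm M h (Op p u) \<le> C * GS_norm M k u"
      using est[OF k(1)] unfolding k(2) by blast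
    have "f \<in> GS_step M k" if "f \<in> GS r M" for f :: "real ^ 'n \<Rightarrow> complex"
      using that Beurling k by (auto simp: GS_def limit_space_def)
    with C have "\<forall>f\<in>GS r M. q (Op p f) \<le> C * GS_norm M k f" by (simp add: h(2))
    moreover have "GS_norm M k \<in> limit_seminorms r (GS_step M) (GS_norm M)"
      using Beurling k(1) by (simp add: limit_seminorms_def)
    ultimately show ?thesis using C(1) by blast
  qed
  ultimately have "continuous_map (GS_topology r M) (GS_topology r M) (Op p)"
    unfolding GS_topology_def limit_topology_def GS_def[symmetric]
    by (intro continuous_map_seminorm_topology maps GS_diff[OF M(1)] GS_limit_seminorm[OF M(1)])
  then show ?thesis
    using int maps add by (simp add: Op_cmult)
qed

end
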